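(* Let $R$ be a graded-commutative noetherian ring and $\mathcal{T}$ a compactly generated $R$-linear triangulated category. For any object $M\in\mathcal T$ and any sequence of elements $x_1,\ldots,x_t$ in $R$, there exists an isomorphism $$\mathrm{hocolim}_n\,\Sigma^{-t}M/\!\!/(x_1^n,\ldots,x_t^n)\xrightarrow{\ \cong\ }\Gamma_{\mathcal V(x_1,\ldots,x_t)}M\,.$$
   Context: A graded-commutative ring is a $\mathbb{Z}$-graded ring $R=\bigoplus_n R_n$ with $xy=(-1)^{|x||y|}yx$; all elements and ideals are homogeneous. A triangulated category $\mathcal{T}$ with suspension $\Sigma$ is $R$-linear if it is equipped with a homomorphism of graded rings $R\to Z^*(\mathcal{T})=\bigoplus_{n\in\mathbb{Z}}\{\alpha\colon \mathrm{id}_{\mathcal T}\to\Sigma^n \text{ natural}\mid \alpha\Sigma=(-1)^n\Sigma\alpha\}$; so $x\in R$ induces natural morphisms $x\colon M\to\Sigma^{|x|}M$. Koszul objects: $M/\!\!/x$ is the cone of $x\colon M\to\Sigma^{|x|}M$, with exact triangle $M\xrightarrow{x}\Sigma^{|x|}M\to M/\!\!/x\to\Sigma M$; inductively $M/\!\!/(x_1,\ldots,x_t)=(M/\!\!/(x_1,\ldots,x_{t-1}))/\!\!/x_t$. Structure maps of the system: write $K_{s,n}=\Sigma^{-s}M/\!\!/(x_1^n,\ldots,x_s^n)$. The homotopy colimit is taken along morphisms $u_{t,n}\colon K_{t,n}\to K_{t,n+1}$ constructed inductively: $u_{0,n}=\mathrm{id}_M$, and $u_{s,n}$ is any morphism such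 that $(u_{s,n},\,u_{s-1,n},\,x_s\circ\Sigma^{n|x_s|}u_{s-1,n})$ is a morphism from the exact triangle $K_{s,n}\to K_{s-1,n}\xrightarrow{x_s^n}\Sigma^{n|x_s|}K_{s-1,n}\to\Sigma K_{s,n}$ to the exact triangle $K_{s,n+1}\to K_{s-1,n+1}\xrightarrow{x_s^{n+1}}\Sigma^{(n+1)|x_s|}K_{s-1,n+1}\to\Sigma K_{s,n+1}$. The homotopy colimit of $M_1\xrightarrow{f_1}M_2\xrightarrow{f_2}\cdots$ is defined by the exact triangle $\coprod_nM_n\xrightarrow{\mathrm{id}-f_n}\coprod_nM_n\to\mathrm{hocolim}_nM_n\to\Sigma\coprod_nM_n$. Local cohomology functor: $\mathrm{Spec}(R)$ is the set of homogeneous primes, $\mathcal{V}(\mathfrak a)=\{\mathfrak p\mid\mathfrak a\subseteq\mathfrak p\}$. For $\mathcal{V}\subseteq\mathrm{Spec}(R)$ specialization closed, $\mathcal{T}_{\mathcal V}$ is the localizing subcategory generated by the compact objects $D$ with $\mathrm{End}^*_{\mathcal T}(D)_{\mathfrak p}=0$ for all $\mathfrak p\notin\mathcal V$, where $\mathrm{End}^*_{\mathcal T}(D)=\bigoplus_n\mathrm{Hom}_{\mathcal T}(D,\Sigma^nD)$. The functor $\Gamma_{\mathcal V}\colon\mathcal T\to\mathcal T$ is the composite of the right adjoint of the inclusion $\mathcal{T}_{\mathcal V}\to\mathcal{T}$ with the inclusion. *)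

theory Defs
  imports "HOL-Algebra.Ideal"
begin

section \<open>Categories, functors, adjunctions\<close>

record ('o, 'm) cat =
  Ob :: "'o set"
  Hom :: "'o \<Rightarrow> 'o \<Rightarrow> 'm set"
  Ident :: "'o \<Rightarrow> 'm"
  Comp :: "'m \<Rightarrow> 'm \<Rightarrow> 'm"  (infixl "\<bullet>\<index>" 70)

locale category =
  fixes T (structure)
  assumes Hom_disjoint: "\<lbrakk>X \<in> Ob T; Y \<in> Ob T; X' \<in> Ob T; Y' \<in> Ob T;
      f \<in> Hom T X Y; f \<in> Hom T X' Y'\<rbrakk> \<Longrightarrow> X = X' \<and> Y = Y'"
    and Ident_closed: "X \<in> Ob T \<Longrightarrow> Ident T X \<in> Hom T X X"
    and Comp_closed: "\<lbrakk>X \<in> Ob T; Y \<in> Ob T; Z \<in> Ob T; f \<in> Hom T X Y; g \<in> Hom T Y Z\<rbrakk>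
      \<Longrightarrow> g \<bullet> f \<in> Hom T X Z"
    and Comp_assoc: "\<lbrakk>X \<in> Ob T; Y \<in> Ob T; Z \<in> Ob T; W \<in> Ob T;
      f \<in> Hom T X Y; g \<in> Hom T Y Z; h \<in> Hom T Z W\<rbrakk> \<Longrightarrow> (h \<bullet> g) \<bullet> f = h \<bullet> (g \<bullet> f)"
    and Comp_Ident: "\<lbrakk>X \<in> Ob T; Y \<in> Ob T; f \<in> Hom T X Y\<rbrakk> \<Longrightarrow> f \<bullet> Ident T X = f"
    and Ident_Comp: "\<lbrakk>X \<in> Ob T; Y \<in> Ob T; f \<in> Hom T X Y\<rbrakk> \<Longrightarrow> Ident T Y \<bullet> f = f"

definition is_iso :: "('o, 'm, 'z) cat_scheme \<Rightarrow> 'o \<Rightarrow> 'o \<Rightarrow> 'm \<Rightarrow> bool" where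
  "is_iso T X Y f \<longleftrightarrow> f \<in> Hom T X Y \<and>
     (\<exists>g \<in> Hom T Y X. g \<bullet>\<^bsub>T\<^esub> f = Ident T X \<and> f \<bullet>\<^bsub>T\<^esub> g = Ident T Y)"

definition isomorphic :: "('o, 'm, 'z) cat_scheme \<Rightarrow> 'o \<Rightarrow> 'o \<Rightarrow> bool" where
  "isomorphic T X Y \<longleftrightarrow> X \<in> Ob T \<and> Y \<in> Ob T \<and> (\<exists>f. is_iso T X Y f)"

definition is_zero_object :: "('o, 'm, 'z) cat_scheme \<Rightarrow> 'o \<Rightarrow> bool" where
  "is_zero_object T Z \<longleftrightarrow> Z \<in> Ob T \<and>
     (\<forall>X \<in> Ob T. (\<exists>!f. f \<in> Hom T X Z) \<and> (\<exists>!f. f \<in> Hom T Z X))"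

definition is_coproduct ::
    "('o, 'm, 'z) cat_scheme \<Rightarrow> 'i set \<Rightarrow> ('i \<Rightarrow> 'o) \<Rightarrow> 'o \<Rightarrow> ('i \<Rightarrow> 'm) \<Rightarrow> bool" where
  "is_coproduct T I X P \<iota> \<longleftrightarrow>
     (\<forall>i \<in> I. X i \<in> Ob T) \<and> P \<in> Ob T \<and> (\<forall>i \<in> I. \<iota> i \<in> Hom T (X i) P) \<and>
     (\<forall>Y \<in> Ob T. \<forall>h. (\<forall>i \<in> I. h i \<in> Hom T (X i) Y) \<longrightarrow>
        (\<exists>!g. g \<in> Hom T P Y \<and> (\<forall>i \<in> I. g \<bullet>\<^bsub>T\<^esub> \<iota> i = h i)))"

record ('o, 'm, 'p, 'n) ftor =
  onOb :: "'o \<Rightarrow> 'p"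
  onHom :: "'m \<Rightarrow> 'n"

definition is_functor ::
    "('o, 'm, 'y) cat_scheme \<Rightarrow> ('p, 'n, 'z) cat_scheme \<Rightarrow> ('o, 'm, 'p, 'n) ftor \<Rightarrow> bool" where
  "is_functor C D F \<longleftrightarrow>
     (\<forall>X \<in> Ob C. onOb F X \<in> Ob D \<and> onHom F (Ident C X) = Ident D (onOb F X)) \<and>
     (\<forall>X \<in> Ob C. \<forall>Y \<in> Ob C. \<forall>f \<in> Hom C X Y. onHom F f \<in> Hom D (onOb F X) (onOb F Y)) \<and>
     (\<forall>X \<in> Ob C. \<forall>Y \<in> Ob C. \<forall>Z \<in> Ob C. \<forall>f \<in> Hom C X Y. \<forall>g \<in> Hom C Y Z.
        onHom F (g \<bullet>\<^bsub>C\<^esub> f) = onHom F g \<bullet>\<^bsub>D\<^esub> onHom F f)"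

definition compose_functor ::
    "('p, 'n, 'q, 'l) ftor \<Rightarrow> ('o, 'm, 'p, 'n) ftor \<Rightarrow> ('o, 'm, 'q, 'l) ftor" where
  "compose_functor G F = \<lparr>onOb = onOb G \<circ> onOb F, onHom = onHom G \<circ> onHom F\<rparr>"

definition full_subcategory :: "('o, 'm, 'z) cat_scheme \<Rightarrow> 'o set \<Rightarrow> ('o, 'm) cat" where
  "full_subcategory T S =
     \<lparr>Ob = Ob T \<inter> S, Hom = Hom T, Ident = Ident T, Comp = Comp T\<rparr>"

definition inclusion :: "('o, 'm, 'o, 'm) ftor" where
  "inclusion = \<lparr>onOb = (\<lambda>X. X), onHom = (\<lambda>f. f)\<rparr>"

text \<open>\<open>F : C \<rightarrow> D\<close> is left adjoint to \<open>G : D \<rightarrow> C\<close>.\<close>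

definition adjoint ::
    "('o, 'm, 'y) cat_scheme \<Rightarrow> ('p, 'n, 'z) cat_scheme \<Rightarrow>
     ('o, 'm, 'p, 'n) ftor \<Rightarrow> ('p, 'n, 'o, 'm) ftor \<Rightarrow> bool" where
  "adjoint C D F G \<longleftrightarrow> is_functor C D F \<and> is_functor D C G \<and>
     (\<exists>\<phi>. (\<forall>X \<in> Ob C. \<forall>Y \<in> Ob D.
              bij_betw (\<phi> X Y) (Hom D (onOb F X) Y) (Hom C X (onOb G Y))) \<and>
          (\<forall>X \<in> Ob C. \<forall>X' \<in> Ob C. \<forall>Y \<in> Ob D. \<forall>Y' \<in> Ob D.
             \<forall>a \<in> Hom C X' X. \<forall>b \<in> Hom D Y Y'. \<forall>f \<in> Hom D (onOb F X) Y.
               \<phi> X' Y' (b \<bullet>\<^bsub>D\<^esub> f \<bullet>\<^bsub>D\<^esub> onHom F a) = onHom G b \<bullet>\<^bsub>C\<^esub> \<phi> X Y f \<bullet>\<^bsub>C\<^esub> a))"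


section \<open>Triangulated categories\<close>

type_synonym ('o, 'm) triangle = "'o \<times> 'o \<times> 'o \<times> 'm \<times> 'm \<times> 'm"

record ('o, 'm) tcat = "('o, 'm) cat" +
  Zer :: "'o \<Rightarrow> 'o \<Rightarrow> 'm"
  Add :: "'m \<Rightarrow> 'm \<Rightarrow> 'm"  (infixl "\<boxplus>\<index>" 65)
  Susp :: "('o, 'm, 'o, 'm) ftor"
  Exact :: "('o, 'm) triangle set"

text \<open>The abelian group of morphisms \<open>X \<rightarrow> Y\<close>, written multiplicatively so that the
  library's \<^locale>\<open>comm_group\<close> and \<^const>\<open>finprod\<close> apply.\<close>

definition Hom_group :: "('o, 'm, 'z) tcat_scheme \<Rightarrow> 'o \<Rightarrow> 'o \<Rightarrow> 'm monoid" where
  "Hom_group T X Y = \<lparr>carrier = Hom T X Y, monoid.mult = Add T, one = Zer T X Y\<rparr>"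

definition Neg :: "('o, 'm, 'z) tcat_scheme \<Rightarrow> 'o \<Rightarrow> 'o \<Rightarrow> 'm \<Rightarrow> 'm" where
  "Neg T X Y f = inv\<^bsub>Hom_group T X Y\<^esub> f"

locale preadditive_category = category T for T (structure) +
  assumes Hom_comm_group: "\<lbrakk>X \<in> Ob T; Y \<in> Ob T\<rbrakk> \<Longrightarrow> comm_group (Hom_group T X Y)"
    and Comp_Add: "\<lbrakk>X \<in> Ob T; Y \<in> Ob T; Z \<in> Ob T;
      f \<in> Hom T X Y; f' \<in> Hom T X Y; g \<in> Hom T Y Z\<rbrakk> \<Longrightarrow> g \<bullet> (f \<boxplus> f') = (g \<bullet> f) \<boxplus> (g \<bullet> f')"
    and Add_Comp: "\<lbrakk>X \<in> Ob T; Y \<in> Ob T; Z \<in> Ob T;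
      f \<in> Hom T X Y; g \<in> Hom T Y Z; g' \<in> Hom T Y Z\<rbrakk> \<Longrightarrow> (g \<boxplus> g') \<bullet> f = (g \<bullet> f) \<boxplus> (g' \<bullet> f)"

locale additive_category = preadditive_category T for T (structure) +
  assumes zero_object: "\<exists>Z. is_zero_object T Z"
    and binary_coproducts: "\<lbrakk>X \<in> Ob T; Y \<in> Ob T\<rbrakk> \<Longrightarrow>
      \<exists>P \<iota>. is_coproduct T (UNIV :: bool set) (\<lambda>b. if b then X else Y) P \<iota>"

definition arrows :: "('o, 'm, 'z) cat_scheme \<Rightarrow> 'm set" where
  "arrows T = (\<Union>X \<in> Ob T. \<Union>Y \<in> Ob T. Hom T X Y)"

text \<open>The suspension is an automorphism, so that its powers \<open>\<Sigma>\<^sup>n\<close> are defined for all integers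
  \<open>n\<close>, and compose strictly.\<close>

definition susp_ob :: "('o, 'm, 'z) tcat_scheme \<Rightarrow> int \<Rightarrow> 'o \<Rightarrow> 'o" where
  "susp_ob T n = (if n \<ge> 0 then onOb (Susp T) ^^ nat n
                  else inv_into (Ob T) (onOb (Susp T)) ^^ nat (- n))"

definition susp_hom :: "('o, 'm, 'z) tcat_scheme \<Rightarrow> int \<Rightarrow> 'm \<Rightarrow> 'm" where
  "susp_hom T n = (if n \<ge> 0 then onHom (Susp T) ^^ nat n
                   else inv_into (arrows T) (onHom (Susp T)) ^^ nat (- n))"

fun is_candidate_triangle :: "('o, 'm, 'z) tcat_scheme \<Rightarrow> ('o, 'm) triangle \<Rightarrow> bool" where
  "is_candidate_triangle T (X, Y, Z, u, v, w) \<longleftrightarrow>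
     X \<in> Ob T \<and> Y \<in> Ob T \<and> Z \<in> Ob T \<and>
     u \<in> Hom T X Y \<and> v \<in> Hom T Y Z \<and> w \<in> Hom T Z (onOb (Susp T) X)"

fun is_triangle_morphism ::
    "('o, 'm, 'z) tcat_scheme \<Rightarrow> ('o, 'm) triangle \<Rightarrow> ('o, 'm) triangle \<Rightarrow> 'm \<times> 'm \<times> 'm \<Rightarrow> bool" where
  "is_triangle_morphism T (X, Y, Z, u, v, w) (X', Y', Z', u', v', w') (f, g, h) \<longleftrightarrow>
     f \<in> Hom T X X' \<and> g \<in> Hom T Y Y' \<and> h \<in> Hom T Z Z' \<and>
     g \<bullet>\<^bsub>T\<^esub> u = u' \<bullet>\<^bsub>T\<^esub> f \<and> h \<bullet>\<^bsub>T\<^esub> v = v' \<bullet>\<^bsub>T\<^esub> g \<and> onHom (Susp T) f \<bullet>\<^bsub>T\<^esub> w = w' \<bullet>\<^bsub>T\<^esub> h"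

locale triangulated_category = additive_category T for T (structure) +
  assumes Susp_functor: "is_functor T T (Susp T)"
    and Susp_bij_Ob: "bij_betw (onOb (Susp T)) (Ob T) (Ob T)"
    and Susp_bij_arrows: "bij_betw (onHom (Susp T)) (arrows T) (arrows T)"
    and Susp_Add: "\<lbrakk>X \<in> Ob T; Y \<in> Ob T; f \<in> Hom T X Y; g \<in> Hom T X Y\<rbrakk> \<Longrightarrow>
      onHom (Susp T) (f \<boxplus> g) = onHom (Susp T) f \<boxplus> onHom (Susp T) g"
    and Exact_candidate: "\<Delta> \<in> Exact T \<Longrightarrow> is_candidate_triangle T \<Delta>"
    and Exact_iso: "\<lbrakk>(X, Y, Z, u, v, w) \<in> Exact T;
      is_candidate_triangle T (X', Y', Z', u', v', w');
      is_triangle_morphism T (X, Y, Z, u, v, w) (X', Y', Z', u', v', w') (f, g, h);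
      is_iso T X X' f; is_iso T Y Y' g; is_iso T Z Z' h\<rbrakk> \<Longrightarrow> (X', Y', Z', u', v', w') \<in> Exact T"
    and Exact_Ident: "\<lbrakk>X \<in> Ob T; is_zero_object T Z\<rbrakk> \<Longrightarrow>
      (X, X, Z, Ident T X, Zer T X Z, Zer T Z (onOb (Susp T) X)) \<in> Exact T"
    and Exact_cone: "\<lbrakk>X \<in> Ob T; Y \<in> Ob T; u \<in> Hom T X Y\<rbrakk> \<Longrightarrow>
      \<exists>Z v w. (X, Y, Z, u, v, w) \<in> Exact T"
    and Exact_rotate: "is_candidate_triangle T (X, Y, Z, u, v, w) \<Longrightarrow>
      (X, Y, Z, u, v, w) \<in> Exact T \<longleftrightarrow>
      (Y, Z, onOb (Susp T) X, v, w,
        Neg T (onOb (Susp T) X) (onOb (Susp T) Y) (onHom (Susp T) u)) \<in> Exact T"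
    and Exact_fill: "\<lbrakk>(X, Y, Z, u, v, w) \<in> Exact T; (X', Y', Z', u', v', w') \<in> Exact T;
      f \<in> Hom T X X'; g \<in> Hom T Y Y'; g \<bullet> u = u' \<bullet> f\<rbrakk> \<Longrightarrow>
      \<exists>h. is_triangle_morphism T (X, Y, Z, u, v, w) (X', Y', Z', u', v', w') (f, g, h)"
    and Exact_octahedron: "\<lbrakk>(X, Y, U, f, i, i') \<in> Exact T; (Y, Z, W, g, j, j') \<in> Exact T;
      (X, Z, V, g \<bullet> f, k, k') \<in> Exact T\<rbrakk> \<Longrightarrow>
      \<exists>p q. (U, V, W, p, q, onHom (Susp T) i \<bullet> j') \<in> Exact T \<and>
        p \<bullet> i = k \<bullet> g \<and> k' \<bullet> p = i' \<and> q \<bullet> k = j \<and> j' \<bullet> q = onHom (Susp T) f \<bullet> k'"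


section \<open>Small coproducts, compact generation, homotopy colimits\<close>

text \<open>A set is \<open>\<kappa>\<close>-small if its cardinality is less than \<open>\<kappa>\<close>; ``set-indexed'' is read as
  ``indexed by a \<open>\<kappa>\<close>-small set''.  Since \<open>\<kappa>\<close> is a well-order on (a subset of) the type \<open>'i\<close>,
  every \<open>\<kappa>\<close>-small set is in bijection with a subset of \<open>'i\<close>, so it suffices to consider
  index sets of type \<open>'i set\<close>.  For a large category one takes \<open>\<kappa>\<close> to be the cardinality of
  the universe.  Some bound is needed: only zero categories have coproducts over index sets
  as large as their own sets of morphisms.\<close>

definition small :: "'i rel \<Rightarrow> 'a set \<Rightarrow> bool" where
  "small \<kappa> A \<longleftrightarrow> (card_of A, \<kappa>) \<in> ordLess"

definition uncountable_cardinal :: "'i rel \<Rightarrow> bool" where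
  "uncountable_cardinal \<kappa> \<longleftrightarrow> Card_order \<kappa> \<and> (natLeq, \<kappa>) \<in> ordLess"

definition has_small_coproducts :: "'i rel \<Rightarrow> ('o, 'm, 'z) cat_scheme \<Rightarrow> bool" where
  "has_small_coproducts \<kappa> T \<longleftrightarrow>
     (\<forall>(I :: 'i set) X. small \<kappa> I \<and> (\<forall>i \<in> I. X i \<in> Ob T) \<longrightarrow> (\<exists>P \<iota>. is_coproduct T I X P \<iota>))"

text \<open>The canonical map \<open>\<Oplus>\<^sub>i Hom(C, X\<^sub>i) \<rightarrow> Hom(C, \<Coprod>\<^sub>i X\<^sub>i)\<close> is bijective.\<close>

definition compact_object :: "'i rel \<Rightarrow> ('o, 'm, 'z) tcat_scheme \<Rightarrow> 'o \<Rightarrow> bool" where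
  "compact_object \<kappa> T C \<longleftrightarrow> C \<in> Ob T \<and>
     (\<forall>(I :: 'i set) X P \<iota>. small \<kappa> I \<and> is_coproduct T I X P \<iota> \<longrightarrow>
        bij_betw
          (\<lambda>g. finprod (Hom_group T C P) (\<lambda>i. \<iota> i \<bullet>\<^bsub>T\<^esub> g i) {i \<in> I. g i \<noteq> Zer T C (X i)})
          {g \<in> (\<Pi>\<^sub>E i \<in> I. Hom T C (X i)). finite {i \<in> I. g i \<noteq> Zer T C (X i)}}
          (Hom T C P))"

text \<open>Full subcategories are identified with their sets of objects.  Closure under isomorphism
  and under zero objects follows from closure under suspensions and cones.\<close>

definition triangulated_subcategory :: "('o, 'm, 'z) tcat_scheme \<Rightarrow> 'o set \<Rightarrow> bool" where
  "triangulated_subcategory T L \<longleftrightarrow> L \<subseteq> Ob T \<and> L \<noteq> {} \<and>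
     (\<forall>X \<in> Ob T. onOb (Susp T) X \<in> L \<longleftrightarrow> X \<in> L) \<and>
     (\<forall>X Y Z u v w. (X, Y, Z, u, v, w) \<in> Exact T \<and> X \<in> L \<and> Y \<in> L \<longrightarrow> Z \<in> L)"

definition localizing_subcategory :: "'i rel \<Rightarrow> ('o, 'm, 'z) tcat_scheme \<Rightarrow> 'o set \<Rightarrow> bool" where
  "localizing_subcategory \<kappa> T L \<longleftrightarrow> triangulated_subcategory T L \<and>
     (\<forall>(I :: 'i set) X P \<iota>. small \<kappa> I \<and> is_coproduct T I X P \<iota> \<and> (\<forall>i \<in> I. X i \<in> L) \<longrightarrow> P \<in> L)"

definition Loc :: "'i rel \<Rightarrow> ('o, 'm, 'z) tcat_scheme \<Rightarrow> 'o set \<Rightarrow> 'o set" where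
  "Loc \<kappa> T S = \<Inter> {L. localizing_subcategory \<kappa> T L \<and> S \<subseteq> L}"

definition compactly_generated :: "'i rel \<Rightarrow> ('o, 'm, 'z) tcat_scheme \<Rightarrow> bool" where
  "compactly_generated \<kappa> T \<longleftrightarrow> has_small_coproducts \<kappa> T \<and>
     (\<exists>S. small \<kappa> S \<and> (\<forall>C \<in> S. compact_object \<kappa> T C) \<and> Loc \<kappa> T S = Ob T)"

text \<open>\<open>H\<close> is a homotopy colimit of \<open>X 1 \<rightarrow> X 2 \<rightarrow> \<dots>\<close> along the morphisms \<open>f n : X n \<rightarrow> X (n + 1)\<close>.\<close>

definition is_hocolim ::
    "('o, 'm, 'z) tcat_scheme \<Rightarrow> (nat \<Rightarrow> 'o) \<Rightarrow> (nat \<Rightarrow> 'm) \<Rightarrow> 'o \<Rightarrow> bool" where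
  "is_hocolim T X f H \<longleftrightarrow>
     (\<forall>n \<ge> 1. X n \<in> Ob T \<and> f n \<in> Hom T (X n) (X (n + 1))) \<and>
     (\<exists>P \<iota> \<sigma> p q. is_coproduct T {1..} X P \<iota> \<and>
        \<sigma> \<in> Hom T P P \<and> (\<forall>n \<ge> 1. \<sigma> \<bullet>\<^bsub>T\<^esub> \<iota> n = \<iota> (n + 1) \<bullet>\<^bsub>T\<^esub> f n) \<and>
        (P, P, H, Ident T P \<boxplus>\<^bsub>T\<^esub> Neg T P P \<sigma>, p, q) \<in> Exact T)"


section \<open>Graded-commutative rings\<close>

record 'r graded_ring = "'r ring" +
  grading :: "int \<Rightarrow> 'r set"

locale graded_commutative_ring = ring R for R (structure) +
  assumes grading_subgroup: "additive_subgroup (grading R n) R"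
    and grading_one: "\<one> \<in> grading R 0"
    and grading_mult: "\<lbrakk>x \<in> grading R m; y \<in> grading R n\<rbrakk> \<Longrightarrow> x \<otimes> y \<in> grading R (m + n)"
    and grading_direct_sum: "x \<in> carrier R \<Longrightarrow>
      \<exists>!c. (\<forall>n. c n \<in> grading R n) \<and> finite {n. c n \<noteq> \<zero>} \<and> x = finsum R c {n. c n \<noteq> \<zero>}"
    and graded_commute: "\<lbrakk>x \<in> grading R m; y \<in> grading R n\<rbrakk> \<Longrightarrow>
      x \<otimes> y = (if even (m * n) then y \<otimes> x else \<ominus> (y \<otimes> x))"

definition homogeneous :: "('r, 'z) graded_ring_scheme \<Rightarrow> 'r set" where
  "homogeneous R = (\<Union>n. grading R n)"

definition homogeneous_ideal :: "('r, 'z) graded_ring_scheme \<Rightarrow> 'r set \<Rightarrow> bool" where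
  "homogeneous_ideal R I \<longleftrightarrow> ideal I R \<and> I = Idl\<^bsub>R\<^esub> (I \<inter> homogeneous R)"

definition graded_noetherian :: "('r, 'z) graded_ring_scheme \<Rightarrow> bool" where
  "graded_noetherian R \<longleftrightarrow>
     (\<forall>I. homogeneous_ideal R I \<longrightarrow> (\<exists>A \<subseteq> homogeneous R. finite A \<and> I = Idl\<^bsub>R\<^esub> A))"

definition graded_Spec :: "('r, 'z) graded_ring_scheme \<Rightarrow> 'r set set" where
  "graded_Spec R = {\<pp>. homogeneous_ideal R \<pp> \<and> \<pp> \<noteq> carrier R \<and>
     (\<forall>a \<in> homogeneous R. \<forall>b \<in> homogeneous R. a \<otimes>\<^bsub>R\<^esub> b \<in> \<pp> \<longrightarrow> a \<in> \<pp> \<or> b \<in> \<pp>)}"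

definition closed_locus :: "('r, 'z) graded_ring_scheme \<Rightarrow> 'r set \<Rightarrow> 'r set set" where
  "closed_locus R \<aa> = {\<pp> \<in> graded_Spec R. \<aa> \<subseteq> \<pp>}"


section \<open>Linear triangulated categories and local cohomology\<close>

text \<open>The degree \<open>n\<close> part of the graded centre.\<close>

definition graded_center :: "('o, 'm, 'z) tcat_scheme \<Rightarrow> int \<Rightarrow> ('o \<Rightarrow> 'm) set" where
  "graded_center T n = {\<alpha>.
     (\<forall>X \<in> Ob T. \<alpha> X \<in> Hom T X (susp_ob T n X)) \<and>
     (\<forall>X \<in> Ob T. \<forall>Y \<in> Ob T. \<forall>f \<in> Hom T X Y. \<alpha> Y \<bullet>\<^bsub>T\<^esub> f = susp_hom T n f \<bullet>\<^bsub>T\<^esub> \<alpha> X) \<and>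
     (\<forall>X \<in> Ob T. \<alpha> (onOb (Susp T) X) =
        (if even n then onHom (Susp T) (\<alpha> X)
         else Neg T (onOb (Susp T) X) (susp_ob T (n + 1) X) (onHom (Susp T) (\<alpha> X))))}"

text \<open>\<open>\<Phi> n x X\<close> is the morphism \<open>X \<rightarrow> \<Sigma>\<^sup>n X\<close> induced by an element \<open>x\<close> of degree \<open>n\<close>.  The degree
  is an argument because \<open>0\<close> is homogeneous of every degree.  The product of \<open>\<alpha>\<close> and \<open>\<beta>\<close> in the
  graded centre, with \<open>\<beta>\<close> of degree \<open>n\<close>, is the composite \<open>X \<rightarrow> \<Sigma>\<^sup>n X \<rightarrow> \<Sigma>\<^sup>m \<Sigma>\<^sup>n X\<close> of \<open>\<beta>\<close> at \<open>X\<close>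
  and \<open>\<alpha>\<close> at \<open>\<Sigma>\<^sup>n X\<close>.\<close>

locale linear_triangulated_category =
  graded_commutative_ring R + triangulated_category T
  for R :: "('r, 'y) graded_ring_scheme" and T :: "('o, 'm, 'z) tcat_scheme"
    and \<Phi> :: "int \<Rightarrow> 'r \<Rightarrow> 'o \<Rightarrow> 'm" +
  assumes action_center: "x \<in> grading R n \<Longrightarrow> \<Phi> n x \<in> graded_center T n"
    and action_add: "\<lbrakk>x \<in> grading R n; y \<in> grading R n; X \<in> Ob T\<rbrakk> \<Longrightarrow>
      \<Phi> n (x \<oplus>\<^bsub>R\<^esub> y) X = \<Phi> n x X \<boxplus>\<^bsub>T\<^esub> \<Phi> n y X"
    and action_one: "X \<in> Ob T \<Longrightarrow> \<Phi> 0 \<one>\<^bsub>R\<^esub> X = Ident T X"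
    and action_mult: "\<lbrakk>x \<in> grading R m; y \<in> grading R n; X \<in> Ob T\<rbrakk> \<Longrightarrow>
      \<Phi> (m + n) (x \<otimes>\<^bsub>R\<^esub> y) X = \<Phi> m x (susp_ob T n X) \<bullet>\<^bsub>T\<^esub> \<Phi> n y X"

text \<open>Degree \<open>n\<close> part of the localization at \<open>\<pp>\<close> of the graded left \<open>R\<close>-module
  \<open>\<Oplus>\<^sub>n Hom(D, \<Sigma>\<^sup>n D)\<close>: left fractions \<open>s\<^sup>-\<^sup>1 f\<close> with \<open>s\<close> homogeneous outside \<open>\<pp>\<close>, recorded as
  \<open>(|s|, s, f)\<close>, where \<open>s\<^sup>-\<^sup>1 f = t\<^sup>-\<^sup>1 g\<close> iff \<open>a s = b t\<close> lies outside \<open>\<pp>\<close> and \<open>a f = b g\<close> for some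
  homogeneous \<open>a\<close> and \<open>b\<close>.  This form of the equivalence avoids signs for denominators of odd
  degree.\<close>

definition End_fractions ::
    "('r, 'y) graded_ring_scheme \<Rightarrow> ('o, 'm, 'z) tcat_scheme \<Rightarrow> 'r set \<Rightarrow> 'o \<Rightarrow> int \<Rightarrow>
     (int \<times> 'r \<times> 'm) set" where
  "End_fractions R T \<pp> D n =
     {(k, s, f). s \<in> grading R k \<and> s \<notin> \<pp> \<and> f \<in> Hom T D (susp_ob T (n + k) D)}"

definition End_fraction_rel ::
    "('r, 'y) graded_ring_scheme \<Rightarrow> ('o, 'm, 'z) tcat_scheme \<Rightarrow> (int \<Rightarrow> 'r \<Rightarrow> 'o \<Rightarrow> 'm) \<Rightarrow>
     'r set \<Rightarrow> 'o \<Rightarrow> int \<Rightarrow> (int \<times> 'r \<times> 'm) rel" where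
  "End_fraction_rel R T \<Phi> \<pp> D n =
     {((k, s, f), (l, t, g)).
        (k, s, f) \<in> End_fractions R T \<pp> D n \<and> (l, t, g) \<in> End_fractions R T \<pp> D n \<and>
        (\<exists>i j a b. a \<in> grading R i \<and> b \<in> grading R j \<and> i + k = j + l \<and>
           a \<otimes>\<^bsub>R\<^esub> s = b \<otimes>\<^bsub>R\<^esub> t \<and> a \<otimes>\<^bsub>R\<^esub> s \<notin> \<pp> \<and>
           \<Phi> i a (susp_ob T (n + k) D) \<bullet>\<^bsub>T\<^esub> f = \<Phi> j b (susp_ob T (n + l) D) \<bullet>\<^bsub>T\<^esub> g)}"

definition End_localized ::
    "('r, 'y) graded_ring_scheme \<Rightarrow> ('o, 'm, 'z) tcat_scheme \<Rightarrow> (int \<Rightarrow> 'r \<Rightarrow> 'o \<Rightarrow> 'm) \<Rightarrow>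
     'r set \<Rightarrow> 'o \<Rightarrow> int \<Rightarrow> (int \<times> 'r \<times> 'm) set set" where
  "End_localized R T \<Phi> \<pp> D n = End_fractions R T \<pp> D n // End_fraction_rel R T \<Phi> \<pp> D n"

definition End_localized_zero ::
    "('r, 'y) graded_ring_scheme \<Rightarrow> ('o, 'm, 'z) tcat_scheme \<Rightarrow> (int \<Rightarrow> 'r \<Rightarrow> 'o \<Rightarrow> 'm) \<Rightarrow>
     'r set \<Rightarrow> 'o \<Rightarrow> int \<Rightarrow> (int \<times> 'r \<times> 'm) set" where
  "End_localized_zero R T \<Phi> \<pp> D n =
     End_fraction_rel R T \<Phi> \<pp> D n `` {(0, \<one>\<^bsub>R\<^esub>, Zer T D (susp_ob T n D))}"

definition local_subcategory ::
    "'i rel \<Rightarrow> ('r, 'y) graded_ring_scheme \<Rightarrow> ('o, 'm, 'z) tcat_scheme \<Rightarrow>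
     (int \<Rightarrow> 'r \<Rightarrow> 'o \<Rightarrow> 'm) \<Rightarrow> 'r set set \<Rightarrow> 'o set" where
  "local_subcategory \<kappa> R T \<Phi> \<V> = Loc \<kappa> T {D. compact_object \<kappa> T D \<and>
     (\<forall>\<pp> \<in> graded_Spec R - \<V>. \<forall>n. End_localized R T \<Phi> \<pp> D n = {End_localized_zero R T \<Phi> \<pp> D n})}"

text \<open>The choice is among right adjoints of the inclusion, which are unique up to isomorphism.
  It is meaningful only if such a right adjoint exists.\<close>

definition Gamma ::
    "'i rel \<Rightarrow> ('r, 'y) graded_ring_scheme \<Rightarrow> ('o, 'm, 'z) tcat_scheme \<Rightarrow>
     (int \<Rightarrow> 'r \<Rightarrow> 'o \<Rightarrow> 'm) \<Rightarrow> 'r set set \<Rightarrow> ('o, 'm, 'o, 'm) ftor" where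
  "Gamma \<kappa> R T \<Phi> \<V> = compose_functor inclusion
     (SOME G. adjoint (full_subcategory T (local_subcategory \<kappa> R T \<Phi> \<V>)) T inclusion G)"


section \<open>Koszul objects\<close>

text \<open>\<open>C s\<close> is a Koszul object on \<open>M\<close> and \<open>y 1, \<dots>, y s\<close>, for \<open>s \<le> t\<close>, where \<open>y i\<close> has degree
  \<open>e i\<close>; each \<open>C (s + 1)\<close> is a cone of \<open>y (s + 1)\<close> on \<open>C s\<close>.  Cones are unique only up to
  isomorphism, hence a predicate.\<close>

definition is_Koszul_tower ::
    "('o, 'm, 'z) tcat_scheme \<Rightarrow> (int \<Rightarrow> 'r \<Rightarrow> 'o \<Rightarrow> 'm) \<Rightarrow> 'o \<Rightarrow> nat \<Rightarrow>
     (nat \<Rightarrow> 'r) \<Rightarrow> (nat \<Rightarrow> int) \<Rightarrow> (nat \<Rightarrow> 'o) \<Rightarrow> bool" where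
  "is_Koszul_tower T \<Phi> M t y e C \<longleftrightarrow> C 0 = M \<and>
     (\<forall>s < t. \<exists>v w. (C s, susp_ob T (e (s + 1)) (C s), C (s + 1),
        \<Phi> (e (s + 1)) (y (s + 1)) (C s), v, w) \<in> Exact T)"

text \<open>In the following, \<open>C s n\<close> is a Koszul object on \<open>M\<close> and the \<open>n\<close>-th powers of
  \<open>x 1, \<dots>, x s\<close>, and \<open>K s n\<close> is its desuspension \<open>\<Sigma>\<^sup>-\<^sup>s (C s n)\<close>.  Desuspending the defining
  triangles changes morphisms by signs that depend on conventions; \<open>a s n\<close> and \<open>b s n\<close> may be any
  morphisms that complete \<open>x s ^ n\<close> to an exact triangle on the given objects.\<close>

definition is_Koszul_system ::
    "('r, 'y) graded_ring_scheme \<Rightarrow> ('o, 'm, 'z) tcat_scheme \<Rightarrow> (int \<Rightarrow> 'r \<Rightarrow> 'o \<Rightarrow> 'm) \<Rightarrow>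
     'o \<Rightarrow> nat \<Rightarrow> (nat \<Rightarrow> 'r) \<Rightarrow> (nat \<Rightarrow> int) \<Rightarrow>
     (nat \<Rightarrow> nat \<Rightarrow> 'o) \<Rightarrow> (nat \<Rightarrow> nat \<Rightarrow> 'm) \<Rightarrow> (nat \<Rightarrow> nat \<Rightarrow> 'm) \<Rightarrow> (nat \<Rightarrow> nat \<Rightarrow> 'm) \<Rightarrow> bool" where
  "is_Koszul_system R T \<Phi> M t x d C a b u \<longleftrightarrow>
     (let K = (\<lambda>s n. susp_ob T (- int s) (C s n));
          \<Delta> = (\<lambda>s n. (K s n, K (s - 1) n, susp_ob T (int n * d s) (K (s - 1) n),
                 a s n, \<Phi> (int n * d s) (x s [^]\<^bsub>R\<^esub> n) (K (s - 1) n), b s n))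
      in (\<forall>n \<ge> 1. is_Koszul_tower T \<Phi> M t (\<lambda>i. x i [^]\<^bsub>R\<^esub> n) (\<lambda>i. int n * d i) (\<lambda>s. C s n)) \<and>
         (\<forall>s \<in> {1..t}. \<forall>n \<ge> 1. \<Delta> s n \<in> Exact T) \<and>
         (\<forall>n \<ge> 1. u 0 n = Ident T M) \<and>
         (\<forall>s \<in> {1..t}. \<forall>n \<ge> 1. is_triangle_morphism T (\<Delta> s n) (\<Delta> s (n + 1))
            (u s n, u (s - 1) n,
             \<Phi> (d s) (x s) (susp_ob T (int n * d s) (K (s - 1) (n + 1)))
               \<bullet>\<^bsub>T\<^esub> susp_hom T (int n * d s) (u (s - 1) n))))"

end

theory Submission
  imports Defs
begin

text \<open>
  Let \<open>L\<close> be the localizing subcategory that defines \<open>\<Gamma>\<close>.  The proof shows that the homotopy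
  colimit \<open>H\<close> lies in \<open>L\<close> and comes with a morphism \<open>H \<rightarrow> M\<close> that induces bijections
  \<open>Hom(D, H) \<rightarrow> Hom(D, M)\<close> for all \<open>D\<close> in \<open>L\<close>.  So \<open>H\<close> is a coreflection of \<open>M\<close> in \<open>L\<close>, and
  coreflections are unique (\<open>coreflection_right_adjoint\<close>).  The existence of the right adjoint is
  proved along the way, without Brown representability.

  The generators of \<open>L\<close> are the compact objects \<open>D\<close> on which every \<open>x\<^sub>i\<close> acts nilpotently
  (\<open>torsion_compact_eq\<close>): if no power of \<open>x\<^sub>i\<close> annihilates \<open>D\<close>, then Zorn's lemma gives a
  homogeneous prime that contains the annihilator of \<open>D\<close> but not \<open>x\<^sub>i\<close>, and \<open>End(D)\<close> does not
  vanish at this prime.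

  Write \<open>K\<^sub>n\<close> for the desuspended Koszul objects on the \<open>n\<close>-th powers.  For such \<open>D\<close> the group
  \<open>Hom(D, M)\<close> is the colimit of the groups \<open>Hom(D, K\<^sub>n)\<close> (\<open>koszul_system_hom\<close>).  Indeed, in each
  step of the construction the transition morphisms between the third terms of the triangles are
  composites with \<open>x\<^sub>s\<close>, so these terms contribute nothing to the colimit.  As \<open>D\<close> is compact,
  \<open>Hom(D, H)\<close> is the same colimit (\<open>koszul_hocolim\<close>).  The bijections \<open>Hom(D, H) \<rightarrow> Hom(D, M)\<close>
  extend from the generators to all \<open>D\<close> in \<open>L\<close> (\<open>hom_bij_Loc\<close>).

  It remains to see that the \<open>K\<^sub>n\<close>, and hence \<open>H\<close>, lie in \<open>L\<close>.  If \<open>M\<close> is compact, the \<open>K\<^sub>n\<close> are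
  compact and the \<open>x\<^sub>i\<close> act nilpotently on them, so they are among the generators.  Hence compact
  objects have coreflections in \<open>L\<close>.  By the five lemma and the compactness of the generators, the
  objects that have coreflections form a localizing subcategory (\<open>coreflective_localizing\<close>), which
  is then the whole category.  For arbitrary \<open>M\<close>, let \<open>B\<close> be the cone of the coreflection of \<open>K\<^sub>n\<close>.
  Powers of the \<open>x\<^sub>i\<close> annihilate \<open>K\<^sub>n\<close>, and therefore \<open>B\<close>.  A morphism from a compact object \<open>C\<close> to a
  suspension of \<open>B\<close> is then detected on a Koszul object on \<open>C\<close>, which is a generator, so it
  vanishes.  Thus \<open>B = 0\<close> (\<open>nilpotent_in_Loc\<close>).
\<close>

section \<open>Morphisms in categories and preadditive categories\<close>

context category
begin

text \<open>A morphism together with its source and target, both of them objects.\<close>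

definition arrow ("\<guillemotleft>_ : _ \<rightarrow> _\<guillemotright>") where
  "\<guillemotleft>f : X \<rightarrow> Y\<guillemotright> \<longleftrightarrow> X \<in> Ob T \<and> Y \<in> Ob T \<and> f \<in> Hom T X Y"

lemma arrowI: "\<lbrakk>X \<in> Ob T; Y \<in> Ob T; f \<in> Hom T X Y\<rbrakk> \<Longrightarrow> \<guillemotleft>f : X \<rightarrow> Y\<guillemotright>"
  by (simp add: arrow_def)

lemma arrowD:
  assumes "\<guillemotleft>f : X \<rightarrow> Y\<guillemotright>"
  shows "X \<in> Ob T" "Y \<in> Ob T" "f \<in> Hom T X Y"
  using assms by (auto simp: arrow_def)

lemma arrow_unique: "\<lbrakk>\<guillemotleft>f : X \<rightarrow> Y\<guillemotright>; \<guillemotleft>f : X' \<rightarrow> Y'\<guillemotright>\<rbrakk> \<Longrightarrow> X = X' \<and> Y = Y'"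
  unfolding arrow_def using Hom_disjoint by blast

lemma arrow_comp: "\<lbrakk>\<guillemotleft>f : X \<rightarrow> Y\<guillemotright>; \<guillemotleft>g : Y \<rightarrow> Z\<guillemotright>\<rbrakk> \<Longrightarrow> \<guillemotleft>g \<bullet> f : X \<rightarrow> Z\<guillemotright>"
  unfolding arrow_def using Comp_closed by blast

lemma comp_assoc: "\<lbrakk>\<guillemotleft>f : X \<rightarrow> Y\<guillemotright>; \<guillemotleft>g : Y \<rightarrow> Z\<guillemotright>; \<guillemotleft>h : Z \<rightarrow> W\<guillemotright>\<rbrakk> \<Longrightarrow> (h \<bullet> g) \<bullet> f = h \<bullet> (g \<bullet> f)"
  unfolding arrow_def using Comp_assoc by blast

lemma arrow_ident: "X \<in> Ob T \<Longrightarrow> \<guillemotleft>Ident T X : X \<rightarrow> X\<guillemotright>"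
  unfolding arrow_def using Ident_closed by blast

lemma comp_ident: "\<guillemotleft>f : X \<rightarrow> Y\<guillemotright> \<Longrightarrow> f \<bullet> Ident T X = f"
  unfolding arrow_def using Comp_Ident by blast

lemma ident_comp: "\<guillemotleft>f : X \<rightarrow> Y\<guillemotright> \<Longrightarrow> Ident T Y \<bullet> f = f"
  unfolding arrow_def using Ident_Comp by blast

text \<open>Sources and targets as functions, meaningful on morphisms only.  They turn the typing of a composite into a computation,
  which the simplifier performs with the rules collected below.\<close>

definition arr where "arr f \<longleftrightarrow> f \<in> arrows T"
definition src where "src f = (SOME X. \<exists>Y. \<guillemotleft>f : X \<rightarrow> Y\<guillemotright>)"
definition tgt where "tgt f = (SOME Y. \<exists>X. \<guillemotleft>f : X \<rightarrow> Y\<guillemotright>)"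

lemma arr_iff: "arr f \<longleftrightarrow> (\<exists>X Y. \<guillemotleft>f : X \<rightarrow> Y\<guillemotright>)"
  unfolding arr_def arrows_def arrow_def by blast

lemma src_eq: "\<guillemotleft>f : X \<rightarrow> Y\<guillemotright> \<Longrightarrow> src f = X"
  unfolding src_def by (rule some_equality) (use arrow_unique in blast)+

lemma tgt_eq: "\<guillemotleft>f : X \<rightarrow> Y\<guillemotright> \<Longrightarrow> tgt f = Y"
  unfolding tgt_def by (rule some_equality) (use arrow_unique in blast)+

lemma arrow_iff: "\<guillemotleft>f : X \<rightarrow> Y\<guillemotright> \<longleftrightarrow> arr f \<and> src f = X \<and> tgt f = Y \<and> X \<in> Ob T \<and> Y \<in> Ob T"
  using arr_iff src_eq tgt_eq arrowD by blast

lemma arr_arrow: "arr f \<Longrightarrow> \<guillemotleft>f : src f \<rightarrow> tgt f\<guillemotright>"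
  using arr_iff src_eq tgt_eq by blast

lemma arr_comp: "\<lbrakk>arr f; arr g; src g = tgt f\<rbrakk> \<Longrightarrow> arr (g \<bullet> f) \<and> src (g \<bullet> f) = src f \<and> tgt (g \<bullet> f) = tgt g"
  using arrow_comp[of f "src f" "tgt f" g "tgt g"] arr_arrow[of f] arr_arrow[of g] arr_iff src_eq tgt_eq
  by metis

lemma arr_ident: "X \<in> Ob T \<Longrightarrow> arr (Ident T X) \<and> src (Ident T X) = X \<and> tgt (Ident T X) = X"
  using arrow_ident arrow_iff by blast

lemma arr_assoc:
  "\<lbrakk>arr f; arr g; arr h; src g = tgt f; src h = tgt g\<rbrakk> \<Longrightarrow> (h \<bullet> g) \<bullet> f = h \<bullet> (g \<bullet> f)"
  using comp_assoc[of f "src f" "tgt f" g "tgt g" h "tgt h"] arr_arrow[of f] arr_arrow[of g]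
    arr_arrow[of h] by simp

lemma arr_comp_ident: "\<lbrakk>arr f; src f = X\<rbrakk> \<Longrightarrow> f \<bullet> Ident T X = f"
  using comp_ident arr_arrow by blast

lemma arr_ident_comp: "\<lbrakk>arr f; tgt f = X\<rbrakk> \<Longrightarrow> Ident T X \<bullet> f = f"
  using ident_comp arr_arrow by blast

lemma comp_eq_comp:
  assumes "\<guillemotleft>f : X \<rightarrow> Y\<guillemotright>" "\<guillemotleft>g : Y \<rightarrow> Z\<guillemotright>" "\<guillemotleft>k : D \<rightarrow> X\<guillemotright>" "g \<bullet> f = h"
  shows "g \<bullet> (f \<bullet> k) = h \<bullet> k"
  using comp_assoc[OF assms(3,1,2)] assms(4) by simp

lemma square_comp:
  assumes "\<guillemotleft>f : X \<rightarrow> Y\<guillemotright>" "\<guillemotleft>g : Y \<rightarrow> Z\<guillemotright>" "\<guillemotleft>f' : X \<rightarrow> Y'\<guillemotright>" "\<guillemotleft>g' : Y' \<rightarrow> Z\<guillemotright>" "\<guillemotleft>k : D \<rightarrow> X\<guillemotright>"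
    and "g \<bullet> f = g' \<bullet> f'"
  shows "g \<bullet> (f \<bullet> k) = g' \<bullet> (f' \<bullet> k)"
  using comp_assoc[OF assms(5,1,2)] comp_assoc[OF assms(5,3,4)] assms(6) by simp

lemmas cat_rules = arrow_iff arr_comp arr_ident arr_assoc arr_comp_ident arr_ident_comp

lemma isomorphicI:
  assumes "\<guillemotleft>f : X \<rightarrow> Y\<guillemotright>" "\<guillemotleft>g : Y \<rightarrow> X\<guillemotright>" "g \<bullet> f = Ident T X" "f \<bullet> g = Ident T Y"
  shows "isomorphic T X Y"
  using assms unfolding isomorphic_def is_iso_def arrow_def by blast

lemma coproduct_arrow:
  assumes "is_coproduct T I X P \<iota>"
  shows "P \<in> Ob T" "i \<in> I \<Longrightarrow> X i \<in> Ob T" "i \<in> I \<Longrightarrow> \<guillemotleft>\<iota> i : X i \<rightarrow> P\<guillemotright>"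
  using assms unfolding is_coproduct_def arrow_def by auto

lemma coproduct_ex1:
  assumes "is_coproduct T I X P \<iota>" "Y \<in> Ob T" "\<forall>i\<in>I. h i \<in> Hom T (X i) Y"
  shows "\<exists>!g. g \<in> Hom T P Y \<and> (\<forall>i\<in>I. g \<bullet> \<iota> i = h i)"
  using assms(1)[unfolded is_coproduct_def, THEN conjunct2, THEN conjunct2, THEN conjunct2,
    THEN bspec[OF _ assms(2)], THEN spec[of _ h]] assms(3) by blast

lemma coproduct_desc:
  assumes "is_coproduct T I X P \<iota>" "Y \<in> Ob T" "\<And>i. i \<in> I \<Longrightarrow> \<guillemotleft>h i : X i \<rightarrow> Y\<guillemotright>"
  obtains g where "\<guillemotleft>g : P \<rightarrow> Y\<guillemotright>" "\<And>i. i \<in> I \<Longrightarrow> g \<bullet> \<iota> i = h i"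
proof -
  have "\<exists>!g. g \<in> Hom T P Y \<and> (\<forall>i\<in>I. g \<bullet> \<iota> i = h i)"
    using assms(3) by (intro coproduct_ex1[OF assms(1,2)]) (auto simp: arrow_def)
  then obtain g where "g \<in> Hom T P Y" "\<forall>i\<in>I. g \<bullet> \<iota> i = h i" by blast
  then show ?thesis using that coproduct_arrow(1)[OF assms(1)] assms(2) by (auto simp: arrow_def)
qed

lemma coproduct_ext:
  assumes "is_coproduct T I X P \<iota>" "\<guillemotleft>g : P \<rightarrow> Y\<guillemotright>" "\<guillemotleft>h : P \<rightarrow> Y\<guillemotright>"
    and "\<And>i. i \<in> I \<Longrightarrow> g \<bullet> \<iota> i = h \<bullet> \<iota> i"
  shows "g = h"
proof -
  have "\<forall>i\<in>I. h \<bullet> \<iota> i \<in> Hom T (X i) Y"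
    using coproduct_arrow[OF assms(1)] assms(3) arrow_comp arrowD(3) by blast
  then have "\<exists>!g. g \<in> Hom T P Y \<and> (\<forall>i\<in>I. g \<bullet> \<iota> i = h \<bullet> \<iota> i)"
    by (intro coproduct_ex1[OF assms(1) arrowD(2)[OF assms(2)]])
  then show ?thesis using assms(4) arrowD(3)[OF assms(2)] arrowD(3)[OF assms(3)] by blast
qed

lemma coproductI:
  assumes "P \<in> Ob T" "\<And>i. i \<in> I \<Longrightarrow> \<guillemotleft>\<iota> i : X i \<rightarrow> P\<guillemotright>"
    and "\<And>Y h. \<lbrakk>Y \<in> Ob T; \<And>i. i \<in> I \<Longrightarrow> \<guillemotleft>h i : X i \<rightarrow> Y\<guillemotright>\<rbrakk> \<Longrightarrow>
      \<exists>g. \<guillemotleft>g : P \<rightarrow> Y\<guillemotright> \<and> (\<forall>i\<in>I. g \<bullet> \<iota> i = h i)"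
    and "\<And>Y g g'. \<lbrakk>\<guillemotleft>g : P \<rightarrow> Y\<guillemotright>; \<guillemotleft>g' : P \<rightarrow> Y\<guillemotright>; \<And>i. i \<in> I \<Longrightarrow> g \<bullet> \<iota> i = g' \<bullet> \<iota> i\<rbrakk> \<Longrightarrow> g = g'"
  shows "is_coproduct T I X P \<iota>"
  unfolding is_coproduct_def
proof (intro conjI ballI allI impI)
  fix Y h assume Y: "Y \<in> Ob T" and h: "\<forall>i\<in>I. h i \<in> Hom T (X i) Y"
  have "\<exists>g. \<guillemotleft>g : P \<rightarrow> Y\<guillemotright> \<and> (\<forall>i\<in>I. g \<bullet> \<iota> i = h i)"
    using assms(2) Y h by (intro assms(3)) (auto simp: arrow_def)
  then obtain g where g: "\<guillemotleft>g : P \<rightarrow> Y\<guillemotright>" "\<forall>i\<in>I. g \<bullet> \<iota> i = h i" by blast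
  show "\<exists>!g. g \<in> Hom T P Y \<and> (\<forall>i\<in>I. g \<bullet> \<iota> i = h i)"
  proof (rule ex1I[of _ g])
    fix g' assume "g' \<in> Hom T P Y \<and> (\<forall>i\<in>I. g' \<bullet> \<iota> i = h i)"
    then show "g' = g" using assms(1) Y g by (intro assms(4)[of g' Y g]) (auto simp: arrow_def)
  qed (use g arrowD in blast)
qed (use assms arrowD in blast)+

lemma coproduct_cong:
  assumes "is_coproduct T I X P \<iota>" "\<And>i. i \<in> I \<Longrightarrow> X i = Y i"
  shows "is_coproduct T I Y P \<iota>"
  using assms(1) unfolding is_coproduct_def by (simp add: assms(2) cong: ball_cong)

lemma coproduct_reindex:
  assumes P: "is_coproduct T I X P \<iota>" and \<phi>: "bij_betw \<phi> J I"
  shows "is_coproduct T J (\<lambda>j. X (\<phi> j)) P (\<lambda>j. \<iota> (\<phi> j))"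
proof (rule coproductI)
  have mem: "\<phi> j \<in> I" if "j \<in> J" for j using \<phi> that by (auto simp: bij_betw_def)
  show "P \<in> Ob T" by (rule coproduct_arrow(1)[OF P])
  show "\<guillemotleft>\<iota> (\<phi> j) : X (\<phi> j) \<rightarrow> P\<guillemotright>" if "j \<in> J" for j using coproduct_arrow(3)[OF P mem[OF that]] .
  define \<psi> where "\<psi> = inv_into J \<phi>"
  have \<psi>: "\<psi> i \<in> J" "\<phi> (\<psi> i) = i" if "i \<in> I" for i
    using \<phi> that unfolding \<psi>_def bij_betw_def by (auto intro: inv_into_into f_inv_into_f)
  have \<psi>\<phi>: "\<psi> (\<phi> j) = j" if "j \<in> J" for j
    using \<phi> that unfolding \<psi>_def bij_betw_def by (auto intro: inv_into_f_f)
  show "\<exists>g. \<guillemotleft>g : P \<rightarrow> Y\<guillemotright> \<and> (\<forall>j\<in>J. g \<bullet> \<iota> (\<phi> j) = h j)"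
    if Y: "Y \<in> Ob T" and h: "\<And>j. j \<in> J \<Longrightarrow> \<guillemotleft>h j : X (\<phi> j) \<rightarrow> Y\<guillemotright>" for Y h
  proof -
    have *: "\<And>i. i \<in> I \<Longrightarrow> \<guillemotleft>h (\<psi> i) : X i \<rightarrow> Y\<guillemotright>" using h \<psi> by metis
    obtain g where "\<guillemotleft>g : P \<rightarrow> Y\<guillemotright>" "\<And>i. i \<in> I \<Longrightarrow> g \<bullet> \<iota> i = h (\<psi> i)"
      using coproduct_desc[OF P Y, where h = "\<lambda>i. h (\<psi> i)", OF *] by blast
    then show ?thesis using mem \<psi>\<phi> by force
  qed
  show "g = g'" if "\<guillemotleft>g : P \<rightarrow> Y\<guillemotright>" "\<guillemotleft>g' : P \<rightarrow> Y\<guillemotright>" "\<And>j. j \<in> J \<Longrightarrow> g \<bullet> \<iota> (\<phi> j) = g' \<bullet> \<iota> (\<phi> j)" for Y g g'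
  proof (rule coproduct_ext[OF P that(1,2)])
    fix i assume "i \<in> I" then show "g \<bullet> \<iota> i = g' \<bullet> \<iota> i" using that(3)[OF \<psi>(1)] \<psi>(2) by auto
  qed
qed

end

context preadditive_category
begin

lemma group_Hom: "\<lbrakk>X \<in> Ob T; Y \<in> Ob T\<rbrakk> \<Longrightarrow> group (Hom_group T X Y)"
  using Hom_comm_group comm_group.axioms(2) by blast

lemma Hom_group_simps [simp]:
  "carrier (Hom_group T X Y) = Hom T X Y" "monoid.mult (Hom_group T X Y) = Add T"
  "one (Hom_group T X Y) = Zer T X Y"
  by (simp_all add: Hom_group_def)

lemma arrow_add: "\<lbrakk>\<guillemotleft>f : X \<rightarrow> Y\<guillemotright>; \<guillemotleft>g : X \<rightarrow> Y\<guillemotright>\<rbrakk> \<Longrightarrow> \<guillemotleft>f \<boxplus> g : X \<rightarrow> Y\<guillemotright>"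
  unfolding arrow_def using monoid.m_closed[OF group.is_monoid[OF group_Hom], of X Y f g] by simp

lemma arrow_zero: "\<lbrakk>X \<in> Ob T; Y \<in> Ob T\<rbrakk> \<Longrightarrow> \<guillemotleft>Zer T X Y : X \<rightarrow> Y\<guillemotright>"
  unfolding arrow_def using monoid.one_closed[OF group.is_monoid[OF group_Hom], of X Y] by simp

lemma arrow_neg: "\<guillemotleft>f : X \<rightarrow> Y\<guillemotright> \<Longrightarrow> \<guillemotleft>Neg T X Y f : X \<rightarrow> Y\<guillemotright>"
  unfolding arrow_def Neg_def using group.inv_closed[OF group_Hom, of X Y f] by simp

lemma add_assoc: "\<lbrakk>\<guillemotleft>f : X \<rightarrow> Y\<guillemotright>; \<guillemotleft>g : X \<rightarrow> Y\<guillemotright>; \<guillemotleft>h : X \<rightarrow> Y\<guillemotright>\<rbrakk> \<Longrightarrow> (f \<boxplus> g) \<boxplus> h = f \<boxplus> (g \<boxplus> h)"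
  unfolding arrow_def using monoid.m_assoc[OF group.is_monoid[OF group_Hom], of X Y f g h] by simp

lemma add_commute: "\<lbrakk>\<guillemotleft>f : X \<rightarrow> Y\<guillemotright>; \<guillemotleft>g : X \<rightarrow> Y\<guillemotright>\<rbrakk> \<Longrightarrow> f \<boxplus> g = g \<boxplus> f"
  unfolding arrow_def
  using comm_monoid.m_comm[OF comm_group.axioms(1)[OF Hom_comm_group], of X Y f g] by simp

lemma add_zero: "\<guillemotleft>f : X \<rightarrow> Y\<guillemotright> \<Longrightarrow> f \<boxplus> Zer T X Y = f"
  unfolding arrow_def using monoid.r_one[OF group.is_monoid[OF group_Hom], of X Y f] by simp

lemma zero_add: "\<guillemotleft>f : X \<rightarrow> Y\<guillemotright> \<Longrightarrow> Zer T X Y \<boxplus> f = f"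
  unfolding arrow_def using monoid.l_one[OF group.is_monoid[OF group_Hom], of X Y f] by simp

lemma add_neg: "\<guillemotleft>f : X \<rightarrow> Y\<guillemotright> \<Longrightarrow> f \<boxplus> Neg T X Y f = Zer T X Y"
  unfolding arrow_def Neg_def using group.r_inv[OF group_Hom, of X Y f] by simp

lemma neg_add: "\<guillemotleft>f : X \<rightarrow> Y\<guillemotright> \<Longrightarrow> Neg T X Y f \<boxplus> f = Zer T X Y"
  unfolding arrow_def Neg_def using group.l_inv[OF group_Hom, of X Y f] by simp

lemma neg_neg: "\<guillemotleft>f : X \<rightarrow> Y\<guillemotright> \<Longrightarrow> Neg T X Y (Neg T X Y f) = f"
  unfolding arrow_def Neg_def using group.inv_inv[OF group_Hom, of X Y f] by simp

lemma neg_inj: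
  assumes f: "\<guillemotleft>f : X \<rightarrow> Y\<guillemotright>" and g: "\<guillemotleft>g : X \<rightarrow> Y\<guillemotright>" and eq: "Neg T X Y f = Neg T X Y g"
  shows "f = g"
  using arg_cong[OF eq, of "Neg T X Y"] unfolding neg_neg[OF f] neg_neg[OF g] .

lemma neg_unique:
  assumes "\<guillemotleft>f : X \<rightarrow> Y\<guillemotright>" "\<guillemotleft>g : X \<rightarrow> Y\<guillemotright>" "f \<boxplus> g = Zer T X Y"
  shows "g = Neg T X Y f"
proof -
  have "g \<boxplus> f = Zer T X Y" using add_commute[OF assms(1,2)] assms(3) by simp
  then show ?thesis
    using group.inv_equality[OF group_Hom, of X Y g f] assms(1,2) unfolding arrow_def Neg_def by simp
qed

lemma diff_zero:
  assumes "\<guillemotleft>f : X \<rightarrow> Y\<guillemotright>" "\<guillemotleft>g : X \<rightarrow> Y\<guillemotright>" "f \<boxplus> Neg T X Y g = Zer T X Y"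
  shows "f = g"
proof -
  note n = arrow_neg[OF assms(2)]
  have "f = f \<boxplus> (Neg T X Y g \<boxplus> g)" using neg_add[OF assms(2)] add_zero[OF assms(1)] by simp
  also have "\<dots> = g" using add_assoc[OF assms(1) n assms(2)] assms(3) zero_add[OF assms(2)] by simp
  finally show ?thesis .
qed

lemma diff_add:
  assumes "\<guillemotleft>f : X \<rightarrow> Y\<guillemotright>" "\<guillemotleft>g : X \<rightarrow> Y\<guillemotright>"
  shows "f = g \<boxplus> (f \<boxplus> Neg T X Y g)"
proof -
  note n = arrow_neg[OF assms(2)]
  have "f = f \<boxplus> (Neg T X Y g \<boxplus> g)" using neg_add[OF assms(2)] add_zero[OF assms(1)] by simp
  also have "\<dots> = (f \<boxplus> Neg T X Y g) \<boxplus> g" using add_assoc[OF assms(1) n assms(2)] by simp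
  also have "\<dots> = g \<boxplus> (f \<boxplus> Neg T X Y g)" by (rule add_commute[OF arrow_add[OF assms(1) n] assms(2)])
  finally show ?thesis .
qed

lemma zero_neg: "\<lbrakk>X \<in> Ob T; Y \<in> Ob T\<rbrakk> \<Longrightarrow> Neg T X Y (Zer T X Y) = Zer T X Y"
  by (rule neg_unique[symmetric]) (auto intro: arrow_zero add_zero)

lemma comp_add: "\<lbrakk>\<guillemotleft>f : X \<rightarrow> Y\<guillemotright>; \<guillemotleft>f' : X \<rightarrow> Y\<guillemotright>; \<guillemotleft>g : Y \<rightarrow> Z\<guillemotright>\<rbrakk> \<Longrightarrow> g \<bullet> (f \<boxplus> f') = (g \<bullet> f) \<boxplus> (g \<bullet> f')"
  unfolding arrow_def using Comp_Add by blast

lemma add_comp: "\<lbrakk>\<guillemotleft>f : X \<rightarrow> Y\<guillemotright>; \<guillemotleft>g : Y \<rightarrow> Z\<guillemotright>; \<guillemotleft>g' : Y \<rightarrow> Z\<guillemotright>\<rbrakk> \<Longrightarrow> (g \<boxplus> g') \<bullet> f = (g \<bullet> f) \<boxplus> (g' \<bullet> f)"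
  unfolding arrow_def using Add_Comp by blast

lemma idem_zero:
  assumes "\<guillemotleft>f : X \<rightarrow> Y\<guillemotright>" "f \<boxplus> f = f" shows "f = Zer T X Y"
proof -
  note n = arrow_neg[OF assms(1)]
  have "f = f \<boxplus> (f \<boxplus> Neg T X Y f)" using add_neg[OF assms(1)] add_zero[OF assms(1)] by simp
  also have "\<dots> = Zer T X Y" using add_assoc[OF assms(1,1) n] assms(2) add_neg[OF assms(1)] by simp
  finally show ?thesis .
qed

lemma comp_zero: 
  assumes g: "\<guillemotleft>g : Y \<rightarrow> Z\<guillemotright>" and X: "X \<in> Ob T" shows "g \<bullet> Zer T X Y = Zer T X Z"
proof (rule idem_zero)
  have z: "\<guillemotleft>Zer T X Y : X \<rightarrow> Y\<guillemotright>" using arrow_zero X arrowD(1)[OF g] by blast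
  show "\<guillemotleft>g \<bullet> Zer T X Y : X \<rightarrow> Z\<guillemotright>" using arrow_comp z g by blast
  show "g \<bullet> Zer T X Y \<boxplus> g \<bullet> Zer T X Y = g \<bullet> Zer T X Y"
    using comp_add[OF z z g] add_zero[OF z] by simp
qed

lemma zero_comp: 
  assumes g: "\<guillemotleft>g : X \<rightarrow> Y\<guillemotright>" and Z: "Z \<in> Ob T" shows "Zer T Y Z \<bullet> g = Zer T X Z"
proof (rule idem_zero)
  have z: "\<guillemotleft>Zer T Y Z : Y \<rightarrow> Z\<guillemotright>" using arrow_zero Z arrowD(2)[OF g] by blast
  show "\<guillemotleft>Zer T Y Z \<bullet> g : X \<rightarrow> Z\<guillemotright>" using arrow_comp z g by blast
  show "Zer T Y Z \<bullet> g \<boxplus> Zer T Y Z \<bullet> g = Zer T Y Z \<bullet> g"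
    using add_comp[OF g z z] add_zero[OF z] by simp
qed

lemma comp_neg:
  assumes f: "\<guillemotleft>f : X \<rightarrow> Y\<guillemotright>" and g: "\<guillemotleft>g : Y \<rightarrow> Z\<guillemotright>"
  shows "g \<bullet> Neg T X Y f = Neg T X Z (g \<bullet> f)"
proof (rule neg_unique)
  show "g \<bullet> f \<boxplus> g \<bullet> Neg T X Y f = Zer T X Z"
    using comp_add[OF f arrow_neg[OF f] g] add_neg[OF f] comp_zero[OF g arrowD(1)[OF f]] by simp
qed (use f g arrow_comp arrow_neg in blast)+

lemma neg_comp:
  assumes f: "\<guillemotleft>f : X \<rightarrow> Y\<guillemotright>" and g: "\<guillemotleft>g : Y \<rightarrow> Z\<guillemotright>"
  shows "Neg T Y Z g \<bullet> f = Neg T X Z (g \<bullet> f)"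
proof (rule neg_unique)
  show "g \<bullet> f \<boxplus> Neg T Y Z g \<bullet> f = Zer T X Z"
    using add_comp[OF f g arrow_neg[OF g]] add_neg[OF g] zero_comp[OF f arrowD(2)[OF g]] by simp
qed (use f g arrow_comp arrow_neg in blast)+

lemma diff_comp_zero:
  assumes "\<guillemotleft>f : X \<rightarrow> Y\<guillemotright>" "\<guillemotleft>g : Y \<rightarrow> Z\<guillemotright>" "\<guillemotleft>h : Y \<rightarrow> Z\<guillemotright>" "g \<bullet> f = h \<bullet> f"
  shows "(g \<boxplus> Neg T Y Z h) \<bullet> f = Zer T X Z"
  using add_comp[OF assms(1,2) arrow_neg[OF assms(3)]] neg_comp[OF assms(1,3)]
    add_neg[OF arrow_comp[OF assms(1,3)]] assms(4) by simp

lemma comp_diff_zero: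
  assumes "\<guillemotleft>f : X \<rightarrow> Y\<guillemotright>" "\<guillemotleft>g : X \<rightarrow> Y\<guillemotright>" "\<guillemotleft>h : Y \<rightarrow> Z\<guillemotright>" "h \<bullet> f = h \<bullet> g"
  shows "h \<bullet> (f \<boxplus> Neg T X Y g) = Zer T X Z"
  using comp_add[OF assms(1) arrow_neg[OF assms(2)] assms(3)] comp_neg[OF assms(2,3)]
    add_neg[OF arrow_comp[OF assms(2,3)]] assms(4) by simp

lemma arr_add: "\<lbrakk>arr f; arr g; src g = src f; tgt g = tgt f\<rbrakk> \<Longrightarrow>
    arr (f \<boxplus> g) \<and> src (f \<boxplus> g) = src f \<and> tgt (f \<boxplus> g) = tgt f"
  using arrow_add[of f "src f" "tgt f" g] arr_arrow[of f] arr_arrow[of g] arrow_iff by auto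

lemma arr_zero: "\<lbrakk>X \<in> Ob T; Y \<in> Ob T\<rbrakk> \<Longrightarrow>
    arr (Zer T X Y) \<and> src (Zer T X Y) = X \<and> tgt (Zer T X Y) = Y"
  using arrow_zero arrow_iff by blast

lemma arr_neg: "\<lbrakk>arr f; src f = X; tgt f = Y\<rbrakk> \<Longrightarrow>
    arr (Neg T X Y f) \<and> src (Neg T X Y f) = X \<and> tgt (Neg T X Y f) = Y"
  using arrow_neg arr_arrow arrow_iff by blast

lemma arr_comp_zero: "\<lbrakk>arr g; src g = Y; X \<in> Ob T\<rbrakk> \<Longrightarrow> g \<bullet> Zer T X Y = Zer T X (tgt g)"
  using comp_zero arr_arrow by blast

lemma arr_zero_comp: "\<lbrakk>arr g; tgt g = Y; Z \<in> Ob T\<rbrakk> \<Longrightarrow> Zer T Y Z \<bullet> g = Zer T (src g) Z"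
  using zero_comp arr_arrow by blast

lemma arr_comp_add: "\<lbrakk>arr f; arr f'; arr g; src f' = src f; tgt f' = tgt f; src g = tgt f\<rbrakk> \<Longrightarrow>
    g \<bullet> (f \<boxplus> f') = (g \<bullet> f) \<boxplus> (g \<bullet> f')"
  using comp_add[of f "src f" "tgt f" f' g "tgt g"] arr_arrow[of f] arr_arrow[of g] arr_arrow[of f'] by simp

lemma arr_add_comp: "\<lbrakk>arr f; arr g; arr g'; src g = tgt f; src g' = tgt f; tgt g' = tgt g\<rbrakk> \<Longrightarrow>
    (g \<boxplus> g') \<bullet> f = (g \<bullet> f) \<boxplus> (g' \<bullet> f)"
  using add_comp[of f "src f" "tgt f" g "tgt g" g'] arr_arrow[of f] arr_arrow[of g] arr_arrow[of g'] by simp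

lemma arr_add_zero: "\<lbrakk>arr f; src f = X; tgt f = Y\<rbrakk> \<Longrightarrow> f \<boxplus> Zer T X Y = f"
  "\<lbrakk>arr f; src f = X; tgt f = Y\<rbrakk> \<Longrightarrow> Zer T X Y \<boxplus> f = f"
  using add_zero zero_add arr_arrow by blast+

lemmas add_rules = cat_rules arr_add arr_zero arr_neg arr_comp_zero arr_zero_comp arr_comp_add
  arr_add_comp arr_add_zero

lemma zero_objectD:
  assumes "is_zero_object T Z"
  shows "Z \<in> Ob T" "\<guillemotleft>f : X \<rightarrow> Z\<guillemotright> \<Longrightarrow> f = Zer T X Z" "\<guillemotleft>g : Z \<rightarrow> X\<guillemotright> \<Longrightarrow> g = Zer T Z X"
proof -
  show Z: "Z \<in> Ob T" using assms by (simp add: is_zero_object_def)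
  show "f = Zer T X Z" if f: "\<guillemotleft>f : X \<rightarrow> Z\<guillemotright>"
    using assms f arrow_zero[OF arrowD(1)[OF f] Z] unfolding is_zero_object_def arrow_def by blast
  show "g = Zer T Z X" if f: "\<guillemotleft>g : Z \<rightarrow> X\<guillemotright>"
    using assms f arrow_zero[OF Z arrowD(2)[OF f]] unfolding is_zero_object_def arrow_def by blast
qed

lemma zero_objectI:
  assumes "Z \<in> Ob T" "Ident T Z = Zer T Z Z"
  shows "is_zero_object T Z"
  unfolding is_zero_object_def
proof (intro conjI ballI)
  fix X assume X: "X \<in> Ob T"
  show "\<exists>!f. f \<in> Hom T X Z"
  proof (rule ex1I[of _ "Zer T X Z"])
    fix f assume "f \<in> Hom T X Z"
    then have "\<guillemotleft>f : X \<rightarrow> Z\<guillemotright>" using X assms by (simp add: arrow_def)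
    then show "f = Zer T X Z" using ident_comp zero_comp assms by metis
  qed (use arrow_zero X assms arrowD in blast)
  show "\<exists>!f. f \<in> Hom T Z X"
  proof (rule ex1I[of _ "Zer T Z X"])
    fix f assume "f \<in> Hom T Z X"
    then have "\<guillemotleft>f : Z \<rightarrow> X\<guillemotright>" using X assms by (simp add: arrow_def)
    then show "f = Zer T Z X" using comp_ident comp_zero assms by metis
  qed (use arrow_zero X assms arrowD in blast)
qed (rule assms)

lemma coproduct_proj:
  assumes "is_coproduct T I X P \<iota>"
  obtains \<pi> where "\<And>i. i \<in> I \<Longrightarrow> \<guillemotleft>\<pi> i : P \<rightarrow> X i\<guillemotright>"
    "\<And>i. i \<in> I \<Longrightarrow> \<pi> i \<bullet> \<iota> i = Ident T (X i)"
    "\<And>i j. \<lbrakk>i \<in> I; j \<in> I; i \<noteq> j\<rbrakk> \<Longrightarrow> \<pi> i \<bullet> \<iota> j = Zer T (X j) (X i)"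
proof -
  have "\<exists>p. \<guillemotleft>p : P \<rightarrow> X i\<guillemotright> \<and> (\<forall>j\<in>I. p \<bullet> \<iota> j = (if j = i then Ident T (X i) else Zer T (X j) (X i)))"
    if i: "i \<in> I" for i
  proof -
    have *: "\<And>j. j \<in> I \<Longrightarrow> \<guillemotleft>(if j = i then Ident T (X i) else Zer T (X j) (X i)) : X j \<rightarrow> X i\<guillemotright>"
      using coproduct_arrow(2)[OF assms] i by (auto intro: arrow_ident arrow_zero)
    show ?thesis using coproduct_desc[OF assms coproduct_arrow(2)[OF assms i] *] by metis
  qed
  then obtain \<pi> where "\<And>i. i \<in> I \<Longrightarrow> \<guillemotleft>\<pi> i : P \<rightarrow> X i\<guillemotright> \<and>
      (\<forall>j\<in>I. \<pi> i \<bullet> \<iota> j = (if j = i then Ident T (X i) else Zer T (X j) (X i)))" by metis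
  then show ?thesis by (intro that) auto
qed

end

section \<open>Integral powers of the suspension\<close>

text \<open>The integral powers of a permutation \<open>F\<close> of a set \<open>A\<close>.\<close>

definition zpow :: "('a \<Rightarrow> 'a) \<Rightarrow> 'a set \<Rightarrow> int \<Rightarrow> 'a \<Rightarrow> 'a" where
  "zpow F A n = (if n \<ge> 0 then F ^^ nat n else inv_into A F ^^ nat (- n))"

lemma zpow_closed:
  assumes "bij_betw F A A" "a \<in> A" shows "zpow F A n a \<in> A"
proof -
  have 1: "(F ^^ k) a \<in> A" for k using assms by (induction k) (auto simp: bij_betw_def)
  have 2: "(inv_into A F ^^ k) a \<in> A" for k
    using assms by (induction k) (auto simp: bij_betw_def intro: inv_into_into)
  show ?thesis using 1 2 by (simp add: zpow_def)
qed

lemma zpow_succ: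
  assumes "bij_betw F A A" "a \<in> A" shows "zpow F A (n + 1) a = F (zpow F A n a)"
proof (cases "n \<ge> 0")
  case True
  then show ?thesis by (simp add: zpow_def nat_add_distrib)
next
  case False
  define k where "k = nat (- n - 1)"
  have k: "n = - int k - 1" using False by (simp add: k_def)
  have nk: "nat (- n) = Suc k" using False by (simp add: k_def)
  have mem: "(inv_into A F ^^ k) a \<in> A"
    using assms by (induction k) (auto simp: bij_betw_def intro: inv_into_into)
  have "zpow F A n a = inv_into A F ((inv_into A F ^^ k) a)"
    unfolding zpow_def using False nk by simp
  moreover have "zpow F A (n + 1) a = (inv_into A F ^^ k) a"
    unfolding zpow_def k by (cases "k = 0") simp_all
  ultimately show ?thesis
    using mem assms(1) f_inv_into_f[of "(inv_into A F ^^ k) a" F A] by (simp add: bij_betw_def)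
qed

lemma zpow_add:
  assumes F: "bij_betw F A A" and a: "a \<in> A"
  shows "zpow F A m (zpow F A n a) = zpow F A (m + n) a"
proof -
  note mem = zpow_closed[OF F]
  show ?thesis
  proof (induction m rule: int_induct[where k = 0])
    case base then show ?case by (simp add: zpow_def)
  next
    case (step1 i)
    have "zpow F A (i + 1) (zpow F A n a) = F (zpow F A (i + n) a)"
      using zpow_succ[OF F mem[OF a]] step1 by simp
    also have "\<dots> = zpow F A (i + n + 1) a" by (rule zpow_succ[OF F a, symmetric])
    finally show ?case by (simp add: add.assoc add.commute add.left_commute)
  next
    case (step2 i)
    have "F (zpow F A (i - 1) (zpow F A n a)) = zpow F A (i + n) a"
      using zpow_succ[OF F mem[OF a], of "i - 1"] step2 by simp
    also have "\<dots> = F (zpow F A (i - 1 + n) a)"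
      using zpow_succ[OF F a, of "i - 1 + n"] by simp
    finally show ?case using F mem a unfolding bij_betw_def by (meson inj_onD)
  qed
qed

context triangulated_category
begin

text \<open>The functor \<open>\<Sigma>\<^sup>n\<close> on objects and on morphisms.\<close>

abbreviation Sob where "Sob n X \<equiv> susp_ob T n X"
abbreviation Sh where "Sh n f \<equiv> susp_hom T n f"

lemma susp_ob_zpow: "susp_ob T = zpow (onOb (Susp T)) (Ob T)"
  by (rule ext) (simp add: susp_ob_def zpow_def)

lemma susp_hom_zpow: "susp_hom T = zpow (onHom (Susp T)) (arrows T)"
  by (rule ext) (simp add: susp_hom_def zpow_def)

lemma Susp_eq: "onOb (Susp T) = susp_ob T 1" "onHom (Susp T) = susp_hom T 1"
  by (simp_all add: susp_ob_def susp_hom_def)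

lemma Sob_closed: "X \<in> Ob T \<Longrightarrow> Sob n X \<in> Ob T"
  unfolding susp_ob_zpow by (rule zpow_closed[OF Susp_bij_Ob])

lemma Sob_add: "X \<in> Ob T \<Longrightarrow> Sob m (Sob n X) = Sob (m + n) X"
  unfolding susp_ob_zpow by (rule zpow_add[OF Susp_bij_Ob])

lemma Sob_0: "Sob 0 X = X" by (simp add: susp_ob_def)

lemma Sh_0: "Sh 0 f = f" by (simp add: susp_hom_def)

lemma Sh_add: "arr f \<Longrightarrow> Sh m (Sh n f) = Sh (m + n) f"
  unfolding susp_hom_zpow arr_def by (rule zpow_add[OF Susp_bij_arrows])

lemma Sh_arr: "arr f \<Longrightarrow> arr (Sh n f)"
  unfolding susp_hom_zpow arr_def by (rule zpow_closed[OF Susp_bij_arrows])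

lemma Sob_inj: "\<lbrakk>X \<in> Ob T; Y \<in> Ob T; Sob n X = Sob n Y\<rbrakk> \<Longrightarrow> X = Y"
  by (drule arg_cong[of _ _ "Sob (- n)"]) (simp add: Sob_add Sob_0)

lemma Sh_inj_arr: "\<lbrakk>arr f; arr g; Sh n f = Sh n g\<rbrakk> \<Longrightarrow> f = g"
  by (drule arg_cong[of _ _ "Sh (- n)"]) (simp add: Sh_add Sh_0)

lemma Sh_1_arrow: "\<guillemotleft>f : X \<rightarrow> Y\<guillemotright> \<Longrightarrow> \<guillemotleft>Sh 1 f : Sob 1 X \<rightarrow> Sob 1 Y\<guillemotright>"
proof -
  assume f: "\<guillemotleft>f : X \<rightarrow> Y\<guillemotright>"
  have "\<forall>X \<in> Ob T. \<forall>Y \<in> Ob T. \<forall>f \<in> Hom T X Y. Sh 1 f \<in> Hom T (Sob 1 X) (Sob 1 Y)"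
    using Susp_functor unfolding is_functor_def Susp_eq by (elim conjE)
  from this[THEN bspec, THEN bspec, THEN bspec, OF arrowD[OF f]] show ?thesis
    using f Sob_closed by (simp add: arrow_def)
qed

lemma Sh_1_comp: "\<lbrakk>\<guillemotleft>f : X \<rightarrow> Y\<guillemotright>; \<guillemotleft>g : Y \<rightarrow> Z\<guillemotright>\<rbrakk> \<Longrightarrow> Sh 1 (g \<bullet> f) = Sh 1 g \<bullet> Sh 1 f"
proof -
  assume f: "\<guillemotleft>f : X \<rightarrow> Y\<guillemotright>" and g: "\<guillemotleft>g : Y \<rightarrow> Z\<guillemotright>"
  have "\<forall>X \<in> Ob T. \<forall>Y \<in> Ob T. \<forall>Z \<in> Ob T. \<forall>f \<in> Hom T X Y. \<forall>g \<in> Hom T Y Z. Sh 1 (g \<bullet> f) = Sh 1 g \<bullet> Sh 1 f"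
    using Susp_functor unfolding is_functor_def Susp_eq by (elim conjE)
  from this[THEN bspec, THEN bspec, THEN bspec, THEN bspec, THEN bspec, OF arrowD(1,2)[OF f] arrowD(2)[OF g]
    arrowD(3)[OF f] arrowD(3)[OF g]] show ?thesis .
qed

lemma Sh_arrow:
  assumes f: "\<guillemotleft>f : X \<rightarrow> Y\<guillemotright>" shows "\<guillemotleft>Sh n f : Sob n X \<rightarrow> Sob n Y\<guillemotright>"
proof -
  note fa = f[unfolded arrow_iff, THEN conjunct1]
  note ob = arrowD(1,2)[OF f]
  show ?thesis
  proof (induction n rule: int_induct[where k = 0])
    case base show ?case using f by (simp add: Sob_0 Sh_0)
  next
    case (step1 i)
    show ?case using Sh_1_arrow[OF step1(2)] Sh_add[OF fa, of 1 i] Sob_add[of _ 1 i] ob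
      by (simp add: add.commute)
  next
    case (step2 i)
    have g: "arr (Sh (i - 1) f)" by (rule Sh_arr[OF fa])
    then obtain X' Y' where g': "\<guillemotleft>Sh (i - 1) f : X' \<rightarrow> Y'\<guillemotright>" using arr_iff by blast
    have "\<guillemotleft>Sh i f : Sob 1 X' \<rightarrow> Sob 1 Y'\<guillemotright>"
      using Sh_1_arrow[OF g'] Sh_add[OF fa, of 1 "i - 1"] by simp
    then have "Sob 1 X' = Sob i X" "Sob 1 Y' = Sob i Y" using step2 arrow_unique by blast+
    then have "Sob 1 X' = Sob 1 (Sob (i - 1) X)" "Sob 1 Y' = Sob 1 (Sob (i - 1) Y)"
      using ob by (simp_all add: Sob_add)
    then have "X' = Sob (i - 1) X" "Y' = Sob (i - 1) Y"
      using Sob_inj[of _ _ 1] arrowD(1,2)[OF g'] ob Sob_closed by blast+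
    then show ?case using g' by simp
  qed
qed

lemma arr_Sh: "arr f \<Longrightarrow> arr (Sh n f) \<and> src (Sh n f) = Sob n (src f) \<and> tgt (Sh n f) = Sob n (tgt f)"
  using Sh_arrow[OF arr_arrow] arrow_iff by blast

lemma Sh_comp:
  assumes f: "arr f" and g: "arr g" and fg: "src g = tgt f"
  shows "Sh n (g \<bullet> f) = Sh n g \<bullet> Sh n f"
proof (induction n rule: int_induct[where k = 0])
  case base show ?case by (simp add: Sh_0)
next
  have gf: "arr (g \<bullet> f)" using arr_comp f g fg by blast
  have *: "Sh (i + 1) (g \<bullet> f) = Sh 1 (Sh i (g \<bullet> f))" "Sh 1 (Sh i g \<bullet> Sh i f) = Sh (i + 1) g \<bullet> Sh (i + 1) f" for i
  proof -
    show "Sh (i + 1) (g \<bullet> f) = Sh 1 (Sh i (g \<bullet> f))" using Sh_add[OF gf, of 1 i] by (simp add: add.commute)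
    have "Sh 1 (Sh i g \<bullet> Sh i f) = Sh 1 (Sh i g) \<bullet> Sh 1 (Sh i f)"
      using arr_Sh[OF f, of i] arr_Sh[OF g, of i] fg
        Sh_1_comp[of "Sh i f" "Sob i (src f)" "Sob i (tgt f)" "Sh i g" "Sob i (tgt g)"]
        arr_arrow[of "Sh i f"] arr_arrow[of "Sh i g"] by simp
    then show "Sh 1 (Sh i g \<bullet> Sh i f) = Sh (i + 1) g \<bullet> Sh (i + 1) f"
      using Sh_add[OF f, of 1 i] Sh_add[OF g, of 1 i] by (simp add: add.commute)
  qed
  {
    case (step1 i)
    then show ?case using * by simp
  next
    case (step2 i)
    have "Sh 1 (Sh (i - 1) (g \<bullet> f)) = Sh 1 (Sh (i - 1) g \<bullet> Sh (i - 1) f)"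
      using *[of "i - 1"] step2 by simp
    moreover have "arr (Sh (i - 1) g \<bullet> Sh (i - 1) f)"
      using arr_comp arr_Sh[OF f] arr_Sh[OF g] fg by simp
    ultimately show ?case using Sh_inj_arr[of _ _ 1] Sh_arr[OF gf] by blast
  }
qed

lemma Sh_Ident:
  assumes X: "X \<in> Ob T" shows "Sh n (Ident T X) = Ident T (Sob n X)"
proof -
  have a: "arr (Sh n (Ident T X)) \<and> src (Sh n (Ident T X)) = Sob n X \<and> tgt (Sh n (Ident T X)) = Sob n X"
    using arr_Sh arr_ident[OF X] by metis
  have i: "\<guillemotleft>Ident T (Sob n X) : Sob n X \<rightarrow> Sob n X\<guillemotright>" using arrow_ident Sob_closed X by blast
  then obtain g where g: "arr g" "src g = X" "tgt g = X" "Ident T (Sob n X) = Sh n g"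
  proof -
    assume *: "\<And>g. \<lbrakk>arr g; src g = X; tgt g = X; Ident T (Sob n X) = Sh n g\<rbrakk> \<Longrightarrow> thesis"
    have "\<guillemotleft>Sh (- n) (Ident T (Sob n X)) : X \<rightarrow> X\<guillemotright>"
      using Sh_arrow[OF i, of "- n"] Sob_add[OF X, of "- n" n] by (simp add: Sob_0)
    moreover have "Sh n (Sh (- n) (Ident T (Sob n X))) = Ident T (Sob n X)"
      using Sh_add[of "Ident T (Sob n X)" n "- n"] i by (simp add: Sh_0 arrow_iff)
    ultimately show thesis using * arrow_iff by metis
  qed
  have "Sh n (Ident T X) = Sh n (Ident T X) \<bullet> Ident T (Sob n X)" using a arr_comp_ident by simp
  also have "\<dots> = Sh n (Ident T X \<bullet> g)" using Sh_comp[OF g(1)] arr_ident[OF X] g by simp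
  also have "\<dots> = Ident T (Sob n X)" using arr_ident_comp g by simp
  finally show ?thesis .
qed

lemma Sh_plus:
  assumes f: "arr f" and g: "arr g" and s: "src g = src f" and t: "tgt g = tgt f"
  shows "Sh n (f \<boxplus> g) = Sh n f \<boxplus> Sh n g"
proof (induction n rule: int_induct[where k = 0])
  case base show ?case by (simp add: Sh_0)
next
  have gf: "arr (f \<boxplus> g)" using arr_add f g s t by blast
  have S1: "Sh 1 (h \<boxplus> k) = Sh 1 h \<boxplus> Sh 1 k" if "arr h" "arr k" "src k = src h" "tgt k = tgt h" for h k
    using that Susp_Add[of "src h" "tgt h" h k] arr_arrow[of h] arr_arrow[of k]
    unfolding Susp_eq arrow_def by simp
  have *: "Sh (i + 1) (f \<boxplus> g) = Sh 1 (Sh i (f \<boxplus> g))" "Sh 1 (Sh i f \<boxplus> Sh i g) = Sh (i + 1) f \<boxplus> Sh (i + 1) g" for i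
    using Sh_add[OF gf, of 1 i] S1[of "Sh i f" "Sh i g"] arr_Sh[OF f] arr_Sh[OF g] s t
      Sh_add[OF f, of 1 i] Sh_add[OF g, of 1 i] by (simp_all add: add.commute)
  {
    case (step1 i)
    then show ?case using * by simp
  next
    case (step2 i)
    have "Sh 1 (Sh (i - 1) (f \<boxplus> g)) = Sh 1 (Sh (i - 1) f \<boxplus> Sh (i - 1) g)"
      using *[of "i - 1"] step2 by simp
    moreover have "arr (Sh (i - 1) f \<boxplus> Sh (i - 1) g)"
      using arr_add arr_Sh[OF f] arr_Sh[OF g] s t by simp
    ultimately show ?case using Sh_inj_arr[of _ _ 1] Sh_arr[OF gf] by blast
  }
qed

lemma Sh_Zer:
  assumes "X \<in> Ob T" "Y \<in> Ob T" shows "Sh n (Zer T X Y) = Zer T (Sob n X) (Sob n Y)"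
proof (rule idem_zero)
  show "\<guillemotleft>Sh n (Zer T X Y) : Sob n X \<rightarrow> Sob n Y\<guillemotright>" by (rule Sh_arrow[OF arrow_zero[OF assms]])
  show "Sh n (Zer T X Y) \<boxplus> Sh n (Zer T X Y) = Sh n (Zer T X Y)"
    using Sh_plus[of "Zer T X Y" "Zer T X Y" n] arr_zero[OF assms] add_zero[OF arrow_zero[OF assms]] by simp
qed

lemma Sh_Neg:
  assumes "arr f" "src f = X" "tgt f = Y"
  shows "Sh n (Neg T X Y f) = Neg T (Sob n X) (Sob n Y) (Sh n f)"
proof (rule neg_unique)
  have f: "\<guillemotleft>f : X \<rightarrow> Y\<guillemotright>" using assms arr_arrow by blast
  show "\<guillemotleft>Sh n f : Sob n X \<rightarrow> Sob n Y\<guillemotright>" "\<guillemotleft>Sh n (Neg T X Y f) : Sob n X \<rightarrow> Sob n Y\<guillemotright>"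
    using Sh_arrow f arrow_neg by blast+
  show "Sh n f \<boxplus> Sh n (Neg T X Y f) = Zer T (Sob n X) (Sob n Y)"
    using Sh_plus[of f "Neg T X Y f" n] arr_neg[OF assms] assms add_neg[OF f] Sh_Zer[OF arrowD(1,2)[OF f]]
    by simp
qed

lemma Sh_inj: "\<lbrakk>\<guillemotleft>f : X \<rightarrow> Y\<guillemotright>; \<guillemotleft>g : X \<rightarrow> Y\<guillemotright>; Sh n f = Sh n g\<rbrakk> \<Longrightarrow> f = g"
  using Sh_inj_arr arrow_iff by blast

lemma Sh_zero_iff: "\<guillemotleft>f : X \<rightarrow> Y\<guillemotright> \<Longrightarrow> Sh n f = Zer T (Sob n X) (Sob n Y) \<longleftrightarrow> f = Zer T X Y"
  using Sh_inj[OF _ arrow_zero] Sh_Zer arrowD by metis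

lemma Sh_surj:
  assumes g: "\<guillemotleft>g : Sob n X \<rightarrow> Sob n Y\<guillemotright>" and ob: "X \<in> Ob T" "Y \<in> Ob T"
  obtains f where "\<guillemotleft>f : X \<rightarrow> Y\<guillemotright>" "g = Sh n f"
proof
  show "\<guillemotleft>Sh (- n) g : X \<rightarrow> Y\<guillemotright>" using Sh_arrow[OF g, of "- n"] ob by (simp add: Sob_add Sob_0)
  show "g = Sh n (Sh (- n) g)" using Sh_add[of g n "- n"] g by (simp add: Sh_0 arrow_iff)
qed

lemmas tri_rules = add_rules Sob_closed Sob_add Sob_0 Sh_0 Sh_add arr_Sh Sh_comp Sh_Ident Sh_plus
  Sh_Zer Sh_Neg


section \<open>Long exact sequences\<close>

lemma exact_arrows:
  assumes "(X, Y, Z, u, v, w) \<in> Exact T"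
  shows "\<guillemotleft>u : X \<rightarrow> Y\<guillemotright>" "\<guillemotleft>v : Y \<rightarrow> Z\<guillemotright>" "\<guillemotleft>w : Z \<rightarrow> Sob 1 X\<guillemotright>"
  using Exact_candidate[OF assms] Sob_closed[of X 1] by (auto simp: Susp_eq arrow_def)

lemma exact_rotate:
  assumes "(X, Y, Z, u, v, w) \<in> Exact T"
  shows "(Y, Z, Sob 1 X, v, w, Neg T (Sob 1 X) (Sob 1 Y) (Sh 1 u)) \<in> Exact T"
  using Exact_rotate[OF Exact_candidate[OF assms]] assms by (simp add: Susp_eq)

lemma exact_unrotate:
  assumes "\<guillemotleft>u : X \<rightarrow> Y\<guillemotright>" "(Y, Z, Sob 1 X, v, w, Neg T (Sob 1 X) (Sob 1 Y) (Sh 1 u)) \<in> Exact T"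
  shows "(X, Y, Z, u, v, w) \<in> Exact T"
proof -
  have "is_candidate_triangle T (X, Y, Z, u, v, w)"
    using assms(1) exact_arrows(1,2)[OF assms(2)] by (simp add: Susp_eq arrow_def)
  from Exact_rotate[OF this] show ?thesis using assms(2) by (simp add: Susp_eq)
qed

lemma exact_fill:
  assumes "(X, Y, Z, u, v, w) \<in> Exact T" "(X', Y', Z', u', v', w') \<in> Exact T"
    and "\<guillemotleft>f : X \<rightarrow> X'\<guillemotright>" "\<guillemotleft>g : Y \<rightarrow> Y'\<guillemotright>" "g \<bullet> u = u' \<bullet> f"
  obtains h where "\<guillemotleft>h : Z \<rightarrow> Z'\<guillemotright>" "h \<bullet> v = v' \<bullet> g" "Sh 1 f \<bullet> w = w' \<bullet> h"
  using Exact_fill[OF assms(1,2) arrowD(3)[OF assms(3)] arrowD(3)[OF assms(4)] assms(5)]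
    exact_arrows[OF assms(1)] exact_arrows[OF assms(2)] by (auto simp: Susp_eq arrow_def)

lemma exact_ident:
  assumes "X \<in> Ob T" "is_zero_object T Z"
  shows "(X, X, Z, Ident T X, Zer T X Z, Zer T Z (Sob 1 X)) \<in> Exact T"
  using Exact_Ident[OF assms] by (simp add: Susp_eq)

lemma zero_Sob:
  assumes "is_zero_object T Z" shows "is_zero_object T (Sob n Z)"
proof (rule zero_objectI)
  have "Z \<in> Ob T" "Ident T Z = Zer T Z Z"
    using zero_objectD[OF assms] arrow_ident by auto
  then show "Sob n Z \<in> Ob T" "Ident T (Sob n Z) = Zer T (Sob n Z) (Sob n Z)"
    using Sob_closed Sh_Ident Sh_Zer by metis+
qed

lemma exact_zero_ident:
  assumes X: "X \<in> Ob T" and Z: "is_zero_object T Z"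
  shows "(Z, X, X, Zer T Z X, Ident T X, Zer T X (Sob 1 Z)) \<in> Exact T"
proof (rule exact_unrotate)
  have Z': "Z \<in> Ob T" by (rule zero_objectD(1)[OF Z])
  show "\<guillemotleft>Zer T Z X : Z \<rightarrow> X\<guillemotright>" using arrow_zero X Z' by blast
  have "Neg T (Sob 1 Z) (Sob 1 X) (Sh 1 (Zer T Z X)) = Zer T (Sob 1 Z) (Sob 1 X)"
    using X Z' zero_neg by (simp add: Sh_Zer Sob_closed)
  then show "(X, X, Sob 1 Z, Ident T X, Zer T X (Sob 1 Z), Neg T (Sob 1 Z) (Sob 1 X) (Sh 1 (Zer T Z X))) \<in> Exact T"
    using exact_ident[OF X zero_Sob[OF Z]] by simp
qed

lemma exact_comp_zero:
  assumes ex: "(X, Y, Z, u, v, w) \<in> Exact T"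
  shows "v \<bullet> u = Zer T X Z"
proof -
  note a = exact_arrows[OF ex]
  obtain O' where O': "is_zero_object T O'" using zero_object by blast
  have X: "X \<in> Ob T" using a arrowD by blast
  obtain h where h: "\<guillemotleft>h : O' \<rightarrow> Z\<guillemotright>" "h \<bullet> Zer T X O' = v \<bullet> u"
    using exact_fill[OF exact_ident[OF X O'] ex arrow_ident[OF X] a(1)] by metis
  have O'': "O' \<in> Ob T" by (rule zero_objectD(1)[OF O'])
  show ?thesis using h comp_zero[OF h(1) X] by simp
qed

lemma exact_comp_zero2: "(X, Y, Z, u, v, w) \<in> Exact T \<Longrightarrow> w \<bullet> v = Zer T Y (Sob 1 X)"
  using exact_comp_zero[OF exact_rotate] .

lemma exact_comp_zero3:
  assumes ex: "(X, Y, Z, u, v, w) \<in> Exact T" shows "Sh 1 u \<bullet> w = Zer T Z (Sob 1 Y)"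
proof -
  note a = exact_arrows[OF ex]
  have "Neg T (Sob 1 X) (Sob 1 Y) (Sh 1 u) \<bullet> w = Zer T Z (Sob 1 Y)"
    by (rule exact_comp_zero[OF exact_rotate[OF exact_rotate[OF ex]]])
  then have "Neg T Z (Sob 1 Y) (Sh 1 u \<bullet> w) = Zer T Z (Sob 1 Y)"
    using neg_comp[OF a(3) Sh_arrow[OF a(1)]] by simp
  then show ?thesis
    using neg_neg[OF arrow_comp[OF a(3) Sh_arrow[OF a(1)]]] zero_neg a arrowD Sob_closed by metis
qed

text \<open>Exactness of \<open>Hom(D, -)\<close> and \<open>Hom(-, E)\<close> on an exact triangle \<open>X \<rightarrow> Y \<rightarrow> Z \<rightarrow> \<Sigma> X\<close>.  The digit
  in the name is the position of the given morphism: 2 for \<open>Y\<close>, 3 for \<open>Z\<close>, and 1 for \<open>\<Sigma> X\<close>.\<close>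

lemma hom_exact2:
  assumes ex: "(X, Y, Z, u, v, w) \<in> Exact T" and f: "\<guillemotleft>f : D \<rightarrow> Y\<guillemotright>" and vf: "v \<bullet> f = Zer T D Z"
  obtains g where "\<guillemotleft>g : D \<rightarrow> X\<guillemotright>" "u \<bullet> g = f"
proof -
  note a = exact_arrows[OF ex]
  obtain O' where O': "is_zero_object T O'" using zero_object by blast
  have O'': "O' \<in> Ob T" by (rule zero_objectD(1)[OF O'])
  have ob: "D \<in> Ob T" "X \<in> Ob T" "Y \<in> Ob T" "Z \<in> Ob T" using a f arrowD by blast+
  have eq: "Zer T O' Z \<bullet> Zer T D O' = v \<bullet> f"
    using vf ob O'' by (simp add: add_rules)
  obtain h where h: "\<guillemotleft>h : Sob 1 D \<rightarrow> Sob 1 X\<guillemotright>"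
      "Sh 1 f \<bullet> Neg T (Sob 1 D) (Sob 1 D) (Sh 1 (Ident T D)) = Neg T (Sob 1 X) (Sob 1 Y) (Sh 1 u) \<bullet> h"
    by (rule exact_fill[OF exact_rotate[OF exact_ident[OF ob(1) O']] exact_rotate[OF ex] f
      arrow_zero[OF O'' ob(4)] eq])
  obtain g where g: "\<guillemotleft>g : D \<rightarrow> X\<guillemotright>" "h = Sh 1 g" using Sh_surj[OF h(1) ob(1,2)] .
  note Sf = Sh_arrow[OF f, of 1] and Su = Sh_arrow[OF a(1), of 1] and ug = arrow_comp[OF g(1) a(1)]
  have "Neg T (Sob 1 D) (Sob 1 Y) (Sh 1 f) = Neg T (Sob 1 D) (Sob 1 Y) (Sh 1 u \<bullet> h)"
    using h(2) comp_neg[OF arrow_ident[OF Sob_closed[OF ob(1)]] Sf] neg_comp[OF h(1) Su] comp_ident[OF Sf]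
      Sh_Ident[OF ob(1)] by simp
  then have "Sh 1 f = Sh 1 u \<bullet> h" by (rule neg_inj[OF Sf arrow_comp[OF h(1) Su]])
  also have "\<dots> = Sh 1 (u \<bullet> g)" using g a by (simp add: tri_rules)
  finally have "u \<bullet> g = f" by (rule Sh_inj[OF f ug, symmetric])
  then show ?thesis using that g by blast
qed

lemma hom_exact3:
  assumes "(X, Y, Z, u, v, w) \<in> Exact T" and "\<guillemotleft>f : D \<rightarrow> Z\<guillemotright>" and "w \<bullet> f = Zer T D (Sob 1 X)"
  obtains g where "\<guillemotleft>g : D \<rightarrow> Y\<guillemotright>" "v \<bullet> g = f"
  using hom_exact2[OF exact_rotate[OF assms(1)] assms(2,3)] .

lemma hom_exact1:
  assumes ex: "(X, Y, Z, u, v, w) \<in> Exact T" and f: "\<guillemotleft>f : D \<rightarrow> Sob 1 X\<guillemotright>"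
    and 0: "Sh 1 u \<bullet> f = Zer T D (Sob 1 Y)"
  obtains g where "\<guillemotleft>g : D \<rightarrow> Z\<guillemotright>" "w \<bullet> g = f"
proof (rule hom_exact3[OF exact_rotate[OF ex] f])
  note a = exact_arrows[OF ex]
  show "Neg T (Sob 1 X) (Sob 1 Y) (Sh 1 u) \<bullet> f = Zer T D (Sob 1 Y)"
    using neg_comp[OF f Sh_arrow[OF a(1)]] 0 zero_neg arrowD[OF f] arrowD[OF a(1)] Sob_closed by simp
qed

lemma cohom_exact2:
  assumes ex: "(X, Y, Z, u, v, w) \<in> Exact T" and f: "\<guillemotleft>f : Y \<rightarrow> E\<guillemotright>" and fu: "f \<bullet> u = Zer T X E"
  obtains g where "\<guillemotleft>g : Z \<rightarrow> E\<guillemotright>" "g \<bullet> v = f"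
proof -
  note a = exact_arrows[OF ex]
  obtain O' where O': "is_zero_object T O'" using zero_object by blast
  have O'': "O' \<in> Ob T" by (rule zero_objectD(1)[OF O'])
  have ob: "E \<in> Ob T" "X \<in> Ob T" "Y \<in> Ob T" "Z \<in> Ob T" using a f arrowD by blast+
  have eq: "f \<bullet> u = Zer T O' E \<bullet> Zer T X O'" using fu ob O'' by (simp add: add_rules)
  obtain h where "\<guillemotleft>h : Z \<rightarrow> E\<guillemotright>" "h \<bullet> v = Ident T E \<bullet> f"
    by (rule exact_fill[OF ex exact_zero_ident[OF ob(1) O'] arrow_zero[OF ob(2) O''] f eq])
  then show ?thesis using that ident_comp[OF f] by simp
qed

lemma cohom_exact3:
  assumes ex: "(X, Y, Z, u, v, w) \<in> Exact T" and "\<guillemotleft>f : Z \<rightarrow> E\<guillemotright>" and "f \<bullet> v = Zer T Y E"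
  obtains g where "\<guillemotleft>g : Sob 1 X \<rightarrow> E\<guillemotright>" "g \<bullet> w = f"
  using cohom_exact2[OF exact_rotate[OF ex] assms(2,3)] .

lemma exact_cone:
  assumes "\<guillemotleft>u : X \<rightarrow> Y\<guillemotright>" obtains Z v w where "(X, Y, Z, u, v, w) \<in> Exact T"
  using Exact_cone arrowD[OF assms] by blast

text \<open>Fibres.  The sign in the rotation axiom is absorbed by the choice of the first morphism.\<close>

lemma exact_fibre:
  assumes u: "\<guillemotleft>u : X \<rightarrow> Y\<guillemotright>"
  obtains F a b where "(F, X, Y, a, u, b) \<in> Exact T"
proof -
  obtain Z v w where ex: "(X, Y, Z, u, v, w) \<in> Exact T" using exact_cone[OF u] .
  note a = exact_arrows[OF ex]
  have ob: "X \<in> Ob T" "Y \<in> Ob T" "Z \<in> Ob T" using a arrowD by blast+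
  define F where "F = Sob (-1) Z"
  have F: "F \<in> Ob T" "Sob 1 F = Z" using ob by (simp_all add: F_def tri_rules)
  have "\<guillemotleft>Neg T Z (Sob 1 X) w : Sob 1 F \<rightarrow> Sob 1 X\<guillemotright>" using arrow_neg[OF a(3)] F by simp
  then obtain k where k: "\<guillemotleft>k : F \<rightarrow> X\<guillemotright>" "Neg T Z (Sob 1 X) w = Sh 1 k" using Sh_surj F(1) ob(1) by metis
  have "Neg T (Sob 1 F) (Sob 1 X) (Sh 1 k) = w" using k(2)[symmetric] neg_neg[OF a(3)] F(2) by simp
  then have "(F, X, Y, k, u, v) \<in> Exact T" using exact_unrotate[OF k(1)] ex F(2) by simp
  then show ?thesis using that by blast
qed

lemma exact_fill_fibre:
  assumes ex: "(F, X, Y, a, u, b) \<in> Exact T" and ex': "(F', X', Y', a', u', b') \<in> Exact T"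
    and f: "\<guillemotleft>f : X \<rightarrow> X'\<guillemotright>" and g: "\<guillemotleft>g : Y \<rightarrow> Y'\<guillemotright>" and eq: "g \<bullet> u = u' \<bullet> f"
  obtains h where "\<guillemotleft>h : F \<rightarrow> F'\<guillemotright>" "f \<bullet> a = a' \<bullet> h" "Sh 1 h \<bullet> b = b' \<bullet> g"
proof -
  note t = exact_arrows[OF ex] and t' = exact_arrows[OF ex']
  have ob: "F \<in> Ob T" "F' \<in> Ob T" using t t' arrowD by blast+
  obtain k where k: "\<guillemotleft>k : Sob 1 F \<rightarrow> Sob 1 F'\<guillemotright>" "k \<bullet> b = b' \<bullet> g"
    "Sh 1 f \<bullet> Neg T (Sob 1 F) (Sob 1 X) (Sh 1 a) = Neg T (Sob 1 F') (Sob 1 X') (Sh 1 a') \<bullet> k"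
    by (rule exact_fill[OF exact_rotate[OF ex] exact_rotate[OF ex'] f g eq])
  obtain h where h: "\<guillemotleft>h : F \<rightarrow> F'\<guillemotright>" "k = Sh 1 h" using Sh_surj[OF k(1) ob] .
  note l = arrow_comp[OF t(1) f] and r = arrow_comp[OF h(1) t'(1)]
  have "Neg T (Sob 1 F) (Sob 1 X') (Sh 1 (f \<bullet> a)) = Neg T (Sob 1 F) (Sob 1 X') (Sh 1 (a' \<bullet> h))"
    using k(3) comp_neg[OF Sh_arrow[OF t(1)] Sh_arrow[OF f], of 1] neg_comp[OF k(1) Sh_arrow[OF t'(1)]]
      h t t' f by (simp add: tri_rules)
  then have "Sh 1 (f \<bullet> a) = Sh 1 (a' \<bullet> h)"
    by (rule neg_inj[OF Sh_arrow[OF l] Sh_arrow[OF r]])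
  then have "f \<bullet> a = a' \<bullet> h" by (rule Sh_inj[OF l r])
  then show ?thesis using that h k by blast
qed

end

section \<open>Finite sums of morphisms into a coproduct\<close>

context preadditive_category
begin

text \<open>The morphisms \<open>D \<rightarrow> P\<close> that are finite sums of morphisms factoring through coprojections.\<close>

inductive finite_sum for I X P \<iota> D where
  zero: "finite_sum I X P \<iota> D (Zer T D P)"
| step: "\<lbrakk>i \<in> I; \<guillemotleft>g : D \<rightarrow> X i\<guillemotright>; finite_sum I X P \<iota> D f\<rbrakk> \<Longrightarrow> finite_sum I X P \<iota> D ((\<iota> i \<bullet> g) \<boxplus> f)"

lemma finite_sum_arrow:
  assumes cp: "is_coproduct T I X P \<iota>" and D: "D \<in> Ob T"
  shows "finite_sum I X P \<iota> D f \<Longrightarrow> \<guillemotleft>f : D \<rightarrow> P\<guillemotright>"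
proof (induction rule: finite_sum.induct)
  case zero then show ?case by (rule arrow_zero[OF D coproduct_arrow(1)[OF cp]])
next
  case (step i g f) then show ?case
    using arrow_add[OF arrow_comp[OF step(2) coproduct_arrow(3)[OF cp step(1)]]] by blast
qed

lemma finite_sum_add:
  assumes cp: "is_coproduct T I X P \<iota>" and D: "D \<in> Ob T" and f': "finite_sum I X P \<iota> D f'"
  shows "finite_sum I X P \<iota> D f \<Longrightarrow> finite_sum I X P \<iota> D (f \<boxplus> f')"
proof (induction rule: finite_sum.induct)
  case zero then show ?case using zero_add[OF finite_sum_arrow[OF cp D f']] f' by simp
next
  case (step i g f)
  have "((\<iota> i \<bullet> g) \<boxplus> f) \<boxplus> f' = (\<iota> i \<bullet> g) \<boxplus> (f \<boxplus> f')"
    using add_assoc[OF arrow_comp[OF step(2) coproduct_arrow(3)[OF cp step(1)]]]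
      finite_sum_arrow[OF cp D] step f' by blast
  then show ?case using finite_sum.step step by metis
qed

lemma finite_sum_comp:
  assumes cp: "is_coproduct T I X P \<iota>" and k: "\<guillemotleft>k : E \<rightarrow> D\<guillemotright>"
  shows "finite_sum I X P \<iota> D f \<Longrightarrow> finite_sum I X P \<iota> E (f \<bullet> k)"
proof (induction rule: finite_sum.induct)
  case zero then show ?case using zero_comp[OF k coproduct_arrow(1)[OF cp]] finite_sum.zero by simp
next
  case (step i g f)
  note \<iota> = coproduct_arrow(3)[OF cp step(1)]
  have "((\<iota> i \<bullet> g) \<boxplus> f) \<bullet> k = (\<iota> i \<bullet> (g \<bullet> k)) \<boxplus> (f \<bullet> k)"
    using add_comp[OF k arrow_comp[OF step(2) \<iota>] finite_sum_arrow[OF cp arrowD(2)[OF k] step(3)]]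
      comp_assoc[OF k step(2) \<iota>] by simp
  then show ?case using finite_sum.step[OF step(1) arrow_comp[OF k step(2)] step(4)] by simp
qed

text \<open>The idempotent of the coproduct that projects onto finitely many summands.\<close>

lemma truncation:
  assumes cp: "is_coproduct T I X P \<iota>" and \<pi>: "\<And>i. i \<in> I \<Longrightarrow> \<guillemotleft>\<pi> i : P \<rightarrow> X i\<guillemotright>"
    "\<And>i. i \<in> I \<Longrightarrow> \<pi> i \<bullet> \<iota> i = Ident T (X i)"
    "\<And>i j. \<lbrakk>i \<in> I; j \<in> I; i \<noteq> j\<rbrakk> \<Longrightarrow> \<pi> i \<bullet> \<iota> j = Zer T (X j) (X i)"
    and F: "finite F"
  shows "F \<subseteq> I \<Longrightarrow> \<exists>E. finite_sum I X P \<iota> P E \<and> (\<forall>i\<in>F. E \<bullet> \<iota> i = \<iota> i) \<and>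
    (\<forall>i\<in>I - F. E \<bullet> \<iota> i = Zer T (X i) P) \<and>
    (\<forall>D k. \<guillemotleft>k : D \<rightarrow> P\<guillemotright> \<and> (\<forall>i\<in>I. \<pi> i \<bullet> k = Zer T D (X i)) \<longrightarrow> E \<bullet> k = Zer T D P)"
  using F
proof (induction F rule: finite_induct)
  case empty
  have P: "P \<in> Ob T" using coproduct_arrow[OF cp] by blast
  have "Zer T P P \<bullet> k = Zer T D P" if "\<guillemotleft>k : D \<rightarrow> P\<guillemotright>" for D k using zero_comp[OF that P] .
  then show ?case using coproduct_arrow(3)[OF cp] finite_sum.zero by (intro exI[of _ "Zer T P P"]) blast
next
  case (insert m F)
  then obtain E where E: "finite_sum I X P \<iota> P E" "\<forall>i\<in>F. E \<bullet> \<iota> i = \<iota> i"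
    "\<forall>i\<in>I - F. E \<bullet> \<iota> i = Zer T (X i) P"
    "\<forall>D k. \<guillemotleft>k : D \<rightarrow> P\<guillemotright> \<and> (\<forall>i\<in>I. \<pi> i \<bullet> k = Zer T D (X i)) \<longrightarrow> E \<bullet> k = Zer T D P" by auto
  have m: "m \<in> I" using insert by blast
  note \<iota>m = coproduct_arrow(3)[OF cp m]
  have P: "P \<in> Ob T" using coproduct_arrow[OF cp] by blast
  have Ea: "\<guillemotleft>E : P \<rightarrow> P\<guillemotright>" by (rule finite_sum_arrow[OF cp P E(1)])
  let ?E = "(\<iota> m \<bullet> \<pi> m) \<boxplus> E"
  have dist: "?E \<bullet> k = (\<iota> m \<bullet> (\<pi> m \<bullet> k)) \<boxplus> (E \<bullet> k)" if "\<guillemotleft>k : D \<rightarrow> P\<guillemotright>" for D k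
    using add_comp[OF that arrow_comp[OF \<pi>(1)[OF m] \<iota>m] Ea] comp_assoc[OF that \<pi>(1)[OF m] \<iota>m] by simp
  have 1: "?E \<bullet> \<iota> i = \<iota> i" if i: "i \<in> insert m F" for i
  proof -
    have iI: "i \<in> I" using i insert m by blast
    note \<iota>i = coproduct_arrow(3)[OF cp iI]
    show ?thesis
    proof (cases "i = m")
      case True
      then have "E \<bullet> \<iota> m = Zer T (X m) P" using E(3) insert(2) m by blast
      then show ?thesis using dist[OF \<iota>i] \<pi>(2)[OF m] comp_ident[OF \<iota>m] add_zero[OF \<iota>m] True by simp
    next
      case False
      then have "E \<bullet> \<iota> i = \<iota> i" using E(2) i by blast
      then show ?thesis using dist[OF \<iota>i] \<pi>(3)[OF m iI] comp_zero[OF \<iota>m coproduct_arrow(2)[OF cp iI]]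
          zero_add[OF \<iota>i] False by simp
    qed
  qed
  have 2: "?E \<bullet> \<iota> i = Zer T (X i) P" if i: "i \<in> I - insert m F" for i
  proof -
    have iI: "i \<in> I" "m \<noteq> i" using i by blast+
    note \<iota>i = coproduct_arrow(3)[OF cp iI(1)]
    have "E \<bullet> \<iota> i = Zer T (X i) P" using E(3) i by blast
    then show ?thesis using dist[OF \<iota>i] \<pi>(3)[OF m iI] comp_zero[OF \<iota>m coproduct_arrow(2)[OF cp iI(1)]]
        zero_add[OF arrow_zero[OF arrowD(1,2)[OF \<iota>i]]] by simp
  qed
  have 3: "?E \<bullet> k = Zer T D P" if k: "\<guillemotleft>k : D \<rightarrow> P\<guillemotright>" "\<forall>i\<in>I. \<pi> i \<bullet> k = Zer T D (X i)" for D k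
    using dist[OF k(1)] k(2)[rule_format, OF m] E(4)[rule_format, of k D] k comp_zero[OF \<iota>m arrowD(1)[OF k(1)]]
      zero_add[OF arrow_zero[OF arrowD(1,2)[OF k(1)]]] by simp
  show ?case using finite_sum.step[OF m \<pi>(1)[OF m] E(1)] 1 2 3 by blast
qed

text \<open>A finite sum involves only finitely many coprojections, so an endomorphism of the coproduct
  that fixes these fixes the sum.\<close>

lemma finite_sum_support:
  assumes cp: "is_coproduct T I X P \<iota>" and D: "D \<in> Ob T"
  shows "finite_sum I X P \<iota> D f \<Longrightarrow>
    \<exists>F. finite F \<and> F \<subseteq> I \<and> (\<forall>E. \<guillemotleft>E : P \<rightarrow> P\<guillemotright> \<and> (\<forall>i\<in>F. E \<bullet> \<iota> i = \<iota> i) \<longrightarrow> E \<bullet> f = f)"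
proof (induction rule: finite_sum.induct)
  case zero
  then show ?case using comp_zero[OF _ D] by (intro exI[of _ "{}"]) blast
next
  case (step i g f)
  then obtain F where F: "finite F" "F \<subseteq> I"
    "\<And>E. \<lbrakk>\<guillemotleft>E : P \<rightarrow> P\<guillemotright>; \<forall>i\<in>F. E \<bullet> \<iota> i = \<iota> i\<rbrakk> \<Longrightarrow> E \<bullet> f = f" by blast
  note \<iota> = coproduct_arrow(3)[OF cp step(1)]
  have "E \<bullet> ((\<iota> i \<bullet> g) \<boxplus> f) = (\<iota> i \<bullet> g) \<boxplus> f"
    if E: "\<guillemotleft>E : P \<rightarrow> P\<guillemotright>" "\<forall>j\<in>insert i F. E \<bullet> \<iota> j = \<iota> j" for E
  proof -
    have "E \<bullet> (\<iota> i \<bullet> g) = \<iota> i \<bullet> g" by (rule comp_eq_comp[OF \<iota> E(1) step(2)]) (use E in blast)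
    moreover have "E \<bullet> f = f" using F(3)[OF E(1)] E(2) by blast
    ultimately show ?thesis
      using comp_add[OF arrow_comp[OF step(2) \<iota>] finite_sum_arrow[OF cp D step(3)] E(1)] by simp
  qed
  then show ?case using F step(1) by (intro exI[of _ "insert i F"]) blast
qed

lemma finite_sum_truncation:
  assumes cp: "is_coproduct T I X P \<iota>" and \<pi>: "\<And>i. i \<in> I \<Longrightarrow> \<guillemotleft>\<pi> i : P \<rightarrow> X i\<guillemotright>"
    "\<And>i. i \<in> I \<Longrightarrow> \<pi> i \<bullet> \<iota> i = Ident T (X i)"
    "\<And>i j. \<lbrakk>i \<in> I; j \<in> I; i \<noteq> j\<rbrakk> \<Longrightarrow> \<pi> i \<bullet> \<iota> j = Zer T (X j) (X i)"
    and f: "finite_sum I X P \<iota> D f" and D: "D \<in> Ob T"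
  shows "\<exists>E F. finite_sum I X P \<iota> P E \<and> E \<bullet> f = f \<and> finite F \<and> F \<subseteq> I \<and>
    (\<forall>i\<in>F. E \<bullet> \<iota> i = \<iota> i) \<and> (\<forall>i\<in>I - F. E \<bullet> \<iota> i = Zer T (X i) P) \<and>
    (\<forall>D k. \<guillemotleft>k : D \<rightarrow> P\<guillemotright> \<and> (\<forall>i\<in>I. \<pi> i \<bullet> k = Zer T D (X i)) \<longrightarrow> E \<bullet> k = Zer T D P)"
proof -
  obtain F where F: "finite F" "F \<subseteq> I" "\<forall>E. \<guillemotleft>E : P \<rightarrow> P\<guillemotright> \<and> (\<forall>i\<in>F. E \<bullet> \<iota> i = \<iota> i) \<longrightarrow> E \<bullet> f = f"
    using finite_sum_support[OF cp D f] by blast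
  obtain E where E: "finite_sum I X P \<iota> P E" "\<forall>i\<in>F. E \<bullet> \<iota> i = \<iota> i"
    "\<forall>i\<in>I - F. E \<bullet> \<iota> i = Zer T (X i) P"
    "\<forall>D k. \<guillemotleft>k : D \<rightarrow> P\<guillemotright> \<and> (\<forall>i\<in>I. \<pi> i \<bullet> k = Zer T D (X i)) \<longrightarrow> E \<bullet> k = Zer T D P"
    using truncation[OF cp \<pi> F(1,2)] by blast
  have "E \<bullet> f = f" using F(3) E(2) finite_sum_arrow[OF cp coproduct_arrow(1)[OF cp] E(1)] by blast
  then show ?thesis using E F(1,2) by blast
qed

text \<open>On finite sums the projections are jointly injective, though they need not be so on arbitrary
  morphisms into a coproduct.\<close>

lemma finite_sum_eq_zero:
  assumes cp: "is_coproduct T I X P \<iota>" and \<pi>: "\<And>i. i \<in> I \<Longrightarrow> \<guillemotleft>\<pi> i : P \<rightarrow> X i\<guillemotright>"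
    "\<And>i. i \<in> I \<Longrightarrow> \<pi> i \<bullet> \<iota> i = Ident T (X i)"
    "\<And>i j. \<lbrakk>i \<in> I; j \<in> I; i \<noteq> j\<rbrakk> \<Longrightarrow> \<pi> i \<bullet> \<iota> j = Zer T (X j) (X i)"
    and f: "finite_sum I X P \<iota> D f" and D: "D \<in> Ob T" and 0: "\<forall>i\<in>I. \<pi> i \<bullet> f = Zer T D (X i)"
  shows "f = Zer T D P"
proof -
  obtain E where E: "E \<bullet> f = f"
    "\<forall>D k. \<guillemotleft>k : D \<rightarrow> P\<guillemotright> \<and> (\<forall>i\<in>I. \<pi> i \<bullet> k = Zer T D (X i)) \<longrightarrow> E \<bullet> k = Zer T D P"
    using finite_sum_truncation[OF cp \<pi> f D] by blast
  show ?thesis using E(2)[rule_format, OF conjI, OF finite_sum_arrow[OF cp D f] 0] unfolding E(1) .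
qed

lemma finprod_finite_sum:
  assumes cp: "is_coproduct T I X P \<iota>" and \<pi>: "\<And>i. i \<in> I \<Longrightarrow> \<guillemotleft>\<pi> i : P \<rightarrow> X i\<guillemotright>"
    "\<And>i. i \<in> I \<Longrightarrow> \<pi> i \<bullet> \<iota> i = Ident T (X i)"
    "\<And>i j. \<lbrakk>i \<in> I; j \<in> I; i \<noteq> j\<rbrakk> \<Longrightarrow> \<pi> i \<bullet> \<iota> j = Zer T (X j) (X i)"
    and D: "D \<in> Ob T" and F: "finite F"
  shows "\<lbrakk>F \<subseteq> I; \<And>i. i \<in> F \<Longrightarrow> \<guillemotleft>g i : D \<rightarrow> X i\<guillemotright>\<rbrakk> \<Longrightarrow>
    finite_sum I X P \<iota> D (finprod (Hom_group T D P) (\<lambda>i. \<iota> i \<bullet> g i) F) \<and>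
    (\<forall>m\<in>I. \<pi> m \<bullet> finprod (Hom_group T D P) (\<lambda>i. \<iota> i \<bullet> g i) F = (if m \<in> F then g m else Zer T D (X m)))"
  using F
proof (induction F rule: finite_induct)
  case empty
  interpret comm_monoid "Hom_group T D P"
    using Hom_comm_group[OF D coproduct_arrow(1)[OF cp]] by (rule comm_group.axioms)
  show ?case using finite_sum.zero comp_zero[OF \<pi>(1) D] by simp
next
  case (insert j F)
  interpret comm_monoid "Hom_group T D P"
    using Hom_comm_group[OF D coproduct_arrow(1)[OF cp]] by (rule comm_group.axioms)
  let ?S = "\<lambda>F. finprod (Hom_group T D P) (\<lambda>i. \<iota> i \<bullet> g i) F"
  have IH: "finite_sum I X P \<iota> D (?S F)" "\<forall>m\<in>I. \<pi> m \<bullet> ?S F = (if m \<in> F then g m else Zer T D (X m))"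
    using insert by auto
  have j: "j \<in> I" and gj: "\<guillemotleft>g j : D \<rightarrow> X j\<guillemotright>" using insert by auto
  note \<iota>j = coproduct_arrow(3)[OF cp j]
  note Sa = finite_sum_arrow[OF cp D IH(1)]
  have cl: "\<iota> i \<bullet> g i \<in> Hom T D P" if "i \<in> insert j F" for i
  proof -
    have "i \<in> I" using that insert(4) by blast
    then show ?thesis by (rule arrowD(3)[OF arrow_comp[OF insert(5)[OF that] coproduct_arrow(3)[OF cp]]])
  qed
  have eq: "?S (insert j F) = (\<iota> j \<bullet> g j) \<boxplus> ?S F"
    using finprod_insert[OF insert(1,2), of "\<lambda>i. \<iota> i \<bullet> g i"] cl by auto
  have "\<pi> m \<bullet> ?S (insert j F) = (if m \<in> insert j F then g m else Zer T D (X m))" if m: "m \<in> I" for m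
  proof -
    have "\<pi> m \<bullet> ?S (insert j F) = (\<pi> m \<bullet> (\<iota> j \<bullet> g j)) \<boxplus> (\<pi> m \<bullet> ?S F)"
      unfolding eq by (rule comp_add[OF arrow_comp[OF gj \<iota>j] Sa \<pi>(1)[OF m]])
    also have "\<pi> m \<bullet> (\<iota> j \<bullet> g j) = (if m = j then g j else Zer T D (X m))"
      using comp_assoc[OF gj \<iota>j \<pi>(1)[OF m]] \<pi>(2)[OF m] \<pi>(3)[OF m j] ident_comp[OF gj]
        zero_comp[OF gj coproduct_arrow(2)[OF cp m]] by auto
    also have "\<dots> \<boxplus> (\<pi> m \<bullet> ?S F) = (if m \<in> insert j F then g m else Zer T D (X m))"
      using IH(2) m insert(2) add_zero[OF gj] zero_add[OF arrow_zero[OF D coproduct_arrow(2)[OF cp m]]]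
        zero_add[OF insert(5)[of m]] by auto
    finally show ?thesis .
  qed
  then show ?case using finite_sum.step[OF j gj IH(1)] eq by simp
qed

text \<open>An object is compact if and only if every morphism to a small coproduct is such a finite sum;
  the injectivity of the canonical map is automatic.\<close>

lemma compact_iff:
  fixes \<kappa> :: "'i rel"
  shows "compact_object \<kappa> T D \<longleftrightarrow> D \<in> Ob T \<and> (\<forall>(I :: 'i set) X P \<iota> h.
    small \<kappa> I \<and> is_coproduct T I X P \<iota> \<and> \<guillemotleft>h : D \<rightarrow> P\<guillemotright> \<longrightarrow> finite_sum I X P \<iota> D h)"
    (is "_ \<longleftrightarrow> _ \<and> ?R")
proof -
  have "bij_betw
          (\<lambda>g. finprod (Hom_group T D P) (\<lambda>i. \<iota> i \<bullet> g i) {i \<in> I. g i \<noteq> Zer T D (X i)})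
          {g \<in> (\<Pi>\<^sub>E i \<in> I. Hom T D (X i)). finite {i \<in> I. g i \<noteq> Zer T D (X i)}} (Hom T D P)
        \<longleftrightarrow> (\<forall>h. \<guillemotleft>h : D \<rightarrow> P\<guillemotright> \<longrightarrow> finite_sum I X P \<iota> D h)" (is "bij_betw ?\<phi> ?A _ \<longleftrightarrow> _")
    if cp: "is_coproduct T I X P \<iota>" and D: "D \<in> Ob T" for I :: "'i set" and X P \<iota>
  proof -
    obtain \<pi> where \<pi>: "\<And>i. i \<in> I \<Longrightarrow> \<guillemotleft>\<pi> i : P \<rightarrow> X i\<guillemotright>"
      "\<And>i. i \<in> I \<Longrightarrow> \<pi> i \<bullet> \<iota> i = Ident T (X i)"
      "\<And>i j. \<lbrakk>i \<in> I; j \<in> I; i \<noteq> j\<rbrakk> \<Longrightarrow> \<pi> i \<bullet> \<iota> j = Zer T (X j) (X i)"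
      using coproduct_proj[OF cp] by metis
    have P: "P \<in> Ob T" by (rule coproduct_arrow(1)[OF cp])
    have \<phi>: "finite_sum I X P \<iota> D (?\<phi> g)" "\<forall>m\<in>I. \<pi> m \<bullet> ?\<phi> g = g m" if g: "g \<in> ?A" for g
    proof -
      have "\<guillemotleft>g i : D \<rightarrow> X i\<guillemotright>" if "i \<in> I" for i
        using g that D coproduct_arrow(2)[OF cp] by (auto simp: arrow_def)
      then show "finite_sum I X P \<iota> D (?\<phi> g)" "\<forall>m\<in>I. \<pi> m \<bullet> ?\<phi> g = g m"
        using finprod_finite_sum[OF cp \<pi> D, of "{i \<in> I. g i \<noteq> Zer T D (X i)}" g] g by auto
    qed
    have inj: "inj_on ?\<phi> ?A"
    proof (rule inj_onI)
      fix g g' assume g: "g \<in> ?A" "g' \<in> ?A" "?\<phi> g = ?\<phi> g'"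
      have "g m = g' m" if m: "m \<in> I" for m
      proof -
        have "g m = \<pi> m \<bullet> ?\<phi> g" by (rule \<phi>(2)[OF g(1), THEN bspec, OF m, symmetric])
        also have "\<dots> = \<pi> m \<bullet> ?\<phi> g'" by (rule arg_cong[OF g(3)])
        also have "\<dots> = g' m" by (rule \<phi>(2)[OF g(2), THEN bspec, OF m])
        finally show ?thesis .
      qed
      moreover have "g \<in> (\<Pi>\<^sub>E i \<in> I. Hom T D (X i))" "g' \<in> (\<Pi>\<^sub>E i \<in> I. Hom T D (X i))" using g(1,2) by blast+
      ultimately show "g = g'" by (auto intro: PiE_ext)
    qed
    have sub: "?\<phi> ` ?A \<subseteq> Hom T D P"
    proof (rule image_subsetI)
      fix g assume "g \<in> ?A"
      then show "?\<phi> g \<in> Hom T D P" by (rule arrowD(3)[OF finite_sum_arrow[OF cp D \<phi>(1)]])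
    qed
    have sur: "h \<in> ?\<phi> ` ?A" if h: "finite_sum I X P \<iota> D h" for h
    proof -
      have ha: "\<guillemotleft>h : D \<rightarrow> P\<guillemotright>" by (rule finite_sum_arrow[OF cp D h])
      obtain E F where EF: "finite_sum I X P \<iota> P E" "E \<bullet> h = h" "finite F" "F \<subseteq> I"
        "\<forall>i\<in>F. E \<bullet> \<iota> i = \<iota> i" "\<forall>i\<in>I - F. E \<bullet> \<iota> i = Zer T (X i) P"
        using finite_sum_truncation[OF cp \<pi> h D] by blast
      have Ea: "\<guillemotleft>E : P \<rightarrow> P\<guillemotright>" by (rule finite_sum_arrow[OF cp P EF(1)])
      have out: "\<pi> i \<bullet> h = Zer T D (X i)" if i: "i \<in> I - F" for i
      proof -
        have iI: "i \<in> I" using i by blast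
        note Xi = coproduct_arrow(2)[OF cp iI]
        have "\<pi> i \<bullet> E = Zer T P (X i)"
        proof (rule coproduct_ext[OF cp arrow_comp[OF Ea \<pi>(1)[OF iI]] arrow_zero[OF P Xi]])
          fix j assume j: "j \<in> I"
          note \<iota>j = coproduct_arrow(3)[OF cp j]
          have "(\<pi> i \<bullet> E) \<bullet> \<iota> j = \<pi> i \<bullet> (E \<bullet> \<iota> j)" by (rule comp_assoc[OF \<iota>j Ea \<pi>(1)[OF iI]])
          also have "\<dots> = Zer T (X j) (X i)"
          proof (cases "j \<in> F")
            case True
            then show ?thesis using EF(5) \<pi>(3)[OF iI j] i by auto
          next
            case False
            then show ?thesis using EF(6) comp_zero[OF \<pi>(1)[OF iI] coproduct_arrow(2)[OF cp j]] j by simp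
          qed
          also have "\<dots> = Zer T P (X i) \<bullet> \<iota> j" by (rule zero_comp[OF \<iota>j Xi, symmetric])
          finally show "(\<pi> i \<bullet> E) \<bullet> \<iota> j = Zer T P (X i) \<bullet> \<iota> j" .
        qed
        then have "\<pi> i \<bullet> (E \<bullet> h) = Zer T P (X i) \<bullet> h" by (rule comp_eq_comp[OF Ea \<pi>(1)[OF iI] ha])
        then show ?thesis unfolding EF(2) zero_comp[OF ha Xi] .
      qed
      define g where "g = restrict (\<lambda>i. \<pi> i \<bullet> h) I"
      have "{i \<in> I. g i \<noteq> Zer T D (X i)} \<subseteq> F" using out by (auto simp: g_def)
      then have "finite {i \<in> I. g i \<noteq> Zer T D (X i)}" using EF(3) finite_subset by blast
      then have g: "g \<in> ?A" using arrowD(3)[OF arrow_comp[OF ha \<pi>(1)]] by (auto simp: g_def)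
      note \<phi>g = finite_sum_arrow[OF cp D \<phi>(1)[OF g]]
      have neg: "finite_sum I X P \<iota> D (Neg T D P (?\<phi> g))"
        using finite_sum_comp[OF cp arrow_neg[OF arrow_ident[OF D]] \<phi>(1)[OF g]]
          comp_neg[OF arrow_ident[OF D] \<phi>g] comp_ident[OF \<phi>g] by simp
      have 0: "\<forall>i\<in>I. \<pi> i \<bullet> (h \<boxplus> Neg T D P (?\<phi> g)) = Zer T D (X i)"
      proof
        fix i assume i: "i \<in> I"
        show "\<pi> i \<bullet> (h \<boxplus> Neg T D P (?\<phi> g)) = Zer T D (X i)"
          by (rule comp_diff_zero[OF ha \<phi>g \<pi>(1)[OF i]]) (use \<phi>(2)[OF g] i in \<open>simp add: g_def\<close>)
      qed
      have "h \<boxplus> Neg T D P (?\<phi> g) = Zer T D P"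
        by (rule finite_sum_eq_zero[OF cp \<pi> finite_sum_add[OF cp D neg h] D 0])
      then have "h = ?\<phi> g" by (rule diff_zero[OF ha \<phi>g])
      then show ?thesis using g by blast
    qed
    show ?thesis
    proof
      assume "bij_betw ?\<phi> ?A (Hom T D P)"
      then have im: "?\<phi> ` ?A = Hom T D P" by (simp only: bij_betw_def)
      show "\<forall>h. \<guillemotleft>h : D \<rightarrow> P\<guillemotright> \<longrightarrow> finite_sum I X P \<iota> D h"
      proof (intro allI impI)
        fix h assume "\<guillemotleft>h : D \<rightarrow> P\<guillemotright>"
        then have "h \<in> ?\<phi> ` ?A" using im arrowD(3) by blast
        then obtain g where "h = ?\<phi> g" "g \<in> ?A" by (rule imageE)
        then show "finite_sum I X P \<iota> D h" using \<phi>(1) by blast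
      qed
    next
      assume R: "\<forall>h. \<guillemotleft>h : D \<rightarrow> P\<guillemotright> \<longrightarrow> finite_sum I X P \<iota> D h"
      have "Hom T D P \<subseteq> ?\<phi> ` ?A" using R sur arrowI[OF D P] by blast
      then show "bij_betw ?\<phi> ?A (Hom T D P)" using inj sub unfolding bij_betw_def by blast
    qed
  qed
  then show ?thesis unfolding compact_object_def by (intro conj_cong refl) (auto 0 4)
qed

lemma compactD:
  fixes \<kappa> :: "'i rel" and I :: "'i set"
  assumes "compact_object \<kappa> T D"
  shows "D \<in> Ob T" "\<lbrakk>small \<kappa> I; is_coproduct T I X P \<iota>; \<guillemotleft>h : D \<rightarrow> P\<guillemotright>\<rbrakk> \<Longrightarrow> finite_sum I X P \<iota> D h"
  using assms unfolding compact_iff by blast+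

text \<open>Compactness refers to index sets of the type \<open>'i\<close>.  As \<open>\<kappa>\<close> is uncountable, sets of natural
  numbers are in bijection with small sets of this type, and coproducts over them can be
  reindexed.\<close>

lemma small_nat:
  includes cardinal_syntax
  fixes \<kappa> :: "'i rel" and J :: "nat set"
  assumes "uncountable_cardinal \<kappa>"
  obtains I :: "'i set" and \<phi> where "small \<kappa> I" "bij_betw \<phi> I J"
proof -
  have \<kappa>: "Card_order \<kappa>" "natLeq <o \<kappa>" using assms by (auto simp: uncountable_cardinal_def)
  have "|J| \<le>o |UNIV :: nat set|" by (rule card_of_mono1) simp
  then have J: "|J| <o \<kappa>" using card_of_nat \<kappa>(2) by (meson ordIso_ordLess_trans ordLeq_ordLess_trans)
  have "|J| \<le>o |Field \<kappa>|"
    using J card_of_Field_ordIso[OF \<kappa>(1)] ordIso_symmetric ordLess_ordIso_trans ordLess_imp_ordLeq by blast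
  then obtain f where f: "inj_on f J" "f ` J \<subseteq> Field \<kappa>" unfolding card_of_ordLeq[symmetric] by blast
  have bij: "bij_betw f J (f ` J)" using f(1) by (rule inj_on_imp_bij_betw)
  then have "|f ` J| =o |J|" using card_of_ordIso ordIso_symmetric by blast
  then have "small \<kappa> (f ` J)" unfolding small_def using J ordIso_ordLess_trans by blast
  then show ?thesis using that bij_betw_inv_into[OF bij] by blast
qed

lemma compact_nat:
  fixes \<kappa> :: "'i rel" and J :: "nat set"
  assumes \<kappa>: "uncountable_cardinal \<kappa>" and D: "compact_object \<kappa> T D"
    and cp: "is_coproduct T J X P \<iota>" and h: "\<guillemotleft>h : D \<rightarrow> P\<guillemotright>"
  shows "finite_sum J X P \<iota> D h"
proof -
  obtain I :: "'i set" and \<phi> where I: "small \<kappa> I" "bij_betw \<phi> I J" by (rule small_nat[OF \<kappa>])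
  have "finite_sum I (\<lambda>i. X (\<phi> i)) P (\<lambda>i. \<iota> (\<phi> i)) D h"
    by (rule compactD(2)[OF D I(1) coproduct_reindex[OF cp I(2)] h])
  then show ?thesis
  proof (induction rule: finite_sum.induct)
    case zero then show ?case by (rule finite_sum.zero)
  next
    case (step i g f)
    have "\<phi> i \<in> J" using I(2) step(1) by (auto simp: bij_betw_def)
    then show ?case using finite_sum.step step by metis
  qed
qed

lemma coproduct_nat:
  fixes \<kappa> :: "'i rel" and J :: "nat set"
  assumes \<kappa>: "uncountable_cardinal \<kappa>" and c: "has_small_coproducts \<kappa> T"
    and X: "\<And>j. j \<in> J \<Longrightarrow> X j \<in> Ob T"
  obtains P \<iota> where "is_coproduct T J X P \<iota>"
proof -
  obtain I :: "'i set" and \<phi> where I: "small \<kappa> I" "bij_betw \<phi> I J" by (rule small_nat[OF \<kappa>])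
  have "\<forall>i\<in>I. X (\<phi> i) \<in> Ob T" using I(2) X by (auto simp: bij_betw_def)
  then obtain P \<iota> where cp: "is_coproduct T I (\<lambda>i. X (\<phi> i)) P \<iota>"
    using c[unfolded has_small_coproducts_def, rule_format, of I "\<lambda>i. X (\<phi> i)"] I(1) by blast
  have bij: "bij_betw (inv_into I \<phi>) J I" by (rule bij_betw_inv_into[OF I(2)])
  have "is_coproduct T J (\<lambda>j. X (\<phi> (inv_into I \<phi> j))) P (\<lambda>j. \<iota> (inv_into I \<phi> j))"
    by (rule coproduct_reindex[OF cp bij])
  then have "is_coproduct T J X P (\<lambda>j. \<iota> (inv_into I \<phi> j))"
    by (rule coproduct_cong) (simp add: bij_betw_inv_into_right[OF I(2)])
  then show ?thesis by (rule that)
qed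

end

section \<open>Compact objects and localizing subcategories\<close>

context triangulated_category
begin

lemma coproduct_shift:
  assumes cp: "is_coproduct T I X P \<iota>"
  shows "is_coproduct T I (\<lambda>i. Sob n (X i)) (Sob n P) (\<lambda>i. Sh n (\<iota> i))"
proof (rule coproductI)
  note P = coproduct_arrow(1)[OF cp] and X = coproduct_arrow(2)[OF cp] and \<iota> = coproduct_arrow(3)[OF cp]
  show "Sob n P \<in> Ob T" by (rule Sob_closed[OF P])
  show "\<guillemotleft>Sh n (\<iota> i) : Sob n (X i) \<rightarrow> Sob n P\<guillemotright>" if "i \<in> I" for i by (rule Sh_arrow[OF \<iota>[OF that]])
  show "\<exists>g. \<guillemotleft>g : Sob n P \<rightarrow> Y\<guillemotright> \<and> (\<forall>i\<in>I. g \<bullet> Sh n (\<iota> i) = h i)"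
    if Y: "Y \<in> Ob T" and h: "\<And>i. i \<in> I \<Longrightarrow> \<guillemotleft>h i : Sob n (X i) \<rightarrow> Y\<guillemotright>" for Y h
  proof -
    have h': "\<guillemotleft>Sh (- n) (h i) : X i \<rightarrow> Sob (- n) Y\<guillemotright>" if "i \<in> I" for i
      using Sh_arrow[OF h[OF that], of "- n"] X[OF that] by (simp add: Sob_add Sob_0)
    obtain g where g: "\<guillemotleft>g : P \<rightarrow> Sob (- n) Y\<guillemotright>" "\<And>i. i \<in> I \<Longrightarrow> g \<bullet> \<iota> i = Sh (- n) (h i)"
      using coproduct_desc[OF cp Sob_closed[OF Y] h'] by metis
    have "\<guillemotleft>Sh n g : Sob n P \<rightarrow> Y\<guillemotright>" using Sh_arrow[OF g(1), of n] Y by (simp add: Sob_add Sob_0)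
    moreover have "Sh n g \<bullet> Sh n (\<iota> i) = h i" if i: "i \<in> I" for i
    proof -
      have "Sh n g \<bullet> Sh n (\<iota> i) = Sh n (g \<bullet> \<iota> i)" using g(1) \<iota>[OF i] by (simp add: tri_rules)
      also have "\<dots> = h i" using g(2)[OF i] h[OF i] by (simp add: tri_rules)
      finally show ?thesis .
    qed
    ultimately show ?thesis by blast
  qed
  show "g = g'" if g: "\<guillemotleft>g : Sob n P \<rightarrow> Y\<guillemotright>" "\<guillemotleft>g' : Sob n P \<rightarrow> Y\<guillemotright>"
    and eq: "\<And>i. i \<in> I \<Longrightarrow> g \<bullet> Sh n (\<iota> i) = g' \<bullet> Sh n (\<iota> i)" for Y g g'
  proof -
    have a: "\<guillemotleft>Sh (- n) k : P \<rightarrow> Sob (- n) Y\<guillemotright>" if "\<guillemotleft>k : Sob n P \<rightarrow> Y\<guillemotright>" for k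
      using Sh_arrow[OF that, of "- n"] P by (simp add: Sob_add Sob_0)
    have "Sh (- n) g = Sh (- n) g'"
    proof (rule coproduct_ext[OF cp a[OF g(1)] a[OF g(2)]])
      fix i assume i: "i \<in> I"
      have *: "Sh (- n) k \<bullet> \<iota> i = Sh (- n) (k \<bullet> Sh n (\<iota> i))" if "\<guillemotleft>k : Sob n P \<rightarrow> Y\<guillemotright>" for k
        using that \<iota>[OF i] by (simp add: tri_rules)
      show "Sh (- n) g \<bullet> \<iota> i = Sh (- n) g' \<bullet> \<iota> i" using *[OF g(1)] *[OF g(2)] eq[OF i] by simp
    qed
    then show ?thesis by (rule Sh_inj[OF g])
  qed
qed

lemma finite_sum_shift:
  assumes cp: "is_coproduct T I X P \<iota>" and D: "D \<in> Ob T"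
  shows "finite_sum I (\<lambda>i. Sob (- n) (X i)) (Sob (- n) P) (\<lambda>i. Sh (- n) (\<iota> i)) D f \<Longrightarrow>
    finite_sum I X P \<iota> (Sob n D) (Sh n f)"
proof (induction rule: finite_sum.induct)
  case zero
  have "Sh n (Zer T D (Sob (- n) P)) = Zer T (Sob n D) P"
    using D coproduct_arrow(1)[OF cp] by (simp add: tri_rules)
  then show ?case using finite_sum.zero by simp
next
  case (step i g f)
  note \<iota> = coproduct_arrow(3)[OF cp step(1)] and X = coproduct_arrow(2)[OF cp step(1)]
  have f: "\<guillemotleft>f : D \<rightarrow> Sob (- n) P\<guillemotright>" by (rule finite_sum_arrow[OF coproduct_shift[OF cp] D step(3)])
  have g: "\<guillemotleft>Sh n g : Sob n D \<rightarrow> X i\<guillemotright>" using Sh_arrow[OF step(2), of n] X by (simp add: Sob_add Sob_0)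
  have "Sh n ((Sh (- n) (\<iota> i) \<bullet> g) \<boxplus> f) = (\<iota> i \<bullet> Sh n g) \<boxplus> Sh n f"
    using \<iota> step(2) f by (simp add: tri_rules)
  then show ?case using finite_sum.step[OF step(1) g step(4)] by simp
qed

lemma compact_shift:
  fixes \<kappa> :: "'i rel"
  assumes D: "compact_object \<kappa> T D" shows "compact_object \<kappa> T (Sob n D)"
  unfolding compact_iff
proof (intro conjI allI impI)
  show "Sob n D \<in> Ob T" by (rule Sob_closed[OF compactD(1)[OF D]])
  fix I :: "'i set" and X P \<iota> h assume "small \<kappa> I \<and> is_coproduct T I X P \<iota> \<and> \<guillemotleft>h : Sob n D \<rightarrow> P\<guillemotright>"
  then have I: "small \<kappa> I" and cp: "is_coproduct T I X P \<iota>" and h: "\<guillemotleft>h : Sob n D \<rightarrow> P\<guillemotright>" by blast+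
  have "\<guillemotleft>Sh (- n) h : D \<rightarrow> Sob (- n) P\<guillemotright>"
    using Sh_arrow[OF h, of "- n"] compactD(1)[OF D] by (simp add: Sob_add Sob_0)
  then have "finite_sum I X P \<iota> (Sob n D) (Sh n (Sh (- n) h))"
    by (intro finite_sum_shift[OF cp compactD(1)[OF D]] compactD(2)[OF D I coproduct_shift[OF cp]])
  then show "finite_sum I X P \<iota> (Sob n D) h" using h by (simp add: tri_rules)
qed

lemma compact_cone:
  fixes \<kappa> :: "'i rel"
  assumes ex: "(A, B, C, \<alpha>, \<beta>, \<gamma>) \<in> Exact T" and A: "compact_object \<kappa> T A" and B: "compact_object \<kappa> T B"
  shows "compact_object \<kappa> T C"
  unfolding compact_iff
proof (intro conjI allI impI)
  note a = exact_arrows[OF ex]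
  show C: "C \<in> Ob T" using a arrowD by blast
  fix I :: "'i set" and X P \<iota> h assume "small \<kappa> I \<and> is_coproduct T I X P \<iota> \<and> \<guillemotleft>h : C \<rightarrow> P\<guillemotright>"
  then have I: "small \<kappa> I" and cp: "is_coproduct T I X P \<iota>" and h: "\<guillemotleft>h : C \<rightarrow> P\<guillemotright>" by blast+
  note h\<beta> = arrow_comp[OF a(2) h]
  obtain \<pi> where \<pi>: "\<And>i. i \<in> I \<Longrightarrow> \<guillemotleft>\<pi> i : P \<rightarrow> X i\<guillemotright>"
    "\<And>i. i \<in> I \<Longrightarrow> \<pi> i \<bullet> \<iota> i = Ident T (X i)"
    "\<And>i j. \<lbrakk>i \<in> I; j \<in> I; i \<noteq> j\<rbrakk> \<Longrightarrow> \<pi> i \<bullet> \<iota> j = Zer T (X j) (X i)"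
    using coproduct_proj[OF cp] by metis
  obtain E where E: "finite_sum I X P \<iota> P E" "E \<bullet> (h \<bullet> \<beta>) = h \<bullet> \<beta>"
    using finite_sum_truncation[OF cp \<pi> compactD(2)[OF B I cp h\<beta>] arrowD(1)[OF a(2)]] by blast
  note Ea = finite_sum_arrow[OF cp coproduct_arrow(1)[OF cp] E(1)]
  have Eh: "finite_sum I X P \<iota> C (E \<bullet> h)" by (rule finite_sum_comp[OF cp h E(1)])
  note Eha = arrow_comp[OF h Ea]
  let ?r = "h \<boxplus> Neg T C P (E \<bullet> h)"
  have r: "\<guillemotleft>?r : C \<rightarrow> P\<guillemotright>" by (rule arrow_add[OF h arrow_neg[OF Eha]])
  \<comment> \<open>The part of \<open>h\<close> not captured by \<open>E\<close> vanishes on \<open>B\<close>, so it factors through \<open>\<Sigma> A\<close>.\<close>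
  have "?r \<bullet> \<beta> = Zer T B P"
    using diff_comp_zero[OF a(2) h Eha] comp_assoc[OF a(2) h Ea] E(2) by simp
  then obtain k where k: "\<guillemotleft>k : Sob 1 A \<rightarrow> P\<guillemotright>" "k \<bullet> \<gamma> = ?r" by (rule cohom_exact3[OF ex r])
  have "finite_sum I X P \<iota> C ?r"
    using finite_sum_comp[OF cp a(3) compactD(2)[OF compact_shift[OF A] I cp k(1)]] k(2) by simp
  then have "finite_sum I X P \<iota> C ((E \<bullet> h) \<boxplus> ?r)" by (rule finite_sum_add[OF cp C _ Eh])
  then show "finite_sum I X P \<iota> C h" using diff_add[OF h Eha] by simp
qed

lemma compact_fibre:
  assumes ex: "(A, B, C, \<alpha>, \<beta>, \<gamma>) \<in> Exact T" and B: "compact_object \<kappa> T B" and C: "compact_object \<kappa> T C"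
  shows "compact_object \<kappa> T A"
proof -
  have "compact_object \<kappa> T (Sob 1 A)" by (rule compact_cone[OF exact_rotate[OF ex] B C])
  from compact_shift[OF this, of "-1"] show ?thesis
    using arrowD(1)[OF exact_arrows(1)[OF ex]] by (simp add: Sob_add Sob_0)
qed

lemma localizingD:
  fixes \<kappa> :: "'i rel" and I :: "'i set"
  assumes "localizing_subcategory \<kappa> T L"
  shows "L \<subseteq> Ob T" "L \<noteq> {}" "X \<in> Ob T \<Longrightarrow> Sob 1 X \<in> L \<longleftrightarrow> X \<in> L"
    "\<lbrakk>(X, Y, Z, u, v, w) \<in> Exact T; X \<in> L; Y \<in> L\<rbrakk> \<Longrightarrow> Z \<in> L"
    "\<lbrakk>small \<kappa> I; is_coproduct T I \<xi> P \<iota>; \<And>i. i \<in> I \<Longrightarrow> \<xi> i \<in> L\<rbrakk> \<Longrightarrow> P \<in> L"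
proof -
  note tr = assms[unfolded localizing_subcategory_def triangulated_subcategory_def Susp_eq]
  show "L \<subseteq> Ob T" using tr by (elim conjE)
  show "L \<noteq> {}" using tr by (elim conjE)
  show "X \<in> Ob T \<Longrightarrow> Sob 1 X \<in> L \<longleftrightarrow> X \<in> L"
    using tr[THEN conjunct1, THEN conjunct2, THEN conjunct2, THEN conjunct1, THEN bspec] .
  show "\<lbrakk>(X, Y, Z, u, v, w) \<in> Exact T; X \<in> L; Y \<in> L\<rbrakk> \<Longrightarrow> Z \<in> L"
    using tr[THEN conjunct1, THEN conjunct2, THEN conjunct2, THEN conjunct2] by blast
  show "\<lbrakk>small \<kappa> I; is_coproduct T I \<xi> P \<iota>; \<And>i. i \<in> I \<Longrightarrow> \<xi> i \<in> L\<rbrakk> \<Longrightarrow> P \<in> L"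
    using tr[THEN conjunct2] by blast
qed

lemma localizingI:
  fixes \<kappa> :: "'i rel"
  assumes "L \<subseteq> Ob T" "L \<noteq> {}" "\<And>X. X \<in> Ob T \<Longrightarrow> Sob 1 X \<in> L \<longleftrightarrow> X \<in> L"
    "\<And>X Y Z u v w. \<lbrakk>(X, Y, Z, u, v, w) \<in> Exact T; X \<in> L; Y \<in> L\<rbrakk> \<Longrightarrow> Z \<in> L"
    "\<And>(I :: 'i set) \<xi> P \<iota>. \<lbrakk>small \<kappa> I; is_coproduct T I \<xi> P \<iota>; \<And>i. i \<in> I \<Longrightarrow> \<xi> i \<in> L\<rbrakk> \<Longrightarrow> P \<in> L"
  shows "localizing_subcategory \<kappa> T L"
  unfolding localizing_subcategory_def triangulated_subcategory_def Susp_eq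
proof (intro conjI allI impI ballI)
  show "Z \<in> L" if "(X, Y, Z, u, v, w) \<in> Exact T \<and> X \<in> L \<and> Y \<in> L" for X Y Z u v w
    using that assms(4) by blast
  show "P \<in> L" if "small \<kappa> I \<and> is_coproduct T I \<xi> P \<iota> \<and> (\<forall>i\<in>I. \<xi> i \<in> L)" for I :: "'i set" and \<xi> P \<iota>
    using that assms(5) by blast
qed (use assms(1-3) in blast)+

lemma localizing_Ob: "localizing_subcategory \<kappa> T (Ob T)"
proof (rule localizingI)
  show "Ob T \<noteq> {}" using zero_object zero_objectD(1) by blast
  show "Z \<in> Ob T" if "(X, Y, Z, u, v, w) \<in> Exact T" for X Y Z u v w
    using arrowD(2)[OF exact_arrows(2)[OF that]] .
  show "P \<in> Ob T" if "is_coproduct T I X P \<iota>" for I X P \<iota> by (rule coproduct_arrow(1)[OF that])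
qed (use Sob_closed in auto)

lemma localizing_zero:
  assumes L: "localizing_subcategory \<kappa> T L" and Z: "is_zero_object T Z" shows "Z \<in> L"
proof -
  obtain X where X: "X \<in> L" using localizingD(2)[OF L] by blast
  then have "X \<in> Ob T" using localizingD(1)[OF L] by blast
  from localizingD(4)[OF L exact_ident[OF this Z] X X] show ?thesis .
qed

lemma localizing_shift:
  assumes L: "localizing_subcategory \<kappa> T L" and X: "X \<in> L" shows "Sob n X \<in> L"
proof -
  have X': "X \<in> Ob T" using X localizingD(1)[OF L] by blast
  have *: "Sob (i + 1) X \<in> L \<longleftrightarrow> Sob i X \<in> L" for i
    using localizingD(3)[OF L Sob_closed[OF X'], of i] X' by (simp add: Sob_add add.commute)
  show ?thesis
  proof (induction n rule: int_induct[where k = 0])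
    case base show ?case using X by (simp add: Sob_0)
  next
    case (step1 i) then show ?case using * by blast
  next
    case (step2 i) then show ?case using *[of "i - 1"] by simp
  qed
qed

lemma localizing_fibre:
  assumes L: "localizing_subcategory \<kappa> T L" and ex: "(X, Y, Z, u, v, w) \<in> Exact T" and "Y \<in> L" "Z \<in> L"
  shows "X \<in> L"
  using localizingD(4)[OF L exact_rotate[OF ex] assms(3,4)]
    localizingD(3)[OF L arrowD(1)[OF exact_arrows(1)[OF ex]]] by blast

lemma localizing_nat:
  fixes \<kappa> :: "'i rel" and J :: "nat set"
  assumes \<kappa>: "uncountable_cardinal \<kappa>" and L: "localizing_subcategory \<kappa> T L"
    and cp: "is_coproduct T J X P \<iota>" and X: "\<And>j. j \<in> J \<Longrightarrow> X j \<in> L"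
  shows "P \<in> L"
proof -
  obtain I :: "'i set" and \<phi> where I: "small \<kappa> I" "bij_betw \<phi> I J" by (rule small_nat[OF \<kappa>])
  show ?thesis
    by (rule localizingD(5)[OF L I(1) coproduct_reindex[OF cp I(2)] X]) (use I(2) in \<open>auto simp: bij_betw_def\<close>)
qed

lemma Loc_least: "\<lbrakk>localizing_subcategory \<kappa> T L; S \<subseteq> L\<rbrakk> \<Longrightarrow> Loc \<kappa> T S \<subseteq> L"
  unfolding Loc_def by blast

lemma Loc_incl: "S \<subseteq> Loc \<kappa> T S"
  unfolding Loc_def by blast

lemma Loc_localizing:
  fixes \<kappa> :: "'i rel"
  assumes S: "S \<subseteq> Ob T" shows "localizing_subcategory \<kappa> T (Loc \<kappa> T S)"
proof (rule localizingI)
  show "Loc \<kappa> T S \<subseteq> Ob T" by (rule Loc_least[OF localizing_Ob S])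
  obtain Z where "is_zero_object T Z" using zero_object by blast
  then have "Z \<in> Loc \<kappa> T S" unfolding Loc_def using localizing_zero by blast
  then show "Loc \<kappa> T S \<noteq> {}" by blast
  show "Sob 1 X \<in> Loc \<kappa> T S \<longleftrightarrow> X \<in> Loc \<kappa> T S" if "X \<in> Ob T" for X
    unfolding Loc_def using localizingD(3) that by blast
  show "Z \<in> Loc \<kappa> T S" if "(X, Y, Z, u, v, w) \<in> Exact T" "X \<in> Loc \<kappa> T S" "Y \<in> Loc \<kappa> T S" for X Y Z u v w
    unfolding Loc_def
  proof (rule InterI)
    fix L assume L: "L \<in> {L. localizing_subcategory \<kappa> T L \<and> S \<subseteq> L}"
    then have "X \<in> L" "Y \<in> L" using that(2,3) unfolding Loc_def by blast+
    then show "Z \<in> L" using localizingD(4)[OF _ that(1)] L by blast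
  qed
  show "P \<in> Loc \<kappa> T S" if "small \<kappa> I" "is_coproduct T I \<xi> P \<iota>" "\<And>i. i \<in> I \<Longrightarrow> \<xi> i \<in> Loc \<kappa> T S"
    for I :: "'i set" and \<xi> P \<iota>
    unfolding Loc_def
  proof (rule InterI)
    fix L assume L: "L \<in> {L. localizing_subcategory \<kappa> T L \<and> S \<subseteq> L}"
    then have "\<And>i. i \<in> I \<Longrightarrow> \<xi> i \<in> L" using that(3) unfolding Loc_def by blast
    then show "P \<in> L" using localizingD(5)[OF _ that(1,2)] L by blast
  qed
qed

lemma hocolim_localizing:
  fixes \<kappa> :: "'i rel"
  assumes \<kappa>: "uncountable_cardinal \<kappa>" and L: "localizing_subcategory \<kappa> T L"
    and H: "is_hocolim T X f H" and X: "\<And>n. n \<ge> 1 \<Longrightarrow> X n \<in> L"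
  shows "H \<in> L"
proof -
  obtain P \<iota> \<sigma> p q where cp: "is_coproduct T {1..} X P \<iota>"
    and ex: "(P, P, H, Ident T P \<boxplus> Neg T P P \<sigma>, p, q) \<in> Exact T"
    using H unfolding is_hocolim_def by blast
  have "P \<in> L" by (rule localizing_nat[OF \<kappa> L cp]) (use X in simp)
  then show ?thesis using localizingD(4)[OF L ex] by blast
qed


section \<open>Coreflections onto localizing subcategories\<close>

text \<open>There are no nonzero morphisms \<open>D \<rightarrow> B\<close>.\<close>

definition orth where "orth D B \<longleftrightarrow> (\<forall>f. \<guillemotleft>f : D \<rightarrow> B\<guillemotright> \<longrightarrow> f = Zer T D B)"

text \<open>Composition with \<open>\<epsilon> : A \<rightarrow> X\<close> is a bijection from \<open>Hom(D, A)\<close> to \<open>Hom(D, X)\<close>.  Injectivity of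
  this group homomorphism is stated as triviality of its kernel.\<close>

definition hom_bij where
  "hom_bij \<epsilon> A X D \<longleftrightarrow> (\<forall>f. \<guillemotleft>f : D \<rightarrow> X\<guillemotright> \<longrightarrow> (\<exists>g. \<guillemotleft>g : D \<rightarrow> A\<guillemotright> \<and> \<epsilon> \<bullet> g = f)) \<and>
    (\<forall>g. \<guillemotleft>g : D \<rightarrow> A\<guillemotright> \<and> \<epsilon> \<bullet> g = Zer T D X \<longrightarrow> g = Zer T D A)"

lemma orthD: "\<lbrakk>orth D B; \<guillemotleft>f : D \<rightarrow> B\<guillemotright>\<rbrakk> \<Longrightarrow> f = Zer T D B"
  unfolding orth_def by blast

lemma orth_shift:
  assumes o: "orth (Sob (- n) D) B" and B: "B \<in> Ob T"
  shows "orth D (Sob n B)"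
  unfolding orth_def
proof (intro allI impI)
  fix f assume f: "\<guillemotleft>f : D \<rightarrow> Sob n B\<guillemotright>"
  have "\<guillemotleft>Sh (- n) f : Sob (- n) D \<rightarrow> B\<guillemotright>" using Sh_arrow[OF f, of "- n"] B by (simp add: Sob_add Sob_0)
  then have "Sh (- n) f = Zer T (Sob (- n) D) B" by (rule orthD[OF o])
  then show "f = Zer T D (Sob n B)" using Sh_zero_iff[OF f, of "- n"] B by (simp add: Sob_add Sob_0)
qed

lemma hom_bij_lift:
  assumes "hom_bij \<epsilon> A X D" "\<guillemotleft>f : D \<rightarrow> X\<guillemotright>" obtains g where "\<guillemotleft>g : D \<rightarrow> A\<guillemotright>" "\<epsilon> \<bullet> g = f"
  using assms unfolding hom_bij_def by blast

lemma hom_bij_zero: "\<lbrakk>hom_bij \<epsilon> A X D; \<guillemotleft>g : D \<rightarrow> A\<guillemotright>; \<epsilon> \<bullet> g = Zer T D X\<rbrakk> \<Longrightarrow> g = Zer T D A"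
  unfolding hom_bij_def by blast

lemma hom_bij_unique:
  assumes b: "hom_bij \<epsilon> A X D" and \<epsilon>: "\<guillemotleft>\<epsilon> : A \<rightarrow> X\<guillemotright>"
    and g: "\<guillemotleft>g : D \<rightarrow> A\<guillemotright>" "\<guillemotleft>g' : D \<rightarrow> A\<guillemotright>" "\<epsilon> \<bullet> g = \<epsilon> \<bullet> g'"
  shows "g = g'"
  by (rule diff_zero[OF g(1,2) hom_bij_zero[OF b arrow_add[OF g(1) arrow_neg[OF g(2)]]
    comp_diff_zero[OF g(1,2) \<epsilon> g(3)]]])

lemma hom_bij_shift:
  assumes b: "hom_bij \<epsilon> A X (Sob (- n) D)" and \<epsilon>: "\<guillemotleft>\<epsilon> : A \<rightarrow> X\<guillemotright>" and D: "D \<in> Ob T"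
  shows "hom_bij (Sh n \<epsilon>) (Sob n A) (Sob n X) D"
  unfolding hom_bij_def
proof (intro conjI allI impI)
  note ob = arrowD(1,2)[OF \<epsilon>] and D' = Sob_closed[OF D, of "- n"]
  have DD: "Sob n (Sob (- n) D) = D" using D by (simp add: Sob_add Sob_0)
  fix f assume "\<guillemotleft>f : D \<rightarrow> Sob n X\<guillemotright>"
  then have "\<guillemotleft>f : Sob n (Sob (- n) D) \<rightarrow> Sob n X\<guillemotright>" using DD by simp
  then obtain f' where f': "\<guillemotleft>f' : Sob (- n) D \<rightarrow> X\<guillemotright>" "f = Sh n f'" by (rule Sh_surj[OF _ D' ob(2)])
  obtain g where g: "\<guillemotleft>g : Sob (- n) D \<rightarrow> A\<guillemotright>" "\<epsilon> \<bullet> g = f'" by (rule hom_bij_lift[OF b f'(1)])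
  have "\<guillemotleft>Sh n g : D \<rightarrow> Sob n A\<guillemotright>" using Sh_arrow[OF g(1), of n] DD by simp
  moreover have "Sh n \<epsilon> \<bullet> Sh n g = f"
    using Sh_comp[of g \<epsilon> n] g \<epsilon> f'(2) by (simp add: arrow_iff)
  ultimately show "\<exists>g. \<guillemotleft>g : D \<rightarrow> Sob n A\<guillemotright> \<and> Sh n \<epsilon> \<bullet> g = f" by blast
next
  note ob = arrowD(1,2)[OF \<epsilon>] and D' = Sob_closed[OF D, of "- n"]
  have DD: "Sob n (Sob (- n) D) = D" using D by (simp add: Sob_add Sob_0)
  fix g assume g: "\<guillemotleft>g : D \<rightarrow> Sob n A\<guillemotright> \<and> Sh n \<epsilon> \<bullet> g = Zer T D (Sob n X)"
  then have "\<guillemotleft>g : Sob n (Sob (- n) D) \<rightarrow> Sob n A\<guillemotright>" using DD by simp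
  then obtain g' where g': "\<guillemotleft>g' : Sob (- n) D \<rightarrow> A\<guillemotright>" "g = Sh n g'" by (rule Sh_surj[OF _ D' ob(1)])
  have "Sh n (\<epsilon> \<bullet> g') = Zer T (Sob n (Sob (- n) D)) (Sob n X)"
    using Sh_comp[of g' \<epsilon> n] g' \<epsilon> g DD by (simp add: arrow_iff)
  then have "\<epsilon> \<bullet> g' = Zer T (Sob (- n) D) X" using Sh_zero_iff[OF arrow_comp[OF g'(1) \<epsilon>]] by blast
  then have "g' = Zer T (Sob (- n) D) A" by (rule hom_bij_zero[OF b g'(1)])
  then show "g = Zer T D (Sob n A)" using g'(2) Sh_Zer[OF D' ob(1), of n] DD by simp
qed

text \<open>The objects without nonzero morphisms to any \<open>\<Sigma>\<^sup>n B\<close> form a localizing subcategory.\<close>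

lemma orth_Loc:
  fixes \<kappa> :: "'i rel"
  assumes G: "G \<subseteq> Ob T" and B: "B \<in> Ob T" and o: "\<And>D n. D \<in> G \<Longrightarrow> orth D (Sob n B)"
    and D: "D \<in> Loc \<kappa> T G"
  shows "orth D (Sob n B)"
proof -
  let ?L = "{X \<in> Ob T. \<forall>n. orth X (Sob n B)}"
  have "localizing_subcategory \<kappa> T ?L"
  proof (rule localizingI)
    obtain Z where Z: "is_zero_object T Z" using zero_object by blast
    then have "Z \<in> ?L" unfolding orth_def using zero_objectD[OF Z] by blast
    then show "?L \<noteq> {}" by blast
  next
    fix X assume X: "X \<in> Ob T"
    have "orth (Sob m X) (Sob (m + n) B) \<longleftrightarrow> orth X (Sob n B)" for m n
    proof
      assume l: "orth (Sob m X) (Sob (m + n) B)"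
      show "orth X (Sob n B)" unfolding orth_def
      proof (intro allI impI)
        fix f assume f: "\<guillemotleft>f : X \<rightarrow> Sob n B\<guillemotright>"
        have "\<guillemotleft>Sh m f : Sob m X \<rightarrow> Sob (m + n) B\<guillemotright>" using Sh_arrow[OF f, of m] B by (simp add: Sob_add)
        then have "Sh m f = Zer T (Sob m X) (Sob (m + n) B)" by (rule orthD[OF l])
        then show "f = Zer T X (Sob n B)" using Sh_zero_iff[OF f, of m] B by (simp add: Sob_add)
      qed
    next
      assume r: "orth X (Sob n B)"
      show "orth (Sob m X) (Sob (m + n) B)" unfolding orth_def
      proof (intro allI impI)
        fix f assume "\<guillemotleft>f : Sob m X \<rightarrow> Sob (m + n) B\<guillemotright>"
        then have "\<guillemotleft>f : Sob m X \<rightarrow> Sob m (Sob n B)\<guillemotright>" using B by (simp add: Sob_add)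
        then obtain f' where f': "\<guillemotleft>f' : X \<rightarrow> Sob n B\<guillemotright>" "f = Sh m f'" by (rule Sh_surj[OF _ X Sob_closed[OF B]])
        then show "f = Zer T (Sob m X) (Sob (m + n) B)"
          using orthD[OF r f'(1)] Sh_Zer[OF X Sob_closed[OF B], of m n] B by (simp add: Sob_add)
      qed
    qed
    then have *: "orth (Sob 1 X) (Sob (1 + n) B) \<longleftrightarrow> orth X (Sob n B)" for n by blast
    have "(\<forall>n. orth (Sob 1 X) (Sob n B)) \<longleftrightarrow> (\<forall>n. orth X (Sob n B))"
      using * by (metis add.commute diff_add_cancel)
    then show "Sob 1 X \<in> ?L \<longleftrightarrow> X \<in> ?L" using X Sob_closed by blast
  next
    fix X Y Z u v w assume ex: "(X, Y, Z, u, v, w) \<in> Exact T" and XY: "X \<in> ?L" "Y \<in> ?L"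
    have Z: "Z \<in> Ob T" by (rule arrowD(2)[OF exact_arrows(2)[OF ex]])
    have X: "X \<in> Ob T" using XY by blast
    have "orth Z (Sob n B)" for n unfolding orth_def
    proof (intro allI impI)
      fix f assume f: "\<guillemotleft>f : Z \<rightarrow> Sob n B\<guillemotright>"
      have "f \<bullet> v = Zer T Y (Sob n B)"
        using XY(2) arrow_comp[OF exact_arrows(2)[OF ex] f] unfolding orth_def by blast
      then obtain k where k: "\<guillemotleft>k : Sob 1 X \<rightarrow> Sob n B\<guillemotright>" "k \<bullet> w = f" by (rule cohom_exact3[OF ex f])
      have "\<guillemotleft>k : Sob 1 X \<rightarrow> Sob 1 (Sob (n - 1) B)\<guillemotright>" using k(1) B by (simp add: Sob_add)
      then obtain k' where k': "\<guillemotleft>k' : X \<rightarrow> Sob (n - 1) B\<guillemotright>" "k = Sh 1 k'"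
        by (rule Sh_surj[OF _ X Sob_closed[OF B]])
      have "k' = Zer T X (Sob (n - 1) B)" using XY(1) k'(1) unfolding orth_def by blast
      then have "k = Zer T (Sob 1 X) (Sob n B)"
        using k'(2) Sh_Zer[OF X Sob_closed[OF B], of 1 "n - 1"] B by (simp add: Sob_add)
      then show "f = Zer T Z (Sob n B)" using k(2) zero_comp[OF exact_arrows(3)[OF ex] Sob_closed[OF B]] by simp
    qed
    then show "Z \<in> ?L" using Z by blast
  next
    fix I :: "'i set" and \<xi> P \<iota> assume cp: "is_coproduct T I \<xi> P \<iota>" and \<xi>: "\<And>i. i \<in> I \<Longrightarrow> \<xi> i \<in> ?L"
    have P: "P \<in> Ob T" by (rule coproduct_arrow(1)[OF cp])
    have "orth P (Sob n B)" for n unfolding orth_def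
    proof (intro allI impI)
      fix f assume f: "\<guillemotleft>f : P \<rightarrow> Sob n B\<guillemotright>"
      show "f = Zer T P (Sob n B)"
      proof (rule coproduct_ext[OF cp f arrow_zero[OF P Sob_closed[OF B]]])
        fix i assume i: "i \<in> I"
        have "f \<bullet> \<iota> i = Zer T (\<xi> i) (Sob n B)"
          using \<xi>[OF i] arrow_comp[OF coproduct_arrow(3)[OF cp i] f] unfolding orth_def by blast
        then show "f \<bullet> \<iota> i = Zer T P (Sob n B) \<bullet> \<iota> i"
          using zero_comp[OF coproduct_arrow(3)[OF cp i] Sob_closed[OF B]] by simp
      qed
    qed
    then show "P \<in> ?L" using P by blast
  qed blast
  then have "Loc \<kappa> T G \<subseteq> ?L" by (rule Loc_least) (use G o in blast)
  then show ?thesis using D by blast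
qed

text \<open>For a class of objects \<open>D\<close> that is closed under suspensions, a morphism induces bijections on
  \<open>Hom(D, -)\<close> if and only if its cone receives no nonzero morphisms from the class.\<close>

lemma hom_bij_cone:
  assumes ex: "(A, X, B, \<epsilon>, v, w) \<in> Exact T" and b: "hom_bij \<epsilon> A X D" "hom_bij \<epsilon> A X (Sob (-1) D)"
    and D: "D \<in> Ob T"
  shows "orth D B"
  unfolding orth_def
proof (intro allI impI)
  note a = exact_arrows[OF ex]
  fix h assume h: "\<guillemotleft>h : D \<rightarrow> B\<guillemotright>"
  note wh = arrow_comp[OF h a(3)]
  have "Sh 1 \<epsilon> \<bullet> (w \<bullet> h) = Zer T D (Sob 1 X)"
    using comp_eq_comp[OF a(3) Sh_arrow[OF a(1)] h exact_comp_zero3[OF ex]]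
      zero_comp[OF h Sob_closed[OF arrowD(2)[OF a(1)]]] by simp
  then have "w \<bullet> h = Zer T D (Sob 1 A)" by (rule hom_bij_zero[OF hom_bij_shift[OF b(2) a(1) D] wh])
  then obtain k where k: "\<guillemotleft>k : D \<rightarrow> X\<guillemotright>" "v \<bullet> k = h" by (rule hom_exact3[OF ex h])
  obtain k' where k': "\<guillemotleft>k' : D \<rightarrow> A\<guillemotright>" "\<epsilon> \<bullet> k' = k" by (rule hom_bij_lift[OF b(1) k(1)])
  have "v \<bullet> (\<epsilon> \<bullet> k') = Zer T D B"
    using comp_eq_comp[OF a(1,2) k'(1) exact_comp_zero[OF ex]] zero_comp[OF k'(1) arrowD(2)[OF a(2)]] by simp
  then show "h = Zer T D B" using k(2) k'(2) by simp
qed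

lemma orth_hom_bij:
  assumes ex: "(A, X, B, \<epsilon>, v, w) \<in> Exact T" and o: "orth D B" "orth (Sob 1 D) B" and D: "D \<in> Ob T"
  shows "hom_bij \<epsilon> A X D"
  unfolding hom_bij_def
proof (intro conjI allI impI)
  note a = exact_arrows[OF ex]
  fix f assume f: "\<guillemotleft>f : D \<rightarrow> X\<guillemotright>"
  have "v \<bullet> f = Zer T D B" by (rule orthD[OF o(1) arrow_comp[OF f a(2)]])
  then show "\<exists>g. \<guillemotleft>g : D \<rightarrow> A\<guillemotright> \<and> \<epsilon> \<bullet> g = f" using hom_exact2[OF ex f] by blast
next
  note a = exact_arrows[OF ex]
  fix g assume g: "\<guillemotleft>g : D \<rightarrow> A\<guillemotright> \<and> \<epsilon> \<bullet> g = Zer T D X"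
  then have g': "\<guillemotleft>g : D \<rightarrow> A\<guillemotright>" and eq: "\<epsilon> \<bullet> g = Zer T D X" by blast+
  have "Sh 1 \<epsilon> \<bullet> Sh 1 g = Zer T (Sob 1 D) (Sob 1 X)"
    using Sh_comp[of g \<epsilon> 1] g' a(1) eq Sh_Zer[OF D arrowD(2)[OF a(1)]] by (simp add: arrow_iff)
  then obtain k where k: "\<guillemotleft>k : Sob 1 D \<rightarrow> B\<guillemotright>" "w \<bullet> k = Sh 1 g" by (rule hom_exact1[OF ex Sh_arrow[OF g']])
  have "k = Zer T (Sob 1 D) B" by (rule orthD[OF o(2) k(1)])
  then have "Sh 1 g = Zer T (Sob 1 D) (Sob 1 A)" using k(2) comp_zero[OF a(3) Sob_closed[OF D]] by simp
  then show "g = Zer T D A" using Sh_zero_iff[OF g'] by blast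
qed

text \<open>By the criterion on the cone, bijectivity extends to the localizing subcategory generated by \<open>G\<close>.\<close>

lemma hom_bij_Loc:
  fixes \<kappa> :: "'i rel"
  assumes G: "G \<subseteq> Ob T" and Gs: "\<And>D n. D \<in> G \<Longrightarrow> Sob n D \<in> G" and \<epsilon>: "\<guillemotleft>\<epsilon> : A \<rightarrow> X\<guillemotright>"
    and b: "\<And>D. D \<in> G \<Longrightarrow> hom_bij \<epsilon> A X D" and D: "D \<in> Loc \<kappa> T G"
  shows "hom_bij \<epsilon> A X D"
proof -
  obtain B v w where ex: "(A, X, B, \<epsilon>, v, w) \<in> Exact T" using exact_cone[OF \<epsilon>] .
  have B: "B \<in> Ob T" by (rule arrowD(2)[OF exact_arrows(2)[OF ex]])
  have oG: "orth D B" if "D \<in> G" for D using hom_bij_cone[OF ex b b] that G Gs by blast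
  have "orth D (Sob n B)" if "D \<in> G" for D n by (rule orth_shift[OF oG[OF Gs[OF that]] B])
  then have o: "orth D (Sob 0 B)" if "D \<in> Loc \<kappa> T G" for D using orth_Loc[OF G B] that by blast
  note L = Loc_localizing[OF G, of \<kappa>]
  have "D \<in> Ob T" using D localizingD(1)[OF L] by blast
  then show ?thesis
    using orth_hom_bij[OF ex] o[OF D] o[OF localizing_shift[OF L D, of 1]] by (simp add: Sob_0)
qed

text \<open>The five lemma for a morphism of exact triangles.\<close>

lemma hom_bij_five:
  assumes X: "(X, Y, Z, u, v, w) \<in> Exact T" and A: "(A, B, C, \<alpha>, \<beta>, \<gamma>) \<in> Exact T"
    and ar: "\<guillemotleft>e\<^sub>X : A \<rightarrow> X\<guillemotright>" "\<guillemotleft>e\<^sub>Y : B \<rightarrow> Y\<guillemotright>" "\<guillemotleft>e\<^sub>Z : C \<rightarrow> Z\<guillemotright>"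
    and sq: "e\<^sub>Y \<bullet> \<alpha> = u \<bullet> e\<^sub>X" "e\<^sub>Z \<bullet> \<beta> = v \<bullet> e\<^sub>Y" "Sh 1 e\<^sub>X \<bullet> \<gamma> = w \<bullet> e\<^sub>Z"
    and b: "hom_bij e\<^sub>X A X D" "hom_bij e\<^sub>Y B Y D" "hom_bij (Sh 1 e\<^sub>X) (Sob 1 A) (Sob 1 X) D"
      "hom_bij (Sh 1 e\<^sub>Y) (Sob 1 B) (Sob 1 Y) D"
  shows "hom_bij e\<^sub>Z C Z D"
  unfolding hom_bij_def
proof (intro conjI allI impI)
  note x = exact_arrows[OF X] and a = exact_arrows[OF A]
  note Se = Sh_arrow[OF ar(1), of 1] Sh_arrow[OF ar(2), of 1] and Su = Sh_arrow[OF x(1), of 1]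
    and S\<alpha> = Sh_arrow[OF a(1), of 1]
  have sq': "Sh 1 e\<^sub>Y \<bullet> Sh 1 \<alpha> = Sh 1 u \<bullet> Sh 1 e\<^sub>X"
    using Sh_comp[of \<alpha> e\<^sub>Y 1] Sh_comp[of e\<^sub>X u 1] sq(1) a(1) x(1) ar by (simp add: arrow_iff)
  fix f assume f: "\<guillemotleft>f : D \<rightarrow> Z\<guillemotright>"
  have D: "D \<in> Ob T" by (rule arrowD(1)[OF f])
  obtain g where g: "\<guillemotleft>g : D \<rightarrow> Sob 1 A\<guillemotright>" "Sh 1 e\<^sub>X \<bullet> g = w \<bullet> f"
    by (rule hom_bij_lift[OF b(3) arrow_comp[OF f x(3)]])
  have "Sh 1 e\<^sub>Y \<bullet> (Sh 1 \<alpha> \<bullet> g) = Sh 1 u \<bullet> (Sh 1 e\<^sub>X \<bullet> g)" by (rule square_comp[OF S\<alpha> Se(2) Se(1) Su g(1) sq'])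
  also have "\<dots> = Zer T D (Sob 1 Y)" unfolding g(2)
    using comp_eq_comp[OF x(3) Su f exact_comp_zero3[OF X]] zero_comp[OF f arrowD(2)[OF Su]] by simp
  finally have "Sh 1 \<alpha> \<bullet> g = Zer T D (Sob 1 B)" by (rule hom_bij_zero[OF b(4) arrow_comp[OF g(1) S\<alpha>]])
  then obtain k where k: "\<guillemotleft>k : D \<rightarrow> C\<guillemotright>" "\<gamma> \<bullet> k = g" by (rule hom_exact1[OF A g(1)])
  note ek = arrow_comp[OF k(1) ar(3)]
  have "w \<bullet> (e\<^sub>Z \<bullet> k) = Sh 1 e\<^sub>X \<bullet> (\<gamma> \<bullet> k)"
    by (rule square_comp[OF ar(3) x(3) a(3) Se(1) k(1) sq(3)[symmetric]])
  then have "w \<bullet> f = w \<bullet> (e\<^sub>Z \<bullet> k)" unfolding k(2) g(2) by simp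
  then have "w \<bullet> (f \<boxplus> Neg T D Z (e\<^sub>Z \<bullet> k)) = Zer T D (Sob 1 X)" by (rule comp_diff_zero[OF f ek x(3)])
  then obtain l where l: "\<guillemotleft>l : D \<rightarrow> Y\<guillemotright>" "v \<bullet> l = f \<boxplus> Neg T D Z (e\<^sub>Z \<bullet> k)"
    by (rule hom_exact3[OF X arrow_add[OF f arrow_neg[OF ek]]])
  obtain l' where l': "\<guillemotleft>l' : D \<rightarrow> B\<guillemotright>" "e\<^sub>Y \<bullet> l' = l" by (rule hom_bij_lift[OF b(2) l(1)])
  note \<beta>l = arrow_comp[OF l'(1) a(2)]
  have "e\<^sub>Z \<bullet> (\<beta> \<bullet> l') = v \<bullet> l"
    using square_comp[OF a(2) ar(3) ar(2) x(2) l'(1) sq(2)] l'(2) by simp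
  then have "e\<^sub>Z \<bullet> (k \<boxplus> (\<beta> \<bullet> l')) = f"
    using comp_add[OF k(1) \<beta>l ar(3)] l(2) diff_add[OF f ek] by simp
  then show "\<exists>g. \<guillemotleft>g : D \<rightarrow> C\<guillemotright> \<and> e\<^sub>Z \<bullet> g = f" using arrow_add[OF k(1) \<beta>l] by blast
next
  note x = exact_arrows[OF X] and a = exact_arrows[OF A]
  note Se = Sh_arrow[OF ar(1), of 1]
  fix k assume "\<guillemotleft>k : D \<rightarrow> C\<guillemotright> \<and> e\<^sub>Z \<bullet> k = Zer T D Z"
  then have k: "\<guillemotleft>k : D \<rightarrow> C\<guillemotright>" and ek: "e\<^sub>Z \<bullet> k = Zer T D Z" by blast+
  have D: "D \<in> Ob T" by (rule arrowD(1)[OF k])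
  have "Sh 1 e\<^sub>X \<bullet> (\<gamma> \<bullet> k) = w \<bullet> (e\<^sub>Z \<bullet> k)" by (rule square_comp[OF a(3) Se ar(3) x(3) k sq(3)])
  also have "\<dots> = Zer T D (Sob 1 X)" unfolding ek by (rule comp_zero[OF x(3) D])
  finally have "\<gamma> \<bullet> k = Zer T D (Sob 1 A)" by (rule hom_bij_zero[OF b(3) arrow_comp[OF k a(3)]])
  then obtain l where l: "\<guillemotleft>l : D \<rightarrow> B\<guillemotright>" "\<beta> \<bullet> l = k" by (rule hom_exact3[OF A k])
  note el = arrow_comp[OF l(1) ar(2)]
  have "v \<bullet> (e\<^sub>Y \<bullet> l) = Zer T D Z"
    using square_comp[OF a(2) ar(3) ar(2) x(2) l(1) sq(2)] l(2) ek by simp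
  then obtain m where m: "\<guillemotleft>m : D \<rightarrow> X\<guillemotright>" "u \<bullet> m = e\<^sub>Y \<bullet> l" by (rule hom_exact2[OF X el])
  obtain m' where m': "\<guillemotleft>m' : D \<rightarrow> A\<guillemotright>" "e\<^sub>X \<bullet> m' = m" by (rule hom_bij_lift[OF b(1) m(1)])
  have "e\<^sub>Y \<bullet> (\<alpha> \<bullet> m') = e\<^sub>Y \<bullet> l"
    using square_comp[OF a(1) ar(2) ar(1) x(1) m'(1) sq(1)] m(2) m'(2) by simp
  then have "\<alpha> \<bullet> m' = l" by (rule hom_bij_unique[OF b(2) ar(2) arrow_comp[OF m'(1) a(1)] l(1)])
  then have "k = \<beta> \<bullet> (\<alpha> \<bullet> m')" using l(2) by simp
  also have "\<dots> = Zer T D C"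
    using comp_eq_comp[OF a(1,2) m'(1) exact_comp_zero[OF A]] zero_comp[OF m'(1) arrowD(2)[OF a(2)]] by simp
  finally show "k = Zer T D C" .
qed

text \<open>A morphism \<open>\<epsilon> : A \<rightarrow> X\<close> from an object of \<open>L\<close> through which every morphism from an object of \<open>L\<close>
  to \<open>X\<close> factors uniquely.\<close>

definition coreflection where
  "coreflection L \<epsilon> A X \<longleftrightarrow> A \<in> L \<and> \<guillemotleft>\<epsilon> : A \<rightarrow> X\<guillemotright> \<and> (\<forall>D\<in>L. hom_bij \<epsilon> A X D)"

text \<open>For a class of compact objects that is closed under suspensions, the objects that have a
  coreflection in the localizing subcategory it generates form a localizing subcategory.\<close>

lemma coreflective_localizing:
  fixes \<kappa> :: "'i rel"
  assumes c: "has_small_coproducts \<kappa> T" and G: "\<And>D. D \<in> G \<Longrightarrow> compact_object \<kappa> T D"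
    and Gs: "\<And>D n. D \<in> G \<Longrightarrow> Sob n D \<in> G"
  shows "localizing_subcategory \<kappa> T {X \<in> Ob T. \<exists>A \<epsilon>. coreflection (Loc \<kappa> T G) \<epsilon> A X}"
    (is "localizing_subcategory \<kappa> T ?C")
proof -
  have GO: "G \<subseteq> Ob T" using compactD(1)[OF G] by blast
  define L where "L = Loc \<kappa> T G"
  have L: "localizing_subcategory \<kappa> T L" unfolding L_def by (rule Loc_localizing[OF GO])
  have GL: "G \<subseteq> L" unfolding L_def by (rule Loc_incl)
  have LO: "D \<in> Ob T" if "D \<in> L" for D using localizingD(1)[OF L] that by blast
  have I: "coreflection L \<epsilon> A X" if "A \<in> L" "\<guillemotleft>\<epsilon> : A \<rightarrow> X\<guillemotright>" "\<And>D. D \<in> G \<Longrightarrow> hom_bij \<epsilon> A X D" for \<epsilon> A X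
    using hom_bij_Loc[OF GO Gs that(2,3), of _ \<kappa>] that(1,2) unfolding coreflection_def L_def by blast
  have sh: "coreflection L (Sh n \<epsilon>) (Sob n A) (Sob n X)" if "coreflection L \<epsilon> A X" for n \<epsilon> A X
    using that hom_bij_shift[of \<epsilon> A X n] localizing_shift[OF L] LO Sh_arrow unfolding coreflection_def by blast
  have "localizing_subcategory \<kappa> T {X \<in> Ob T. \<exists>A \<epsilon>. coreflection L \<epsilon> A X}" (is "localizing_subcategory \<kappa> T ?C")
  proof (rule localizingI)
    obtain Z where Z: "is_zero_object T Z" using zero_object by blast
    have Z': "Z \<in> Ob T" by (rule zero_objectD(1)[OF Z])
    have "hom_bij (Ident T Z) Z Z D" for D
      unfolding hom_bij_def using zero_objectD(2)[OF Z, of _ D] ident_comp[of _ D Z] by metis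
    then have "coreflection L (Ident T Z) Z Z"
      unfolding coreflection_def using localizing_zero[OF L Z] arrow_ident[OF Z'] by blast
    then show "?C \<noteq> {}" using Z' by blast
  next
    fix X assume X: "X \<in> Ob T"
    have "Sob (-1) (Sob 1 X) = X" using X by (simp add: Sob_add Sob_0)
    then have "(\<exists>A \<epsilon>. coreflection L \<epsilon> A (Sob 1 X)) \<longleftrightarrow> (\<exists>A \<epsilon>. coreflection L \<epsilon> A X)"
      using sh[of _ _ X 1] sh[of _ _ "Sob 1 X" "-1"] by metis
    then show "Sob 1 X \<in> ?C \<longleftrightarrow> X \<in> ?C" using X Sob_closed[OF X] by blast
  next
    fix X Y Z u v w assume ex: "(X, Y, Z, u, v, w) \<in> Exact T" and XY: "X \<in> ?C" "Y \<in> ?C"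
    obtain A e\<^sub>X B e\<^sub>Y where e: "coreflection L e\<^sub>X A X" "coreflection L e\<^sub>Y B Y" using XY by blast
    have eX: "A \<in> L" "\<guillemotleft>e\<^sub>X : A \<rightarrow> X\<guillemotright>" "\<And>D. D \<in> L \<Longrightarrow> hom_bij e\<^sub>X A X D"
      and eY: "B \<in> L" "\<guillemotleft>e\<^sub>Y : B \<rightarrow> Y\<guillemotright>" "\<And>D. D \<in> L \<Longrightarrow> hom_bij e\<^sub>Y B Y D"
      using e unfolding coreflection_def by blast+
    note x = exact_arrows[OF ex]
    obtain \<alpha> where \<alpha>: "\<guillemotleft>\<alpha> : A \<rightarrow> B\<guillemotright>" "e\<^sub>Y \<bullet> \<alpha> = u \<bullet> e\<^sub>X"
      by (rule hom_bij_lift[OF eY(3)[OF eX(1)] arrow_comp[OF eX(2) x(1)]])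
    obtain C \<beta> \<gamma> where ex': "(A, B, C, \<alpha>, \<beta>, \<gamma>) \<in> Exact T" using exact_cone[OF \<alpha>(1)] .
    obtain e\<^sub>Z where eZ: "\<guillemotleft>e\<^sub>Z : C \<rightarrow> Z\<guillemotright>" "e\<^sub>Z \<bullet> \<beta> = v \<bullet> e\<^sub>Y" "Sh 1 e\<^sub>X \<bullet> \<gamma> = w \<bullet> e\<^sub>Z"
      by (rule exact_fill[OF ex' ex eX(2) eY(2) \<alpha>(2)])
    have "hom_bij e\<^sub>Z C Z D" if D: "D \<in> L" for D
    proof (rule hom_bij_five[OF ex ex' eX(2) eY(2) eZ(1) \<alpha>(2) eZ(2,3) eX(3)[OF D] eY(3)[OF D]])
      show "hom_bij (Sh 1 e\<^sub>X) (Sob 1 A) (Sob 1 X) D" using sh[OF e(1)] D unfolding coreflection_def by blast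
      show "hom_bij (Sh 1 e\<^sub>Y) (Sob 1 B) (Sob 1 Y) D" using sh[OF e(2)] D unfolding coreflection_def by blast
    qed
    moreover have "C \<in> L" by (rule localizingD(4)[OF L ex' eX(1) eY(1)])
    ultimately have "coreflection L e\<^sub>Z C Z" unfolding coreflection_def using eZ(1) by blast
    then show "Z \<in> ?C" using arrowD(2)[OF x(2)] by blast
  next
    fix I :: "'i set" and X P \<iota>
    assume sm: "small \<kappa> I" and cp: "is_coproduct T I X P \<iota>" and X: "\<And>i. i \<in> I \<Longrightarrow> X i \<in> ?C"
    have "\<forall>i\<in>I. \<exists>A \<epsilon>. coreflection L \<epsilon> A (X i)" using X by blast
    then obtain A e where e: "\<And>i. i \<in> I \<Longrightarrow> coreflection L (e i) (A i) (X i)" by metis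
    have eX: "A i \<in> L" "\<guillemotleft>e i : A i \<rightarrow> X i\<guillemotright>" "\<And>D. D \<in> L \<Longrightarrow> hom_bij (e i) (A i) (X i) D" if "i \<in> I" for i
      using e[OF that] unfolding coreflection_def by blast+
    obtain Q \<nu> where cq: "is_coproduct T I A Q \<nu>"
      using c[unfolded has_small_coproducts_def, rule_format, of I A] sm eX(1) LO by blast
    note \<iota> = coproduct_arrow(3)[OF cp] and \<nu> = coproduct_arrow(3)[OF cq]
    have P: "P \<in> Ob T" and Q: "Q \<in> Ob T" by (rule coproduct_arrow(1)[OF cp], rule coproduct_arrow(1)[OF cq])
    obtain \<epsilon> where \<epsilon>: "\<guillemotleft>\<epsilon> : Q \<rightarrow> P\<guillemotright>" "\<And>i. i \<in> I \<Longrightarrow> \<epsilon> \<bullet> \<nu> i = \<iota> i \<bullet> e i"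
      using coproduct_desc[OF cq P, where h = "\<lambda>i. \<iota> i \<bullet> e i"] arrow_comp[OF eX(2) \<iota>] by blast
    obtain \<pi> where \<pi>: "\<And>i. i \<in> I \<Longrightarrow> \<guillemotleft>\<pi> i : P \<rightarrow> X i\<guillemotright>" "\<And>i. i \<in> I \<Longrightarrow> \<pi> i \<bullet> \<iota> i = Ident T (X i)"
      "\<And>i j. \<lbrakk>i \<in> I; j \<in> I; i \<noteq> j\<rbrakk> \<Longrightarrow> \<pi> i \<bullet> \<iota> j = Zer T (X j) (X i)"
      using coproduct_proj[OF cp] by metis
    obtain \<rho> where \<rho>: "\<And>i. i \<in> I \<Longrightarrow> \<guillemotleft>\<rho> i : Q \<rightarrow> A i\<guillemotright>" "\<And>i. i \<in> I \<Longrightarrow> \<rho> i \<bullet> \<nu> i = Ident T (A i)"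
      "\<And>i j. \<lbrakk>i \<in> I; j \<in> I; i \<noteq> j\<rbrakk> \<Longrightarrow> \<rho> i \<bullet> \<nu> j = Zer T (A j) (A i)"
      using coproduct_proj[OF cq] by metis
    have comm: "\<pi> i \<bullet> \<epsilon> = e i \<bullet> \<rho> i" if i: "i \<in> I" for i
    proof (rule coproduct_ext[OF cq arrow_comp[OF \<epsilon>(1) \<pi>(1)[OF i]] arrow_comp[OF \<rho>(1)[OF i] eX(2)[OF i]]])
      fix j assume j: "j \<in> I"
      have "(\<pi> i \<bullet> \<epsilon>) \<bullet> \<nu> j = \<pi> i \<bullet> (\<iota> j \<bullet> e j)"
        using comp_assoc[OF \<nu>[OF j] \<epsilon>(1) \<pi>(1)[OF i]] \<epsilon>(2)[OF j] by simp
      also have "\<dots> = (\<pi> i \<bullet> \<iota> j) \<bullet> e j" by (rule comp_assoc[OF eX(2)[OF j] \<iota>[OF j] \<pi>(1)[OF i], symmetric])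
      also have "\<dots> = e i \<bullet> (\<rho> i \<bullet> \<nu> j)"
      proof (cases "i = j")
        case True
        then show ?thesis using \<pi>(2)[OF i] \<rho>(2)[OF i] ident_comp[OF eX(2)[OF i]] comp_ident[OF eX(2)[OF i]] by simp
      next
        case False
        then show ?thesis using \<pi>(3)[OF i j] \<rho>(3)[OF i j] zero_comp[OF eX(2)[OF j] arrowD(2)[OF eX(2)[OF i]]]
            comp_zero[OF eX(2)[OF i] arrowD(1)[OF eX(2)[OF j]]] by simp
      qed
      also have "\<dots> = (e i \<bullet> \<rho> i) \<bullet> \<nu> j" by (rule comp_assoc[OF \<nu>[OF j] \<rho>(1)[OF i] eX(2)[OF i], symmetric])
      finally show "(\<pi> i \<bullet> \<epsilon>) \<bullet> \<nu> j = (e i \<bullet> \<rho> i) \<bullet> \<nu> j" .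
    qed
    have "hom_bij \<epsilon> Q P D" if DG: "D \<in> G" for D
      unfolding hom_bij_def
    proof (intro conjI allI impI)
      note cD = G[OF DG]
      have D: "D \<in> Ob T" and DL: "D \<in> L" using compactD(1)[OF cD] GL DG by blast+
      fix f assume "\<guillemotleft>f : D \<rightarrow> P\<guillemotright>"
      then have "finite_sum I X P \<iota> D f" by (rule compactD(2)[OF cD sm cp])
      then show "\<exists>g. \<guillemotleft>g : D \<rightarrow> Q\<guillemotright> \<and> \<epsilon> \<bullet> g = f"
      proof (induction rule: finite_sum.induct)
        case zero
        show ?case using arrow_zero[OF D Q] comp_zero[OF \<epsilon>(1) D] by blast
      next
        case (step i g f)
        then obtain f' where f': "\<guillemotleft>f' : D \<rightarrow> Q\<guillemotright>" "\<epsilon> \<bullet> f' = f" by blast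
        obtain g' where g': "\<guillemotleft>g' : D \<rightarrow> A i\<guillemotright>" "e i \<bullet> g' = g"
          by (rule hom_bij_lift[OF eX(3)[OF step(1) DL] step(2)])
        note \<nu>g = arrow_comp[OF g'(1) \<nu>[OF step(1)]]
        have "\<epsilon> \<bullet> (\<nu> i \<bullet> g') = \<iota> i \<bullet> g"
          using square_comp[OF \<nu>[OF step(1)] \<epsilon>(1) eX(2)[OF step(1)] \<iota>[OF step(1)] g'(1) \<epsilon>(2)[OF step(1)]] g'(2) by simp
        then have "\<epsilon> \<bullet> ((\<nu> i \<bullet> g') \<boxplus> f') = (\<iota> i \<bullet> g) \<boxplus> f" using comp_add[OF \<nu>g f'(1) \<epsilon>(1)] f'(2) by simp
        then show ?case using arrow_add[OF \<nu>g f'(1)] by blast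
      qed
    next
      note cD = G[OF DG]
      have D: "D \<in> Ob T" and DL: "D \<in> L" using compactD(1)[OF cD] GL DG by blast+
      fix k assume "\<guillemotleft>k : D \<rightarrow> Q\<guillemotright> \<and> \<epsilon> \<bullet> k = Zer T D P"
      then have k: "\<guillemotleft>k : D \<rightarrow> Q\<guillemotright>" and ek: "\<epsilon> \<bullet> k = Zer T D P" by blast+
      have "\<rho> i \<bullet> k = Zer T D (A i)" if i: "i \<in> I" for i
      proof (rule hom_bij_zero[OF eX(3)[OF i DL] arrow_comp[OF k \<rho>(1)[OF i]]])
        have "e i \<bullet> (\<rho> i \<bullet> k) = \<pi> i \<bullet> (\<epsilon> \<bullet> k)"
          by (rule square_comp[OF \<rho>(1)[OF i] eX(2)[OF i] \<epsilon>(1) \<pi>(1)[OF i] k comm[OF i, symmetric]])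
        then show "e i \<bullet> (\<rho> i \<bullet> k) = Zer T D (X i)" unfolding ek using comp_zero[OF \<pi>(1)[OF i] D] by simp
      qed
      then have 0: "\<forall>i\<in>I. \<rho> i \<bullet> k = Zer T D (A i)" by blast
      show "k = Zer T D Q"
        by (rule finite_sum_eq_zero[OF cq \<rho> compactD(2)[OF cD sm cq k] D 0])
    qed
    moreover have "Q \<in> L" by (rule localizingD(5)[OF L sm cq eX(1)])
    ultimately have "coreflection L \<epsilon> Q P" using \<epsilon>(1) by (intro I)
    then show "P \<in> ?C" using P by blast
  qed blast
  then show ?thesis unfolding L_def .
qed

lemma right_adjoint_exists:
  assumes L: "L \<subseteq> Ob T" and c: "\<And>X. X \<in> Ob T \<Longrightarrow> \<exists>A \<epsilon>. coreflection L \<epsilon> A X"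
  shows "\<exists>G :: ('a, 'b, 'a, 'b) ftor. adjoint (full_subcategory T L) T inclusion G"
proof -
  from c have "\<forall>X\<in>Ob T. \<exists>A \<epsilon>. coreflection L \<epsilon> A X" by blast
  then obtain A \<epsilon> where cor: "\<And>X. X \<in> Ob T \<Longrightarrow> coreflection L (\<epsilon> X) (A X) X" by metis
  have A: "A X \<in> L" and \<epsilon>: "\<guillemotleft>\<epsilon> X : A X \<rightarrow> X\<guillemotright>" and hb: "\<And>D. D \<in> L \<Longrightarrow> hom_bij (\<epsilon> X) (A X) X D"
    if "X \<in> Ob T" for X
    using cor[OF that] unfolding coreflection_def by blast+
  define lift where "lift X Y f = (SOME g. \<guillemotleft>g : X \<rightarrow> A Y\<guillemotright> \<and> \<epsilon> Y \<bullet> g = f)" for X Y f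
  have lift: "\<guillemotleft>lift X Y f : X \<rightarrow> A Y\<guillemotright>" "\<epsilon> Y \<bullet> lift X Y f = f" if "X \<in> L" "\<guillemotleft>f : X \<rightarrow> Y\<guillemotright>" for X Y f
  proof -
    have "\<exists>g. \<guillemotleft>g : X \<rightarrow> A Y\<guillemotright> \<and> \<epsilon> Y \<bullet> g = f"
      using hom_bij_lift[OF hb[OF arrowD(2)[OF that(2)] that(1)] that(2)] by blast
    then have "\<guillemotleft>lift X Y f : X \<rightarrow> A Y\<guillemotright> \<and> \<epsilon> Y \<bullet> lift X Y f = f" unfolding lift_def by (rule someI_ex)
    then show "\<guillemotleft>lift X Y f : X \<rightarrow> A Y\<guillemotright>" "\<epsilon> Y \<bullet> lift X Y f = f" by blast+
  qed
  have uniq: "g = lift X Y f" if "X \<in> L" "Y \<in> Ob T" "\<guillemotleft>g : X \<rightarrow> A Y\<guillemotright>" "\<epsilon> Y \<bullet> g = f" for g X Y f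
  proof -
    have f: "\<guillemotleft>f : X \<rightarrow> Y\<guillemotright>" using arrow_comp[OF that(3) \<epsilon>[OF that(2)]] that(4) by simp
    show ?thesis
      by (rule hom_bij_unique[OF hb[OF that(2,1)] \<epsilon>[OF that(2)] that(3) lift(1)[OF that(1) f]])
        (simp only: that(4) lift(2)[OF that(1) f])
  qed
  define G :: "('a, 'b, 'a, 'b) ftor"
    where "G = \<lparr>onOb = A, onHom = (\<lambda>f. lift (A (src f)) (tgt f) (f \<bullet> \<epsilon> (src f)))\<rparr>"
  have Gob: "onOb G X = A X" for X by (simp add: G_def)
  have Ghom: "onHom G f = lift (A X) Y (f \<bullet> \<epsilon> X)" if "\<guillemotleft>f : X \<rightarrow> Y\<guillemotright>" for f X Y
    using that by (simp add: G_def src_eq[OF that] tgt_eq[OF that])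
  have Ga: "\<guillemotleft>onHom G f : A X \<rightarrow> A Y\<guillemotright>" "\<epsilon> Y \<bullet> onHom G f = f \<bullet> \<epsilon> X" if f: "\<guillemotleft>f : X \<rightarrow> Y\<guillemotright>" for f X Y
    unfolding Ghom[OF f]
    using lift[OF A[OF arrowD(1)[OF f]] arrow_comp[OF \<epsilon>[OF arrowD(1)[OF f]] f]] by blast+
  have Gu: "k = onHom G f" if f: "\<guillemotleft>f : X \<rightarrow> Y\<guillemotright>" and k: "\<guillemotleft>k : A X \<rightarrow> A Y\<guillemotright>" "\<epsilon> Y \<bullet> k = f \<bullet> \<epsilon> X" for f X Y k
    unfolding Ghom[OF f] by (rule uniq[OF A[OF arrowD(1)[OF f]] arrowD(2)[OF f] k])
  have AO: "A X \<in> Ob T" if "X \<in> Ob T" for X using A[OF that] L by blast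
  let ?C = "full_subcategory T L"
  have Cs: "Ob ?C = Ob T \<inter> L" "Hom ?C = Hom T" "Ident ?C = Ident T" "Comp ?C = Comp T"
    by (simp_all add: full_subcategory_def)
  have Gf: "is_functor T ?C G"
    unfolding is_functor_def Cs
  proof (intro conjI ballI)
    fix X assume X: "X \<in> Ob T"
    show "onOb G X \<in> Ob T \<inter> L" unfolding Gob using A[OF X] AO[OF X] by blast
    show "onHom G (Ident T X) = Ident T (onOb G X)" unfolding Gob
      by (rule Gu[OF arrow_ident[OF X] arrow_ident[OF AO[OF X]], symmetric])
        (simp only: comp_ident[OF \<epsilon>[OF X]] ident_comp[OF \<epsilon>[OF X]])
  next
    fix X Y f assume "X \<in> Ob T" "Y \<in> Ob T" "f \<in> Hom T X Y"
    then show "onHom G f \<in> Hom T (onOb G X) (onOb G Y)" unfolding Gob by (intro arrowD(3)[OF Ga(1)] arrowI)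
  next
    fix X Y Z f g assume *: "X \<in> Ob T" "Y \<in> Ob T" "Z \<in> Ob T" "f \<in> Hom T X Y" "g \<in> Hom T Y Z"
    have f: "\<guillemotleft>f : X \<rightarrow> Y\<guillemotright>" and g: "\<guillemotleft>g : Y \<rightarrow> Z\<guillemotright>" using * by (auto intro: arrowI)
    show "onHom G (g \<bullet> f) = onHom G g \<bullet> onHom G f"
    proof (rule Gu[OF arrow_comp[OF f g] arrow_comp[OF Ga(1)[OF f] Ga(1)[OF g]], symmetric])
      have "\<epsilon> Z \<bullet> (onHom G g \<bullet> onHom G f) = g \<bullet> (\<epsilon> Y \<bullet> onHom G f)"
        by (rule square_comp[OF Ga(1)[OF g] \<epsilon>[OF *(3)] \<epsilon>[OF *(2)] g Ga(1)[OF f] Ga(2)[OF g]])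
      also have "\<dots> = g \<bullet> (f \<bullet> \<epsilon> X)" by (simp only: Ga(2)[OF f])
      also have "\<dots> = (g \<bullet> f) \<bullet> \<epsilon> X" by (rule comp_assoc[OF \<epsilon>[OF *(1)] f g, symmetric])
      finally show "\<epsilon> Z \<bullet> (onHom G g \<bullet> onHom G f) = (g \<bullet> f) \<bullet> \<epsilon> X" .
    qed
  qed
  have If: "is_functor ?C T inclusion"
    unfolding is_functor_def Cs inclusion_def by simp
  have "adjoint ?C T inclusion G"
    unfolding adjoint_def
  proof (intro conjI If Gf exI[of _ lift] ballI)
    fix X Y assume X: "X \<in> Ob ?C" and Y: "Y \<in> Ob T"
    then have X': "X \<in> Ob T" "X \<in> L" by (simp_all add: Cs)
    show "bij_betw (lift X Y) (Hom T (onOb inclusion X) Y) (Hom ?C X (onOb G Y))"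
    proof (rule bij_betw_byWitness[where f' = "\<lambda>g. \<epsilon> Y \<bullet> g"])
      show "\<forall>f\<in>Hom T (onOb inclusion X) Y. \<epsilon> Y \<bullet> lift X Y f = f"
        using lift(2)[OF X'(2) arrowI[OF X'(1) Y]] by (simp add: inclusion_def)
      show "\<forall>g\<in>Hom ?C X (onOb G Y). lift X Y (\<epsilon> Y \<bullet> g) = g"
        using uniq[OF X'(2) Y arrowI[OF X'(1) AO[OF Y]] refl, symmetric] by (simp add: Cs Gob)
      show "lift X Y ` Hom T (onOb inclusion X) Y \<subseteq> Hom ?C X (onOb G Y)"
        using arrowD(3)[OF lift(1)[OF X'(2) arrowI[OF X'(1) Y]]] by (auto simp: Cs Gob inclusion_def)
      show "(\<lambda>g. \<epsilon> Y \<bullet> g) ` Hom ?C X (onOb G Y) \<subseteq> Hom T (onOb inclusion X) Y"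
        using arrowD(3)[OF arrow_comp[OF arrowI[OF X'(1) AO[OF Y]] \<epsilon>[OF Y]]] by (auto simp: Cs Gob inclusion_def)
    qed
  next
    fix X X' Y Y' a b f
    assume "X \<in> Ob ?C" "X' \<in> Ob ?C" and Y: "Y \<in> Ob T" "Y' \<in> Ob T"
      and "a \<in> Hom ?C X' X" "b \<in> Hom T Y Y'" "f \<in> Hom T (onOb inclusion X) Y"
    then have X: "X \<in> L" "X' \<in> L" and a: "\<guillemotleft>a : X' \<rightarrow> X\<guillemotright>" and b: "\<guillemotleft>b : Y \<rightarrow> Y'\<guillemotright>" and f: "\<guillemotleft>f : X \<rightarrow> Y\<guillemotright>"
      by (simp_all add: Cs inclusion_def arrow_def)
    note l = lift[OF X(1) f]
    have "\<epsilon> Y' \<bullet> ((onHom G b \<bullet> lift X Y f) \<bullet> a) = (\<epsilon> Y' \<bullet> (onHom G b \<bullet> lift X Y f)) \<bullet> a"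
      by (rule comp_assoc[OF a arrow_comp[OF l(1) Ga(1)[OF b]] \<epsilon>[OF Y(2)], symmetric])
    also have "\<epsilon> Y' \<bullet> (onHom G b \<bullet> lift X Y f) = b \<bullet> (\<epsilon> Y \<bullet> lift X Y f)"
      by (rule square_comp[OF Ga(1)[OF b] \<epsilon>[OF Y(2)] \<epsilon>[OF Y(1)] b l(1) Ga(2)[OF b]])
    also have "\<epsilon> Y \<bullet> lift X Y f = f" by (rule l(2))
    finally have "(onHom G b \<bullet> lift X Y f) \<bullet> a = lift X' Y' ((b \<bullet> f) \<bullet> a)"
      by (intro uniq[OF X(2) Y(2) arrow_comp[OF a arrow_comp[OF l(1) Ga(1)[OF b]]]])
    then show "lift X' Y' (b \<bullet> f \<bullet> onHom inclusion a) = onHom G b \<bullet>\<^bsub>?C\<^esub> lift X Y f \<bullet>\<^bsub>?C\<^esub> a"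
      by (simp add: Cs inclusion_def)
  qed
  then show ?thesis by blast
qed

text \<open>The value of any right adjoint of the inclusion is a coreflection, hence unique.\<close>

lemma coreflection_right_adjoint:
  fixes G :: "('a, 'b, 'a, 'b) ftor"
  assumes L: "L \<subseteq> Ob T" and adj: "adjoint (full_subcategory T L) T inclusion G" and M: "M \<in> Ob T"
    and cor: "coreflection L \<epsilon> H M"
  shows "isomorphic T H (onOb G M)"
proof -
  let ?C = "full_subcategory T L"
  have Cs: "Ob ?C = Ob T \<inter> L" "Hom ?C = Hom T" "Ident ?C = Ident T" "Comp ?C = Comp T"
    by (simp_all add: full_subcategory_def)
  have inc: "onOb inclusion X = X" "onHom inclusion f = f" for X :: 'a and f :: 'b
    by (simp_all add: inclusion_def)
  note adj' = adj[unfolded adjoint_def Cs inc]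
  from adj'[THEN conjunct2, THEN conjunct2] obtain \<phi> where
    bij: "\<And>X Y. \<lbrakk>X \<in> Ob T \<inter> L; Y \<in> Ob T\<rbrakk> \<Longrightarrow> bij_betw (\<phi> X Y) (Hom T X Y) (Hom T X (onOb G Y))" and
    nat: "\<And>X X' Y Y' a b f. \<lbrakk>X \<in> Ob T \<inter> L; X' \<in> Ob T \<inter> L; Y \<in> Ob T; Y' \<in> Ob T; a \<in> Hom T X' X; b \<in> Hom T Y Y';
      f \<in> Hom T X Y\<rbrakk> \<Longrightarrow> \<phi> X' Y' (b \<bullet> f \<bullet> a) = onHom G b \<bullet> \<phi> X Y f \<bullet> a" by blast
  define A where "A = onOb G M"
  note Gf = adj'[THEN conjunct2, THEN conjunct1, unfolded is_functor_def Cs, THEN conjunct1, THEN bspec, OF M]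
  have A: "A \<in> Ob T" "A \<in> L" and GI: "onHom G (Ident T M) = Ident T A" using Gf unfolding A_def by blast+
  have A': "A \<in> Ob T \<inter> L" using A by blast
  have "Ident T A \<in> \<phi> A M ` Hom T A M"
    using bij[OF A' M] arrowD(3)[OF arrow_ident[OF A(1)]] unfolding bij_betw_def A_def[symmetric] by blast
  then obtain \<eta> where "\<phi> A M \<eta> = Ident T A" "\<eta> \<in> Hom T A M" by force
  then have \<eta>: "\<guillemotleft>\<eta> : A \<rightarrow> M\<guillemotright>" "\<phi> A M \<eta> = Ident T A" using A M by (auto intro: arrowI)
  have key: "\<phi> D M (\<eta> \<bullet> g) = g" if g: "\<guillemotleft>g : D \<rightarrow> A\<guillemotright>" and D: "D \<in> L" for D g
  proof -
    have "\<phi> D M (Ident T M \<bullet> \<eta> \<bullet> g) = onHom G (Ident T M) \<bullet> \<phi> A M \<eta> \<bullet> g"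
      using g \<eta>(1) D M A arrow_ident[OF M] by (intro nat) (auto simp: arrow_def)
    then show ?thesis
      unfolding GI \<eta>(2) ident_comp[OF \<eta>(1)] ident_comp[OF arrow_ident[OF A(1)]] ident_comp[OF g] .
  qed
  have \<eta>_inj: "g = g'" if "\<guillemotleft>g : D \<rightarrow> A\<guillemotright>" "\<guillemotleft>g' : D \<rightarrow> A\<guillemotright>" "D \<in> L" "\<eta> \<bullet> g = \<eta> \<bullet> g'" for g g' D
  proof -
    have "g = \<phi> D M (\<eta> \<bullet> g)" by (rule key[OF that(1,3), symmetric])
    also have "\<dots> = g'" unfolding that(4) by (rule key[OF that(2,3)])
    finally show ?thesis .
  qed
  have \<eta>_sur: "\<guillemotleft>\<phi> D M f : D \<rightarrow> A\<guillemotright>" "\<eta> \<bullet> \<phi> D M f = f" if f: "\<guillemotleft>f : D \<rightarrow> M\<guillemotright>" and D: "D \<in> L" for D f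
  proof -
    have D': "D \<in> Ob T \<inter> L" using D L by blast
    note b = bij[OF D' M]
    show g: "\<guillemotleft>\<phi> D M f : D \<rightarrow> A\<guillemotright>"
      using b arrowD(3)[OF f] D' A unfolding bij_betw_def A_def arrow_def by blast
    have inj: "inj_on (\<phi> D M) (Hom T D M)" using b unfolding bij_betw_def by blast
    show "\<eta> \<bullet> \<phi> D M f = f"
      by (rule inj_onD[OF inj key[OF g D] arrowD(3)[OF arrow_comp[OF g \<eta>(1)]] arrowD(3)[OF f]])
  qed
  have H: "H \<in> L" "\<guillemotleft>\<epsilon> : H \<rightarrow> M\<guillemotright>" "\<And>D. D \<in> L \<Longrightarrow> hom_bij \<epsilon> H M D" using cor unfolding coreflection_def by blast+
  have HO: "H \<in> Ob T" by (rule arrowD(1)[OF H(2)])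
  note p = \<eta>_sur[OF H(2,1)]
  obtain q where q: "\<guillemotleft>q : A \<rightarrow> H\<guillemotright>" "\<epsilon> \<bullet> q = \<eta>" by (rule hom_bij_lift[OF H(3)[OF A(2)] \<eta>(1)])
  have "isomorphic T H A"
  proof (rule isomorphicI[OF p(1) q(1)])
    have "\<epsilon> \<bullet> (q \<bullet> \<phi> H M \<epsilon>) = \<epsilon>" using comp_assoc[OF p(1) q(1) H(2)] q(2) p(2) by simp
    then have "\<epsilon> \<bullet> (q \<bullet> \<phi> H M \<epsilon>) = \<epsilon> \<bullet> Ident T H" using comp_ident[OF H(2)] by simp
    then show "q \<bullet> \<phi> H M \<epsilon> = Ident T H"
      by (rule hom_bij_unique[OF H(3)[OF H(1)] H(2) arrow_comp[OF p(1) q(1)] arrow_ident[OF HO]])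
    have "\<eta> \<bullet> (\<phi> H M \<epsilon> \<bullet> q) = \<eta>" using comp_assoc[OF q(1) p(1) \<eta>(1)] q(2) p(2) by simp
    then have "\<eta> \<bullet> (\<phi> H M \<epsilon> \<bullet> q) = \<eta> \<bullet> Ident T A" using comp_ident[OF \<eta>(1)] by simp
    then show "\<phi> H M \<epsilon> \<bullet> q = Ident T A"
      by (rule \<eta>_inj[OF arrow_comp[OF q(1) p(1)] arrow_ident[OF A(1)] A(2)])
  qed
  then show ?thesis unfolding A_def .
qed

end

section \<open>Homogeneous primes\<close>

context graded_commutative_ring
begin

text \<open>A graded ideal, given by its homogeneous elements: the set of all pairs of a degree and an
  element of that degree.\<close>

definition graded_ideal :: "(int \<times> 'a) set \<Rightarrow> bool" where
  "graded_ideal W \<longleftrightarrow> (\<forall>n a. (n, a) \<in> W \<longrightarrow> a \<in> grading R n) \<and> (\<forall>n. (n, \<zero>) \<in> W) \<and>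
    (\<forall>n a b. (n, a) \<in> W \<and> (n, b) \<in> W \<longrightarrow> (n, a \<oplus> b) \<in> W) \<and>
    (\<forall>m n r a. r \<in> grading R m \<and> (n, a) \<in> W \<longrightarrow> (m + n, r \<otimes> a) \<in> W)"

lemma graded_idealD:
  assumes "graded_ideal W"
  shows "(n, a) \<in> W \<Longrightarrow> a \<in> grading R n" "(n, \<zero>) \<in> W"
    "\<lbrakk>(n, a) \<in> W; (n, b) \<in> W\<rbrakk> \<Longrightarrow> (n, a \<oplus> b) \<in> W"
    "\<lbrakk>r \<in> grading R m; (n, a) \<in> W\<rbrakk> \<Longrightarrow> (m + n, r \<otimes> a) \<in> W"
  using assms unfolding graded_ideal_def by blast+

lemma grading_carrier: "a \<in> grading R n \<Longrightarrow> a \<in> carrier R"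
  using additive_subgroup.a_subset[OF grading_subgroup[of n]] by blast

lemma grading_zero: "\<zero> \<in> grading R n"
  by (rule additive_subgroup.zero_closed[OF grading_subgroup])

lemma grading_add: "\<lbrakk>a \<in> grading R n; b \<in> grading R n\<rbrakk> \<Longrightarrow> a \<oplus> b \<in> grading R n"
  by (rule additive_subgroup.a_closed[OF grading_subgroup])

lemma grading_neg: "a \<in> grading R n \<Longrightarrow> \<ominus> a \<in> grading R n"
  by (rule additive_subgroup.a_inv_closed[OF grading_subgroup])

lemma graded_ideal_neg:
  assumes W: "graded_ideal W" and a: "(n, a) \<in> W" shows "(n, \<ominus> a) \<in> W"
  using graded_idealD(4)[OF W grading_neg[OF grading_one] a] grading_carrier[OF graded_idealD(1)[OF W a]]
  by (simp add: l_minus)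

lemma graded_ideal_swap:
  assumes W: "graded_ideal W" and a: "a \<in> grading R m" and b: "b \<in> grading R n" and ab: "(k, a \<otimes> b) \<in> W"
  shows "(k, b \<otimes> a) \<in> W"
proof -
  have "b \<otimes> a = (if even (n * m) then a \<otimes> b else \<ominus> (a \<otimes> b))" by (rule graded_commute[OF b a])
  then show ?thesis using ab graded_ideal_neg[OF W ab] by simp
qed

text \<open>The ideal quotient \<open>W : z\<close> by a homogeneous element is again a graded ideal.\<close>

lemma graded_ideal_colon:
  assumes W: "graded_ideal W" and z: "z \<in> grading R k"
  shows "graded_ideal {(j, r). r \<in> grading R j \<and> (j + k, r \<otimes> z) \<in> W}" (is "graded_ideal ?C")
    and "W \<subseteq> {(j, r). r \<in> grading R j \<and> (j + k, r \<otimes> z) \<in> W}"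
proof -
  note zc = grading_carrier[OF z]
  have 1: "(n, \<zero>) \<in> ?C" for n using grading_zero graded_idealD(2)[OF W] zc by simp
  have 2: "(n, a \<oplus> b) \<in> ?C" if "(n, a) \<in> ?C" "(n, b) \<in> ?C" for n a b
    using that graded_idealD(3)[OF W] grading_add l_distr[OF grading_carrier[of a n] grading_carrier[of b n] zc] by simp
  have 3: "(m + n, r \<otimes> a) \<in> ?C" if r: "r \<in> grading R m" and a: "(n, a) \<in> ?C" for m n r a
    using graded_idealD(4)[OF W r, of "n + k" "a \<otimes> z"] a grading_mult[OF r]
      m_assoc[OF grading_carrier[OF r] grading_carrier[of a n] zc] by (simp add: add.assoc)
  show "graded_ideal ?C" unfolding graded_ideal_def using 1 2 3 by blast
  show "W \<subseteq> ?C"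
  proof
    fix q assume q: "q \<in> W"
    obtain j r where jr: "q = (j, r)" by (cases q)
    have r: "r \<in> grading R j" using graded_idealD(1)[OF W] q jr by blast
    have "(j + k, z \<otimes> r) \<in> W" using graded_idealD(4)[OF W z, of j r] q jr by (simp add: add.commute)
    then show "q \<in> ?C" using graded_ideal_swap[OF W z r] r jr by simp
  qed
qed

lemma graded_ideal_Union:
  assumes C: "subset.chain \<A> \<C>" and ne: "\<C> \<noteq> {}" and W: "\<And>W. W \<in> \<C> \<Longrightarrow> graded_ideal W"
  shows "graded_ideal (\<Union>\<C>)"
proof -
  have 1: "(n, a \<oplus> b) \<in> \<Union>\<C>" if ab: "(n, a) \<in> \<Union>\<C>" "(n, b) \<in> \<Union>\<C>" for n a b
  proof -
    obtain U V where UV: "U \<in> \<C>" "V \<in> \<C>" "(n, a) \<in> U" "(n, b) \<in> V" using ab by blast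
    have "U \<subseteq> V \<or> V \<subseteq> U" using C UV(1,2) unfolding subset.chain_def by blast
    then show ?thesis using UV graded_idealD(3)[OF W] by blast
  qed
  have 2: "(n, \<zero>) \<in> \<Union>\<C>" for n using ne graded_idealD(2)[OF W] by blast
  have 3: "a \<in> grading R n" if "(n, a) \<in> \<Union>\<C>" for n a using that graded_idealD(1)[OF W] by blast
  have 4: "(m + n, r \<otimes> a) \<in> \<Union>\<C>" if "r \<in> grading R m" "(n, a) \<in> \<Union>\<C>" for m n r a
    using that graded_idealD(4)[OF W] by blast
  show ?thesis unfolding graded_ideal_def using 1 2 3 4 by blast
qed

lemma grading_pow: "y \<in> grading R e \<Longrightarrow> y [^] n \<in> grading R (int n * e)"
proof (induction n)
  case 0 then show ?case using grading_one by simp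
next
  case (Suc n)
  have "y [^] n \<otimes> y \<in> grading R (int n * e + e)" using grading_mult Suc by blast
  then show ?case by (simp add: algebra_simps)
qed

text \<open>A graded ideal that is maximal among those containing no power of \<open>y\<close> is prime.\<close>

lemma graded_ideal_avoiding_powers:
  assumes W0: "graded_ideal W0" and y: "y \<in> grading R e" and av: "\<And>N. (int N * e, y [^] (N::nat)) \<notin> W0"
  obtains W where "graded_ideal W" "W0 \<subseteq> W" "\<And>N. (int N * e, y [^] (N::nat)) \<notin> W"
    "\<And>m n a b. \<lbrakk>a \<in> grading R m; b \<in> grading R n; (m + n, a \<otimes> b) \<in> W\<rbrakk> \<Longrightarrow> (m, a) \<in> W \<or> (n, b) \<in> W"
proof -
  let ?A = "{W. graded_ideal W \<and> W0 \<subseteq> W \<and> (\<forall>N::nat. (int N * e, y [^] N) \<notin> W)}"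
  have "\<exists>W\<in>?A. \<forall>X\<in>?A. W \<subseteq> X \<longrightarrow> X = W"
  proof (rule subset_Zorn)
    fix \<C> assume C: "subset.chain ?A \<C>"
    then have sub: "\<C> \<subseteq> ?A" unfolding subset.chain_def by blast
    show "\<exists>U\<in>?A. \<forall>X\<in>\<C>. X \<subseteq> U"
    proof (cases "\<C> = {}")
      case True
      then show ?thesis using W0 av by blast
    next
      case False
      have "graded_ideal (\<Union>\<C>)" by (rule graded_ideal_Union[OF C False]) (use sub in blast)
      then have "\<Union>\<C> \<in> ?A" using sub False by blast
      then show ?thesis by blast
    qed
  qed
  then obtain W where WA: "W \<in> ?A" and max': "\<forall>X\<in>?A. W \<subseteq> X \<longrightarrow> X = W" by (rule bexE)
  have max: "X = W" if "X \<in> ?A" "W \<subseteq> X" for X using max'[THEN bspec, OF that(1)] that(2) by (rule mp)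
  have W: "graded_ideal W" "W0 \<subseteq> W" "\<And>N::nat. (int N * e, y [^] N) \<notin> W" using WA by blast+
  let ?C = "\<lambda>k z. {(j, r). r \<in> grading R j \<and> (j + k, r \<otimes> z) \<in> W}"
  have prime: "(m, a) \<in> W \<or> (n, b) \<in> W"
    if a: "a \<in> grading R m" and b: "b \<in> grading R n" and ab: "(m + n, a \<otimes> b) \<in> W" for m n a b
  proof (cases "?C n b \<in> ?A")
    case True
    have "?C n b = W" by (rule max[OF True graded_ideal_colon(2)[OF W(1) b]])
    moreover have "(m, a) \<in> ?C n b" using a ab by simp
    ultimately show ?thesis by blast
  next
    case False
    then obtain N :: nat where N: "(int N * e, y [^] N) \<in> ?C n b"
      using graded_ideal_colon[OF W(1) b] W(2) by blast
    let ?z = "y [^] N" and ?k = "int N * e"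
    note z = grading_pow[OF y, of N]
    have "(int K * e, y [^] K) \<notin> ?C ?k ?z" for K :: nat
    proof
      assume "(int K * e, y [^] K) \<in> ?C ?k ?z"
      then have "(int K * e + int N * e, y [^] K \<otimes> y [^] N) \<in> W" by simp
      then have "(int (K + N) * e, y [^] (K + N)) \<in> W"
        using nat_pow_mult[OF grading_carrier[OF y], of K N] by (simp add: algebra_simps)
      then show False using W(3) by blast
    qed
    then have "?C ?k ?z \<in> ?A" using graded_ideal_colon[OF W(1) z] W(2) by blast
    then have eq: "?C ?k ?z = W" by (rule max[OF _ graded_ideal_colon(2)[OF W(1) z]])
    have "(n + ?k, ?z \<otimes> b) \<in> W" using N by (simp add: add.commute)
    then have "(n, b) \<in> ?C ?k ?z" using graded_ideal_swap[OF W(1) z b] b by simp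
    then show ?thesis using eq by blast
  qed
  show ?thesis by (rule that[OF W prime])
qed

text \<open>The finite sums of elements of \<open>W\<close>.  If \<open>W\<close> is a graded ideal, this is an ideal of the ring
  whose homogeneous elements are those of \<open>W\<close>.\<close>

inductive_set gspan :: "(int \<times> 'a) set \<Rightarrow> 'a set" for W where
  zero: "\<zero> \<in> gspan W"
| add: "\<lbrakk>(n, a) \<in> W; r \<in> gspan W\<rbrakk> \<Longrightarrow> a \<oplus> r \<in> gspan W"

lemma gspan_carrier:
  assumes W: "graded_ideal W" shows "r \<in> gspan W \<Longrightarrow> r \<in> carrier R"
proof (induction rule: gspan.induct)
  case (add n a r)
  then show ?case using a_closed[OF grading_carrier[OF graded_idealD(1)[OF W add(1)]]] by blast
qed simp

lemma gspan_plus: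
  assumes W: "graded_ideal W" and s: "s \<in> gspan W"
  shows "r \<in> gspan W \<Longrightarrow> r \<oplus> s \<in> gspan W"
proof (induction rule: gspan.induct)
  case zero then show ?case using s gspan_carrier[OF W s] by simp
next
  case (add n a r)
  have "(a \<oplus> r) \<oplus> s = a \<oplus> (r \<oplus> s)"
    by (rule a_assoc[OF grading_carrier[OF graded_idealD(1)[OF W add(1)]] gspan_carrier[OF W add(2)] gspan_carrier[OF W s]])
  then show ?case using gspan.add[OF add(1,3)] by simp
qed

lemma gspan_incl:
  assumes W: "graded_ideal W" and a: "(n, a) \<in> W" shows "a \<in> gspan W"
  using gspan.add[OF a gspan.zero] grading_carrier[OF graded_idealD(1)[OF W a]] by simp

lemma gspan_mult_homogeneous:
  assumes W: "graded_ideal W" and s: "s \<in> grading R m"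
  shows "r \<in> gspan W \<Longrightarrow> s \<otimes> r \<in> gspan W \<and> r \<otimes> s \<in> gspan W"
proof (induction rule: gspan.induct)
  case zero then show ?case using gspan.zero grading_carrier[OF s] by simp
next
  case (add n a r)
  note a = graded_idealD(1)[OF W add(1)]
  have sa: "(m + n, s \<otimes> a) \<in> W" by (rule graded_idealD(4)[OF W s add(1)])
  have as: "(m + n, a \<otimes> s) \<in> W" by (rule graded_ideal_swap[OF W s a sa])
  show ?case
    using gspan.add[OF sa] gspan.add[OF as] add(3) grading_carrier[OF s] grading_carrier[OF a] gspan_carrier[OF W add(2)]
    by (simp add: l_distr r_distr)
qed

lemma graded_ideal_UNIV: "graded_ideal {(n, a). a \<in> grading R n}"
  unfolding graded_ideal_def using grading_zero grading_add grading_mult by blast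

lemma gspan_UNIV:
  assumes r: "r \<in> carrier R" shows "r \<in> gspan {(n, a). a \<in> grading R n}"
proof -
  obtain c where c: "\<forall>n. c n \<in> grading R n" "finite {n. c n \<noteq> \<zero>}" "r = finsum R c {n. c n \<noteq> \<zero>}"
    using grading_direct_sum[OF r] by blast
  have "finsum R c F \<in> gspan {(n, a). a \<in> grading R n}" if "finite F" for F
    using that
  proof (induction F rule: finite_induct)
    case empty show ?case using gspan.zero by simp
  next
    case (insert n F)
    have "finsum R c (insert n F) = c n \<oplus> finsum R c F"
      using insert c(1) grading_carrier by (intro finsum_insert) blast+
    then show ?case using gspan.add[of n "c n"] insert c(1) by simp
  qed
  then show ?thesis using c(2,3) by blast
qed

lemma gspan_mult:
  assumes W: "graded_ideal W" and r: "r \<in> gspan W" and s: "s \<in> carrier R"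
  shows "s \<otimes> r \<in> gspan W \<and> r \<otimes> s \<in> gspan W"
  using gspan_UNIV[OF s]
proof (induction rule: gspan.induct)
  case zero then show ?case using gspan.zero gspan_carrier[OF W r] by simp
next
  case (add n a s)
  have a: "a \<in> grading R n" using add(1) by simp
  note sc = gspan_carrier[OF graded_ideal_UNIV add(2)] and rc = gspan_carrier[OF W r]
  show ?case
    using gspan_plus[OF W] gspan_mult_homogeneous[OF W a r] add(3) sc rc grading_carrier[OF a]
    by (simp add: l_distr r_distr)
qed

lemma gspan_decomposition:
  assumes W: "graded_ideal W"
  shows "r \<in> gspan W \<Longrightarrow> \<exists>c F. finite F \<and> (\<forall>n. (n, c n) \<in> W) \<and> (\<forall>n. n \<notin> F \<longrightarrow> c n = \<zero>) \<and> r = finsum R c F"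
proof (induction rule: gspan.induct)
  case zero
  show ?case using graded_idealD(2)[OF W] by (intro exI[of _ "\<lambda>_. \<zero>"] exI[of _ "{}"]) simp
next
  case (add n a r)
  then obtain c F where c: "finite F" "\<forall>n. (n, c n) \<in> W" "\<forall>n. n \<notin> F \<longrightarrow> c n = \<zero>" "r = finsum R c F" by blast
  have cc: "c m \<in> carrier R" for m using c(2) grading_carrier graded_idealD(1)[OF W] by blast
  have ac: "a \<in> carrier R" using add(1) grading_carrier graded_idealD(1)[OF W] by blast
  let ?c = "c(n := a \<oplus> c n)" and ?G = "F - {n}"
  have G: "finite ?G" "n \<notin> ?G" using c(1) by auto
  have "r = finsum R c (insert n ?G)"
  proof (cases "n \<in> F")
    case True
    then show ?thesis using c(4) by (simp add: insert_absorb)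
  next
    case False
    then have "finsum R c (insert n F) = c n \<oplus> finsum R c F" using c(1) cc by (intro finsum_insert) auto
    then show ?thesis using c(3,4) False cc by (simp add: finsum_closed Pi_I)
  qed
  also have "\<dots> = c n \<oplus> finsum R c ?G" using G cc by (intro finsum_insert) auto
  finally have r: "r = c n \<oplus> finsum R c ?G" .
  have "finsum R ?c (insert n ?G) = ?c n \<oplus> finsum R ?c ?G" using G cc ac by (intro finsum_insert) auto
  also have "finsum R ?c ?G = finsum R c ?G" using cc by (intro finsum_cong') auto
  finally have sum: "finsum R ?c (insert n ?G) = ?c n \<oplus> finsum R c ?G" .
  have "?c n \<oplus> finsum R c ?G = a \<oplus> r"
    unfolding r using ac cc by (simp add: a_assoc finsum_closed Pi_I)
  then have "a \<oplus> r = finsum R ?c (insert n ?G)" by (simp only: sum)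
  moreover have "\<forall>m. (m, ?c m) \<in> W" using c(2) add(1) graded_idealD(3)[OF W] by simp
  moreover have "\<forall>m. m \<notin> insert n ?G \<longrightarrow> ?c m = \<zero>" using c(3) by simp
  moreover have "finite (insert n ?G)" using c(1) by simp
  ultimately show ?case by blast
qed

lemma gspan_homogeneous:
  assumes W: "graded_ideal W" and r: "r \<in> gspan W" and rn: "r \<in> grading R n"
  shows "(n, r) \<in> W"
proof -
  obtain c F where c: "finite F" "\<forall>n. (n, c n) \<in> W" "\<forall>n. n \<notin> F \<longrightarrow> c n = \<zero>" "r = finsum R c F"
    using gspan_decomposition[OF W r] by blast
  have cg: "c m \<in> grading R m" for m using c(2) graded_idealD(1)[OF W] by blast
  define P where "P c \<longleftrightarrow> (\<forall>n. c n \<in> grading R n) \<and> finite {n. c n \<noteq> \<zero>} \<and> r = finsum R c {n. c n \<noteq> \<zero>}" for c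
  have sub: "{m. c m \<noteq> \<zero>} \<subseteq> F" using c(3) by blast
  have "finsum R c {m. c m \<noteq> \<zero>} = finsum R c F"
    using c(1) sub cg grading_carrier by (intro add.finprod_mono_neutral_cong_left) auto
  then have 1: "P c"
    unfolding P_def using cg c(1,4) finite_subset[OF sub] by auto
  let ?c = "\<lambda>m. if m = n then r else \<zero>"
  have rc: "r \<in> carrier R" by (rule grading_carrier[OF rn])
  have s: "{m. ?c m \<noteq> \<zero>} = (if r = \<zero> then {} else {n})" by auto
  have "finsum R ?c {n} = ?c n \<oplus> finsum R ?c {}" using rc by (intro finsum_insert) auto
  then have "r = finsum R ?c {m. ?c m \<noteq> \<zero>}" unfolding s using rc by auto
  moreover have "finite {m. ?c m \<noteq> \<zero>}" unfolding s by simp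
  ultimately have 2: "P ?c"
    unfolding P_def using rn grading_zero by simp
  have "\<exists>!c. P c" unfolding P_def by (rule grading_direct_sum[OF rc])
  then have "c = ?c" using 1 2 by blast
  then have "c n = r" by simp
  then show ?thesis using c(2) by metis
qed

lemma gspan_ideal:
  assumes W: "graded_ideal W" shows "ideal (gspan W) R"
proof (rule idealI)
  show "ring R" by (rule ring_axioms)
  show "subgroup (gspan W) (add_monoid R)"
  proof (rule subgroup.intro)
    show "gspan W \<subseteq> carrier (add_monoid R)" using gspan_carrier[OF W] by auto
    show "\<one>\<^bsub>add_monoid R\<^esub> \<in> gspan W" using gspan.zero by simp
    show "r \<otimes>\<^bsub>add_monoid R\<^esub> s \<in> gspan W" if "r \<in> gspan W" "s \<in> gspan W" for r s
      using gspan_plus[OF W that(2,1)] by simp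
    show "inv\<^bsub>add_monoid R\<^esub> r \<in> gspan W" if r: "r \<in> gspan W" for r
    proof -
      have "(\<ominus> \<one>) \<otimes> r \<in> gspan W" using gspan_mult[OF W r, of "\<ominus> \<one>"] by simp
      then have "\<ominus> r \<in> gspan W" using gspan_carrier[OF W r] by (simp add: l_minus)
      then show ?thesis by (simp add: a_inv_def)
    qed
  qed
qed (use gspan_mult[OF W] in blast)+

lemma graded_prime_avoiding_powers:
  assumes W0: "graded_ideal W0" and y: "y \<in> grading R e" and av: "\<And>N. (int N * e, y [^] (N::nat)) \<notin> W0"
  obtains \<pp> where "\<pp> \<in> graded_Spec R" "y \<notin> \<pp>" "snd ` W0 \<subseteq> \<pp>"
proof -
  obtain W where W: "graded_ideal W" "W0 \<subseteq> W" "\<And>N. (int N * e, y [^] (N::nat)) \<notin> W" and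
    prime: "\<And>m n a b. \<lbrakk>a \<in> grading R m; b \<in> grading R n; (m + n, a \<otimes> b) \<in> W\<rbrakk> \<Longrightarrow> (m, a) \<in> W \<or> (n, b) \<in> W"
    by (rule graded_ideal_avoiding_powers[OF W0 y av]) blast
  note hom = gspan_homogeneous[OF W(1)] and id = gspan_ideal[OF W(1)]
  have sub: "gspan W \<subseteq> carrier R" using gspan_carrier[OF W(1)] by blast
  let ?h = "gspan W \<inter> homogeneous R"
  have hs: "?h \<subseteq> carrier R" using sub by blast
  have "gspan W = Idl ?h"
  proof
    show "Idl ?h \<subseteq> gspan W" by (rule genideal_minimal[OF id]) blast
    have I: "ideal (Idl ?h) R" by (rule genideal_ideal[OF hs])
    have "r \<in> Idl ?h" if "r \<in> gspan W" for r
      using that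
    proof (induction rule: gspan.induct)
      case zero show ?case by (rule additive_subgroup.zero_closed[OF ideal.axioms(1)[OF I]])
    next
      case (add n a r)
      have "a \<in> ?h" using gspan_incl[OF W(1) add(1)] graded_idealD(1)[OF W(1) add(1)] unfolding homogeneous_def by blast
      then have "a \<in> Idl ?h" using genideal_self[OF hs] by blast
      then show ?case using additive_subgroup.a_closed[OF ideal.axioms(1)[OF I]] add(3) by blast
    qed
    then show "gspan W \<subseteq> Idl ?h" by blast
  qed
  then have "homogeneous_ideal R (gspan W)" unfolding homogeneous_ideal_def using id by blast
  moreover have "gspan W \<noteq> carrier R"
  proof
    assume "gspan W = carrier R"
    then have "\<one> \<in> gspan W" by simp
    then have "(0, \<one>) \<in> W" by (rule hom[OF _ grading_one])
    then show False using W(3)[of 0] by simp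
  qed
  moreover have "a \<in> gspan W \<or> b \<in> gspan W"
    if a: "a \<in> homogeneous R" and b: "b \<in> homogeneous R" and ab: "a \<otimes> b \<in> gspan W" for a b
  proof -
    obtain m n where mn: "a \<in> grading R m" "b \<in> grading R n" using a b unfolding homogeneous_def by blast
    have "(m + n, a \<otimes> b) \<in> W" by (rule hom[OF ab grading_mult[OF mn]])
    then show ?thesis using prime[OF mn] gspan_incl[OF W(1)] by blast
  qed
  ultimately have "gspan W \<in> graded_Spec R" unfolding graded_Spec_def by blast
  moreover have "y \<notin> gspan W"
  proof
    assume "y \<in> gspan W"
    then have "(e, y) \<in> W" by (rule hom[OF _ y])
    then show False using W(3)[of 1] grading_carrier[OF y] by simp
  qed
  moreover have "snd ` W0 \<subseteq> gspan W" using W(2) gspan_incl[OF W(1)] by force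
  ultimately show ?thesis by (rule that)
qed

lemma graded_primeD:
  assumes "\<pp> \<in> graded_Spec R"
  shows "ideal \<pp> R" "\<one> \<notin> \<pp>" "\<lbrakk>a \<in> grading R m; b \<in> grading R n; a \<otimes> b \<in> \<pp>\<rbrakk> \<Longrightarrow> a \<in> \<pp> \<or> b \<in> \<pp>"
proof -
  show id: "ideal \<pp> R" using assms unfolding graded_Spec_def homogeneous_ideal_def by blast
  show "\<one> \<notin> \<pp>" using ideal.one_imp_carrier[OF id] assms unfolding graded_Spec_def by blast
  show "\<lbrakk>a \<in> grading R m; b \<in> grading R n; a \<otimes> b \<in> \<pp>\<rbrakk> \<Longrightarrow> a \<in> \<pp> \<or> b \<in> \<pp>"
    using assms unfolding graded_Spec_def homogeneous_def by blast
qed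

lemma graded_prime_pow:
  assumes p: "\<pp> \<in> graded_Spec R" and y: "y \<in> grading R e" "y \<notin> \<pp>" shows "y [^] (n::nat) \<notin> \<pp>"
proof (induction n)
  case 0 show ?case using graded_primeD(2)[OF p] by simp
next
  case (Suc n) then show ?case using graded_primeD(3)[OF p grading_pow[OF y(1)] y(1), of n] y(2) by auto
qed

end

section \<open>The action of the ring\<close>

text \<open>Linear triangulated categories, with \<open>T\<close> as the implicit structure for composition and addition
  of morphisms.\<close>

locale graded_action = linear_triangulated_category R T \<Phi>
  for R :: "('r, 'y) graded_ring_scheme" and T :: "('o, 'm, 'z) tcat_scheme" (structure)
    and \<Phi> :: "int \<Rightarrow> 'r \<Rightarrow> 'o \<Rightarrow> 'm"
begin

lemma act_arrow: "\<lbrakk>r \<in> grading R n; X \<in> Ob T\<rbrakk> \<Longrightarrow> \<guillemotleft>\<Phi> n r X : X \<rightarrow> Sob n X\<guillemotright>"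
  using action_center[of r n] Sob_closed[of X n] unfolding graded_center_def arrow_def by blast

lemma act_natural:
  assumes "r \<in> grading R n" "\<guillemotleft>f : X \<rightarrow> Y\<guillemotright>" shows "\<Phi> n r Y \<bullet> f = Sh n f \<bullet> \<Phi> n r X"
proof -
  have "\<forall>X \<in> Ob T. \<forall>Y \<in> Ob T. \<forall>f \<in> Hom T X Y. \<Phi> n r Y \<bullet> f = Sh n f \<bullet> \<Phi> n r X"
    using action_center[OF assms(1)] unfolding graded_center_def by blast
  from this[THEN bspec, THEN bspec, THEN bspec, OF arrowD[OF assms(2)]] show ?thesis .
qed

lemma act_Susp:
  assumes "r \<in> grading R n" "X \<in> Ob T"
  shows "\<Phi> n r (Sob 1 X) = (if even n then Sh 1 (\<Phi> n r X)
    else Neg T (Sob 1 X) (Sob (n + 1) X) (Sh 1 (\<Phi> n r X)))"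
  using action_center[OF assms(1)] assms(2) unfolding graded_center_def Susp_eq by blast

text \<open>The signs in the compatibility with the suspension do not affect vanishing.\<close>

lemma act_comp_zero_Susp:
  assumes r: "r \<in> grading R n" and f: "\<guillemotleft>f : V \<rightarrow> W\<guillemotright>"
  shows "\<Phi> n r (Sob 1 W) \<bullet> Sh 1 f = Zer T (Sob 1 V) (Sob (n + 1) W) \<longleftrightarrow> \<Phi> n r W \<bullet> f = Zer T V (Sob n W)"
proof -
  have W: "W \<in> Ob T" and V: "V \<in> Ob T" using arrowD f by blast+
  note a = act_arrow[OF r W]
  note Sf = Sh_arrow[OF f, of 1]
  have Sa: "\<guillemotleft>Sh 1 (\<Phi> n r W) : Sob 1 W \<rightarrow> Sob (n + 1) W\<guillemotright>"
    using Sh_arrow[OF a, of 1] W by (simp add: Sob_add add.commute)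
  have eq: "Sh 1 (\<Phi> n r W) \<bullet> Sh 1 f = Sh 1 (\<Phi> n r W \<bullet> f)" using f a by (simp add: arrow_iff Sh_comp)
  have SS: "Sob 1 (Sob n W) = Sob (n + 1) W" using W by (simp add: Sob_add add.commute)
  have iff: "Sh 1 (\<Phi> n r W) \<bullet> Sh 1 f = Zer T (Sob 1 V) (Sob (n + 1) W) \<longleftrightarrow> \<Phi> n r W \<bullet> f = Zer T V (Sob n W)"
    unfolding eq SS[symmetric] by (rule Sh_zero_iff[OF arrow_comp[OF f a]])
  have z: "Neg T (Sob 1 V) (Sob (n + 1) W) (Zer T (Sob 1 V) (Sob (n + 1) W)) = Zer T (Sob 1 V) (Sob (n + 1) W)"
    by (rule zero_neg[OF Sob_closed[OF V] Sob_closed[OF W]])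
  have "Neg T (Sob 1 W) (Sob (n + 1) W) (Sh 1 (\<Phi> n r W)) \<bullet> Sh 1 f = Zer T (Sob 1 V) (Sob (n + 1) W) \<longleftrightarrow>
    Sh 1 (\<Phi> n r W) \<bullet> Sh 1 f = Zer T (Sob 1 V) (Sob (n + 1) W)"
    unfolding neg_comp[OF Sf Sa] using z neg_inj[OF arrow_comp[OF Sf Sa] arrow_zero[OF Sob_closed[OF V] Sob_closed[OF W]]]
    by metis
  then show ?thesis unfolding act_Susp[OF r W] using iff by simp
qed

lemma act_comp_zero_shift:
  assumes r: "r \<in> grading R n" and f: "\<guillemotleft>f : V \<rightarrow> W\<guillemotright>"
  shows "\<Phi> n r (Sob k W) \<bullet> Sh k f = Zer T (Sob k V) (Sob (n + k) W) \<longleftrightarrow> \<Phi> n r W \<bullet> f = Zer T V (Sob n W)"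
proof -
  have W: "W \<in> Ob T" and V: "V \<in> Ob T" using arrowD f by blast+
  have fa: "arr f" using f by (simp add: arrow_iff)
  have *: "\<Phi> n r (Sob (i + 1) W) \<bullet> Sh (i + 1) f = Zer T (Sob (i + 1) V) (Sob (n + (i + 1)) W) \<longleftrightarrow>
      \<Phi> n r (Sob i W) \<bullet> Sh i f = Zer T (Sob i V) (Sob (n + i) W)" for i
    using act_comp_zero_Susp[OF r Sh_arrow[OF f, of i]] V W fa
    by (simp add: Sob_add Sh_add add.commute add.left_commute)
  show ?thesis
  proof (induction k rule: int_induct[where k = 0])
    case base then show ?case by (simp add: Sob_0 Sh_0)
  next
    case (step1 i) then show ?case using *[of i] by blast
  next
    case (step2 i) then show ?case using *[of "i - 1"] by simp
  qed
qed

text \<open>The homogeneous element \<open>r\<close> of degree \<open>n\<close> annihilates \<open>X\<close>.\<close>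

definition kills where "kills n r X \<longleftrightarrow> \<Phi> n r X = Zer T X (Sob n X)"

lemma kills_shift:
  assumes r: "r \<in> grading R n" and X: "X \<in> Ob T"
  shows "kills n r (Sob k X) \<longleftrightarrow> kills n r X"
proof -
  have "\<Phi> n r (Sob k X) \<bullet> Ident T (Sob k X) = \<Phi> n r (Sob k X)" "\<Phi> n r X \<bullet> Ident T X = \<Phi> n r X"
    using comp_ident act_arrow[OF r] X Sob_closed by blast+
  then show ?thesis
    using act_comp_zero_shift[OF r arrow_ident[OF X], of k] X unfolding kills_def
    by (simp add: Sh_Ident Sob_add)
qed

lemma kills_comp:
  assumes r: "r \<in> grading R n" and k: "kills n r X" and f: "\<guillemotleft>f : D \<rightarrow> X\<guillemotright>"
  shows "\<Phi> n r X \<bullet> f = Zer T D (Sob n X)"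
  using k zero_comp[OF f Sob_closed[OF arrowD(2)[OF f]]] unfolding kills_def by simp

lemma kills_source:
  assumes r: "r \<in> grading R n" and k: "kills n r D" and f: "\<guillemotleft>f : D \<rightarrow> X\<guillemotright>"
  shows "\<Phi> n r X \<bullet> f = Zer T D (Sob n X)"
  using act_natural[OF r f] comp_zero[OF Sh_arrow[OF f] arrowD(1)[OF f]] k unfolding kills_def by simp

lemma kills_mult:
  assumes r: "r \<in> grading R m" and y: "y \<in> grading R n" and X: "X \<in> Ob T" and k: "kills m r X \<or> kills n y X"
  shows "kills (m + n) (r \<otimes>\<^bsub>R\<^esub> y) X"
proof -
  note a = act_arrow[OF y X] and b = act_arrow[OF r Sob_closed[OF X], of n]
  have S: "Sob m (Sob n X) = Sob (m + n) X" using X by (simp add: Sob_add)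
  have "\<Phi> m r (Sob n X) \<bullet> \<Phi> n y X = Zer T X (Sob (m + n) X)"
    using k
  proof
    assume "kills m r X"
    then have "kills m r (Sob n X)" using kills_shift[OF r X] by blast
    from kills_comp[OF r this a] show ?thesis unfolding S .
  next
    assume "kills n y X"
    then show ?thesis using comp_zero[OF b X] S unfolding kills_def by simp
  qed
  then show ?thesis unfolding kills_def action_mult[OF r y X] .
qed

lemma kills_zero: 
  assumes X: "X \<in> Ob T" and z: "\<zero>\<^bsub>R\<^esub> \<in> grading R n" shows "kills n \<zero>\<^bsub>R\<^esub> X"
  unfolding kills_def
proof (rule idem_zero[OF act_arrow[OF z X]])
  show "\<Phi> n \<zero>\<^bsub>R\<^esub> X \<boxplus> \<Phi> n \<zero>\<^bsub>R\<^esub> X = \<Phi> n \<zero>\<^bsub>R\<^esub> X"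
    using action_add[OF z z X] by simp
qed

lemma kills_add:
  assumes "r \<in> grading R n" "y \<in> grading R n" "X \<in> Ob T" "kills n r X" "kills n y X"
  shows "kills n (r \<oplus>\<^bsub>R\<^esub> y) X"
  using assms action_add[OF assms(1-3)] add_zero[OF arrow_zero[OF assms(3) Sob_closed[OF assms(3)]]]
  unfolding kills_def by simp

text \<open>If \<open>y\<close> annihilates \<open>a\<close> and \<open>b\<close> in an exact triangle \<open>K' \<rightarrow> K \<rightarrow> Z \<rightarrow> \<Sigma> K'\<close> with first
  morphism \<open>a\<close> and last morphism \<open>b\<close>, then \<open>y\<^sup>2\<close> annihilates \<open>K'\<close>.\<close>

lemma square_kills:
  assumes ex: "(K', K, Z, a, u, b) \<in> Exact T" and y: "y \<in> grading R e"
    and ya: "\<Phi> e y K \<bullet> a = Zer T K' (Sob e K)" and yb: "\<Phi> e y (Sob 1 K') \<bullet> b = Zer T Z (Sob (e + 1) K')"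
  shows "kills (e + e) (y \<otimes>\<^bsub>R\<^esub> y) K'"
proof -
  note x = exact_arrows[OF ex]
  have ob: "K' \<in> Ob T" "K \<in> Ob T" "Z \<in> Ob T" using x arrowD by blast+
  note yK' = act_arrow[OF y ob(1)]
  define g where "g = Sh (- e) (\<Phi> e y K')"
  have g: "\<guillemotleft>g : Sob (- e) K' \<rightarrow> K'\<guillemotright>" using Sh_arrow[OF yK', of "- e"] ob unfolding g_def by (simp add: Sob_add Sob_0)
  have "a \<bullet> g = Sh (- e) (Sh e a \<bullet> \<Phi> e y K')" unfolding g_def using x yK' ob by (simp add: tri_rules)
  also have "\<dots> = Sh (- e) (Zer T K' (Sob e K))" using act_natural[OF y x(1)] ya by simp
  also have "\<dots> = Zer T (Sob (- e) K') K" using ob by (simp add: tri_rules)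
  finally have ag: "a \<bullet> g = Zer T (Sob (- e) K') K" .
  note Sg = Sh_arrow[OF g, of 1]
  have "Sh 1 a \<bullet> Sh 1 g = Sh 1 (a \<bullet> g)" using x g by (simp add: arrow_iff Sh_comp)
  also have "\<dots> = Zer T (Sob 1 (Sob (- e) K')) (Sob 1 K)" unfolding ag by (rule Sh_Zer[OF Sob_closed[OF ob(1)] ob(2)])
  finally have "Sh 1 a \<bullet> Sh 1 g = Zer T (Sob 1 (Sob (- e) K')) (Sob 1 K)" .
  then obtain h where h: "\<guillemotleft>h : Sob 1 (Sob (- e) K') \<rightarrow> Z\<guillemotright>" "b \<bullet> h = Sh 1 g" by (rule hom_exact1[OF ex Sg])
  have yS: "\<guillemotleft>\<Phi> e y (Sob 1 K') : Sob 1 K' \<rightarrow> Sob (e + 1) K'\<guillemotright>"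
    using act_arrow[OF y Sob_closed[OF ob(1)], of 1] ob by (simp add: Sob_add)
  have "\<Phi> e y (Sob 1 K') \<bullet> (b \<bullet> h) = Zer T (Sob 1 (Sob (- e) K')) (Sob (e + 1) K')"
    using comp_eq_comp[OF x(3) yS h(1) yb] zero_comp[OF h(1) Sob_closed[OF ob(1)]] by simp
  then have "\<Phi> e y (Sob 1 K') \<bullet> Sh 1 g = Zer T (Sob 1 (Sob (- e) K')) (Sob (e + 1) K')" unfolding h(2) .
  then have "\<Phi> e y K' \<bullet> g = Zer T (Sob (- e) K') (Sob e K')" using act_comp_zero_Susp[OF y g] by blast
  then have "\<Phi> e y (Sob e K') \<bullet> Sh e g = Zer T (Sob e (Sob (- e) K')) (Sob (e + e) K')"
    using act_comp_zero_shift[OF y g, of e] by blast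
  moreover have "Sh e g = \<Phi> e y K'" unfolding g_def using yK' by (simp add: tri_rules)
  moreover have "Sob e (Sob (- e) K') = K'" using ob by (simp add: Sob_add Sob_0)
  ultimately show ?thesis unfolding kills_def action_mult[OF y y ob(1)] by simp
qed

lemma kills_fibre:
  assumes ex: "(K', K, Z, a, u, b) \<in> Exact T" and y: "y \<in> grading R e" and k: "kills e y K" "kills e y Z"
  shows "kills (e + e) (y \<otimes>\<^bsub>R\<^esub> y) K'"
proof (rule square_kills[OF ex y kills_comp[OF y k(1) exact_arrows(1)[OF ex]]])
  show "\<Phi> e y (Sob 1 K') \<bullet> b = Zer T Z (Sob (e + 1) K')"
    using kills_source[OF y k(2) exact_arrows(3)[OF ex]] arrowD(1)[OF exact_arrows(1)[OF ex]] by (simp add: Sob_add)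
qed

text \<open>On the fibre of \<open>y : K \<rightarrow> \<Sigma>\<^sup>e K\<close>, the square of \<open>y\<close> vanishes, although \<open>y\<close> need not annihilate \<open>K\<close>.\<close>

lemma kills_fibre_self:
  assumes ex: "(K', K, Sob e K, a, \<Phi> e y K, b) \<in> Exact T" and y: "y \<in> grading R e"
  shows "kills (e + e) (y \<otimes>\<^bsub>R\<^esub> y) K'"
proof (rule square_kills[OF ex y exact_comp_zero[OF ex]])
  note x = exact_arrows[OF ex]
  have ob: "K' \<in> Ob T" "K \<in> Ob T" using x arrowD by blast+
  define c where "c = Sh (- e) b"
  have c: "\<guillemotleft>c : K \<rightarrow> Sob (1 - e) K'\<guillemotright>" using Sh_arrow[OF x(3), of "- e"] ob unfolding c_def by (simp add: Sob_add Sob_0)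
  have cb: "Sh e c = b" unfolding c_def using x(3) by (simp add: tri_rules)
  have "\<Phi> e y (Sob (1 - e) K') \<bullet> c = b \<bullet> \<Phi> e y K" using act_natural[OF y c] cb by simp
  also have "\<dots> = Zer T K (Sob 1 K')" by (rule exact_comp_zero2[OF ex])
  finally have "\<Phi> e y (Sob (1 - e) K') \<bullet> c = Zer T K (Sob e (Sob (1 - e) K'))" using ob by (simp add: Sob_add)
  then have "\<Phi> e y (Sob e (Sob (1 - e) K')) \<bullet> Sh e c = Zer T (Sob e K) (Sob (e + e) (Sob (1 - e) K'))"
    using act_comp_zero_shift[OF y c, of e] by blast
  then show "\<Phi> e y (Sob 1 K') \<bullet> b = Zer T (Sob e K) (Sob (e + 1) K')" unfolding cb using ob by (simp add: Sob_add)
qed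

end

section \<open>Koszul systems\<close>

text \<open>Homogeneous elements \<open>x 1, \<dots>, x t\<close> of degrees \<open>d 1, \<dots>, d t\<close>.\<close>

locale koszul = graded_action R T \<Phi>
  for R :: "('r, 'y) graded_ring_scheme" and T :: "('o, 'm, 'z) tcat_scheme" (structure)
    and \<Phi> :: "int \<Rightarrow> 'r \<Rightarrow> 'o \<Rightarrow> 'm" +
  fixes t :: nat and x :: "nat \<Rightarrow> 'r" and d :: "nat \<Rightarrow> int"
  assumes x_grading: "i \<in> {1..t} \<Longrightarrow> x i \<in> grading R (d i)"
begin

lemma x_carrier: "i \<in> {1..t} \<Longrightarrow> x i \<in> carrier R"
  by (rule grading_carrier[OF x_grading])

lemma pow_grading: "i \<in> {1..t} \<Longrightarrow> x i [^]\<^bsub>R\<^esub> n \<in> grading R (int n * d i)"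
  by (rule grading_pow[OF x_grading])

text \<open>Vanishing of the \<open>n\<close>-th power of \<open>x i\<close> on \<open>X\<close>, and the morphism that it induces on \<open>X\<close>.\<close>

abbreviation xkills where "xkills i n X \<equiv> kills (int n * d i) (x i [^]\<^bsub>R\<^esub> n) X"
abbreviation xact where "xact i n X \<equiv> \<Phi> (int n * d i) (x i [^]\<^bsub>R\<^esub> n) X"

lemma xact_arrow: "\<lbrakk>i \<in> {1..t}; X \<in> Ob T\<rbrakk> \<Longrightarrow> \<guillemotleft>xact i n X : X \<rightarrow> Sob (int n * d i) X\<guillemotright>"
  by (rule act_arrow[OF pow_grading])

lemma xact_Suc:
  assumes i: "i \<in> {1..t}" and X: "X \<in> Ob T"
  shows "xact i (Suc n) X = \<Phi> (d i) (x i) (Sob (int n * d i) X) \<bullet> xact i n X"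
proof -
  have "x i [^]\<^bsub>R\<^esub> Suc n = x i \<otimes>\<^bsub>R\<^esub> x i [^]\<^bsub>R\<^esub> n"
    by (rule nat_pow_Suc2[OF x_carrier[OF i]])
  then show ?thesis using action_mult[OF x_grading[OF i] pow_grading[OF i] X, of n]
    by (simp add: algebra_simps)
qed

lemma xkills_mono:
  assumes i: "i \<in> {1..t}" and X: "X \<in> Ob T" and k: "xkills i n X" and le: "n \<le> m"
  shows "xkills i m X"
proof -
  have "kills (int (m - n) * d i + int n * d i) (x i [^]\<^bsub>R\<^esub> (m - n) \<otimes>\<^bsub>R\<^esub> x i [^]\<^bsub>R\<^esub> n) X"
    by (rule kills_mult[OF pow_grading[OF i] pow_grading[OF i] X]) (use k in blast)
  moreover have "x i [^]\<^bsub>R\<^esub> (m - n) \<otimes>\<^bsub>R\<^esub> x i [^]\<^bsub>R\<^esub> n = x i [^]\<^bsub>R\<^esub> m"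
    using nat_pow_mult[OF x_carrier[OF i], of "m - n" n] le by simp
  moreover have "int (m - n) * d i + int n * d i = int m * d i" using le by (simp add: of_nat_diff algebra_simps)
  ultimately show ?thesis by simp
qed

lemma xkills_double:
  assumes i: "i \<in> {1..t}"
    and k: "kills (int n * d i + int n * d i) (x i [^]\<^bsub>R\<^esub> n \<otimes>\<^bsub>R\<^esub> x i [^]\<^bsub>R\<^esub> n) X"
  shows "xkills i (n + n) X"
  using k nat_pow_mult[OF x_carrier[OF i], of n n] by (simp add: algebra_simps)

text \<open>The action of \<open>x i\<close> on \<open>X\<close> is nilpotent.\<close>

definition nilpotent where "nilpotent i X \<longleftrightarrow> (\<exists>n. xkills i n X)"

lemma nilpotent_shift: "\<lbrakk>i \<in> {1..t}; X \<in> Ob T\<rbrakk> \<Longrightarrow> nilpotent i (Sob k X) \<longleftrightarrow> nilpotent i X"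
  unfolding nilpotent_def using kills_shift[OF pow_grading] by blast

text \<open>One stage of the construction: \<open>K' n\<close> is a fibre of the \<open>n\<close>-th power of \<open>x s\<close> on \<open>K n\<close>, and
  \<open>u'\<close> extends \<open>u\<close> to the fibres.\<close>

definition koszul_step where
  "koszul_step s K u K' a b u' \<longleftrightarrow> (\<forall>n \<ge> 1.
     (K' n, K n, Sob (int n * d s) (K n), a n, xact s n (K n), b n) \<in> Exact T \<and>
     \<guillemotleft>u' n : K' n \<rightarrow> K' (Suc n)\<guillemotright> \<and> u n \<bullet> a n = a (Suc n) \<bullet> u' n \<and>
     Sh 1 (u' n) \<bullet> b n = b (Suc n) \<bullet>
       (\<Phi> (d s) (x s) (Sob (int n * d s) (K (Suc n))) \<bullet> Sh (int n * d s) (u n)))"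

text \<open>The systems \<open>K\<close> obtained after \<open>s\<close> stages, with transition morphisms \<open>u\<close> and with the
  augmentation \<open>e n : K n \<rightarrow> M\<close>, the composite of the first morphisms of the triangles.\<close>

inductive koszul_system for M where
  base: "(\<And>n. n \<ge> 1 \<Longrightarrow> K n = M \<and> u n = Ident T M \<and> e n = Ident T M) \<Longrightarrow> koszul_system M 0 K u e"
| step: "\<lbrakk>koszul_system M s K u e; koszul_step (Suc s) K u K' a b u';
    \<And>n. n \<ge> 1 \<Longrightarrow> e' n = e n \<bullet> a n\<rbrakk> \<Longrightarrow> koszul_system M (Suc s) K' u' e'"

lemma koszul_stepD:
  assumes "koszul_step s K u K' a b u'" "n \<ge> 1"
  shows "(K' n, K n, Sob (int n * d s) (K n), a n, xact s n (K n), b n) \<in> Exact T"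
     "\<guillemotleft>u' n : K' n \<rightarrow> K' (Suc n)\<guillemotright>" "u n \<bullet> a n = a (Suc n) \<bullet> u' n"
     "Sh 1 (u' n) \<bullet> b n = b (Suc n) \<bullet>
       (\<Phi> (d s) (x s) (Sob (int n * d s) (K (Suc n))) \<bullet> Sh (int n * d s) (u n))"
     "\<guillemotleft>a n : K' n \<rightarrow> K n\<guillemotright>"
  using assms exact_arrows(1) unfolding koszul_step_def by blast+

lemma koszul_system_arrows:
  assumes M: "M \<in> Ob T"
  shows "koszul_system M s K u e \<Longrightarrow>
    (\<forall>n\<ge>1. K n \<in> Ob T \<and> \<guillemotleft>u n : K n \<rightarrow> K (Suc n)\<guillemotright> \<and> \<guillemotleft>e n : K n \<rightarrow> M\<guillemotright> \<and> e (Suc n) \<bullet> u n = e n)"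
proof (induction rule: koszul_system.induct)
  case (base K u e)
  show ?case
  proof (intro allI impI)
    fix n :: nat assume n: "n \<ge> 1"
    have "K n = M \<and> u n = Ident T M \<and> e n = Ident T M" by (rule base[OF n])
    moreover have "K (Suc n) = M \<and> u (Suc n) = Ident T M \<and> e (Suc n) = Ident T M" by (rule base) simp
    ultimately show "K n \<in> Ob T \<and> \<guillemotleft>u n : K n \<rightarrow> K (Suc n)\<guillemotright> \<and> \<guillemotleft>e n : K n \<rightarrow> M\<guillemotright> \<and> e (Suc n) \<bullet> u n = e n"
      using M arrow_ident[OF M] comp_ident[OF arrow_ident[OF M]] by simp
  qed
next
  case (step s K u e K' a b u' e')
  show ?case
  proof (intro allI impI)
    fix n :: nat assume n: "n \<ge> 1"
    have n': "Suc n \<ge> 1" by simp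
    note s = koszul_stepD[OF step(2) n] and s' = koszul_stepD[OF step(2) n']
    have K: "\<guillemotleft>u n : K n \<rightarrow> K (Suc n)\<guillemotright>" "\<guillemotleft>e n : K n \<rightarrow> M\<guillemotright>" "\<guillemotleft>e (Suc n) : K (Suc n) \<rightarrow> M\<guillemotright>" "e (Suc n) \<bullet> u n = e n"
      using step.IH n n' by blast+
    have "e' (Suc n) \<bullet> u' n = e (Suc n) \<bullet> (a (Suc n) \<bullet> u' n)"
      unfolding step(3)[OF n'] by (rule comp_assoc[OF s(2) s'(5) K(3)])
    also have "\<dots> = e (Suc n) \<bullet> (u n \<bullet> a n)" by (simp only: s(3))
    also have "\<dots> = e n \<bullet> a n" by (rule comp_eq_comp[OF K(1,3) s(5) K(4)])
    finally have "e' (Suc n) \<bullet> u' n = e' n" unfolding step(3)[OF n] .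
    moreover have "\<guillemotleft>e' n : K' n \<rightarrow> M\<guillemotright>" unfolding step(3)[OF n] by (rule arrow_comp[OF s(5) K(2)])
    ultimately show "K' n \<in> Ob T \<and> \<guillemotleft>u' n : K' n \<rightarrow> K' (Suc n)\<guillemotright> \<and> \<guillemotleft>e' n : K' n \<rightarrow> M\<guillemotright> \<and> e' (Suc n) \<bullet> u' n = e' n"
      using s(2) arrowD(1) by blast
  qed
qed

lemma koszul_systemD:
  assumes "koszul_system M s K u e" "M \<in> Ob T" "n \<ge> 1"
  shows "K n \<in> Ob T" "\<guillemotleft>u n : K n \<rightarrow> K (Suc n)\<guillemotright>" "\<guillemotleft>e n : K n \<rightarrow> M\<guillemotright>" "e (Suc n) \<bullet> u n = e n"
  using koszul_system_arrows[OF assms(2,1)] assms(3) by blast+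

lemma koszul_system_u: "\<lbrakk>koszul_system M s K u e; M \<in> Ob T\<rbrakk> \<Longrightarrow> \<forall>n\<ge>1. \<guillemotleft>u n : K n \<rightarrow> K (Suc n)\<guillemotright>"
  using koszul_systemD(2) by blast

lemma koszul_step_u: "koszul_step s K u K' a b u' \<Longrightarrow> \<forall>n\<ge>1. \<guillemotleft>u' n : K' n \<rightarrow> K' (Suc n)\<guillemotright>"
  using koszul_stepD(2) by blast

lemma koszul_system_exists:
  assumes M: "M \<in> Ob T"
  shows "s \<le> t \<Longrightarrow> \<exists>K u e. koszul_system M s K u e"
proof (induction s)
  case 0
  show ?case using koszul_system.base[of "\<lambda>_. M" M "\<lambda>_. Ident T M" "\<lambda>_. Ident T M"] by blast
next
  case (Suc s)
  then obtain K u e where sys: "koszul_system M s K u e" by auto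
  note D = koszul_systemD[OF sys M]
  have S: "Suc s \<in> {1..t}" using Suc by simp
  let ?S = "\<lambda>n. Sob (int n * d (Suc s)) (K n)"
  have "\<forall>n. \<exists>F a b. n \<ge> 1 \<longrightarrow> (F, K n, ?S n, a, xact (Suc s) n (K n), b) \<in> Exact T"
    using exact_fibre[OF xact_arrow[OF S D(1)]] by metis
  then obtain K' a b where ex: "\<And>n. n \<ge> 1 \<Longrightarrow> (K' n, K n, ?S n, a n, xact (Suc s) n (K n), b n) \<in> Exact T"
    by metis
  let ?g = "\<lambda>n. \<Phi> (d (Suc s)) (x (Suc s)) (Sob (int n * d (Suc s)) (K (Suc n))) \<bullet> Sh (int n * d (Suc s)) (u n)"
  have "\<exists>h. n \<ge> 1 \<longrightarrow> \<guillemotleft>h : K' n \<rightarrow> K' (Suc n)\<guillemotright> \<and> u n \<bullet> a n = a (Suc n) \<bullet> h \<and> Sh 1 h \<bullet> b n = b (Suc n) \<bullet> ?g n" for n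
  proof (cases "n \<ge> 1")
    case True
    have n': "Suc n \<ge> 1" by simp
    note u = D(2)[OF True] and K = D(1)[OF True] D(1)[OF n']
    have Su: "\<guillemotleft>Sh (int n * d (Suc s)) (u n) : ?S n \<rightarrow> Sob (int n * d (Suc s)) (K (Suc n))\<guillemotright>" by (rule Sh_arrow[OF u])
    have xa: "\<guillemotleft>\<Phi> (d (Suc s)) (x (Suc s)) (Sob (int n * d (Suc s)) (K (Suc n))) : Sob (int n * d (Suc s)) (K (Suc n)) \<rightarrow> ?S (Suc n)\<guillemotright>"
      using act_arrow[OF x_grading[OF S] Sob_closed[OF K(2)], of "int n * d (Suc s)"] K(2)
      by (simp add: Sob_add algebra_simps)
    have "?g n \<bullet> xact (Suc s) n (K n) = \<Phi> (d (Suc s)) (x (Suc s)) (Sob (int n * d (Suc s)) (K (Suc n))) \<bullet>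
        (Sh (int n * d (Suc s)) (u n) \<bullet> xact (Suc s) n (K n))"
      by (rule comp_assoc[OF xact_arrow[OF S K(1)] Su xa])
    also have "Sh (int n * d (Suc s)) (u n) \<bullet> xact (Suc s) n (K n) = xact (Suc s) n (K (Suc n)) \<bullet> u n"
      by (rule act_natural[OF pow_grading[OF S] u, symmetric])
    also have "\<Phi> (d (Suc s)) (x (Suc s)) (Sob (int n * d (Suc s)) (K (Suc n))) \<bullet> (xact (Suc s) n (K (Suc n)) \<bullet> u n) =
        xact (Suc s) (Suc n) (K (Suc n)) \<bullet> u n"
      by (rule comp_eq_comp[OF xact_arrow[OF S K(2)] xa u xact_Suc[OF S K(2), symmetric]])
    finally have eq: "?g n \<bullet> xact (Suc s) n (K n) = xact (Suc s) (Suc n) (K (Suc n)) \<bullet> u n" .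
    obtain h where "\<guillemotleft>h : K' n \<rightarrow> K' (Suc n)\<guillemotright>" "u n \<bullet> a n = a (Suc n) \<bullet> h" "Sh 1 h \<bullet> b n = b (Suc n) \<bullet> ?g n"
      by (rule exact_fill_fibre[OF ex[OF True] ex[OF n'] u arrow_comp[OF Su xa] eq])
    then show ?thesis by blast
  qed blast
  then obtain u' where u': "\<And>n. n \<ge> 1 \<Longrightarrow> \<guillemotleft>u' n : K' n \<rightarrow> K' (Suc n)\<guillemotright> \<and> u n \<bullet> a n = a (Suc n) \<bullet> u' n \<and>
    Sh 1 (u' n) \<bullet> b n = b (Suc n) \<bullet> ?g n" by metis
  have "koszul_step (Suc s) K u K' a b u'" unfolding koszul_step_def using ex u' by blast
  then have "koszul_system M (Suc s) K' u' (\<lambda>n. e n \<bullet> a n)" by (rule koszul_system.step[OF sys _ refl])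
  then show ?case by blast
qed

text \<open>The objects of the system are compact if \<open>M\<close> is, and powers of the \<open>x i\<close> annihilate them.\<close>

lemma koszul_system_compact:
  assumes M: "compact_object \<kappa> T M"
  shows "koszul_system M s K u e \<Longrightarrow> (\<forall>n\<ge>1. compact_object \<kappa> T (K n))"
proof (induction rule: koszul_system.induct)
  case (base K u e) then show ?case using M by simp
next
  case (step s K u e K' a b u' e')
  show ?case using compact_fibre[OF koszul_stepD(1)[OF step(2)]] compact_shift step(4) by blast
qed

lemma koszul_system_nilpotent:
  assumes M: "M \<in> Ob T"
  shows "koszul_system M s K u e \<Longrightarrow> s \<le> t \<Longrightarrow> (\<forall>n\<ge>1. \<forall>i\<in>{1..s}. nilpotent i (K n))"
proof (induction rule: koszul_system.induct)
  case (base K u e) then show ?case by simp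
next
  case (step s K u e K' a b u' e')
  show ?case
  proof (intro allI impI ballI)
    fix n :: nat and i assume n: "n \<ge> 1" and i: "i \<in> {1..Suc s}"
    have it: "i \<in> {1..t}" using i step(5) by simp
    note ex = koszul_stepD(1)[OF step(2) n]
    note K = koszul_systemD(1)[OF step(1) M n]
    show "nilpotent i (K' n)"
    proof (cases "i = Suc s")
      case True
      have "xkills i (n + n) (K' n)"
        using xkills_double[OF it kills_fibre_self[OF _ pow_grading[OF it]]] ex True by simp
      then show ?thesis unfolding nilpotent_def by blast
    next
      case False
      then have "nilpotent i (K n)" using step n i by simp
      then obtain N where N: "xkills i N (K n)" unfolding nilpotent_def by blast
      then have "xkills i N (Sob (int n * d (Suc s)) (K n))" using kills_shift[OF pow_grading[OF it] K] by blast
      then have "xkills i (N + N) (K' n)" by (rule xkills_double[OF it kills_fibre[OF ex pow_grading[OF it] N]])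
      then show ?thesis unfolding nilpotent_def by blast
    qed
  qed
qed

text \<open>If the \<open>N\<close>-th powers of the \<open>x i\<close> annihilate \<open>B\<close>, then a nonzero morphism to \<open>B\<close> stays nonzero
  when it is restricted along \<open>K N \<rightarrow> M\<close>: otherwise it would factor, in some stage, through the
  action of \<open>x s\<^sup>N\<close>, which is zero on \<open>B\<close>.\<close>

lemma koszul_system_orth:
  assumes M: "M \<in> Ob T" and N: "N \<ge> 1" and B: "B \<in> Ob T"
  shows "koszul_system M s K u e \<Longrightarrow> s \<le> t \<Longrightarrow> (\<And>i. i \<in> {1..s} \<Longrightarrow> xkills i N B) \<Longrightarrow> orth (K N) B \<Longrightarrow> orth M B"
proof (induction rule: koszul_system.induct)
  case (base K u e) then show ?case using N by simp
next
  case (step s K u e K' a b u' e')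
  have S: "Suc s \<in> {1..t}" using step by simp
  note ex = koszul_stepD(1)[OF step(2) N]
  note K = koszul_systemD(1)[OF step(1) M N]
  let ?e = "int N * d (Suc s)"
  have "orth (K N) B" unfolding orth_def
  proof (intro allI impI)
    fix f assume f: "\<guillemotleft>f : K N \<rightarrow> B\<guillemotright>"
    have "f \<bullet> a N = Zer T (K' N) B" by (rule orthD[OF step(7) arrow_comp[OF exact_arrows(1)[OF ex] f]])
    then obtain g where g: "\<guillemotleft>g : Sob ?e (K N) \<rightarrow> B\<guillemotright>" "g \<bullet> xact (Suc s) N (K N) = f" by (rule cohom_exact2[OF ex f])
    have "\<guillemotleft>g : Sob ?e (K N) \<rightarrow> Sob ?e (Sob (- ?e) B)\<guillemotright>" using g(1) B by (simp add: Sob_add Sob_0)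
    then obtain g' where g': "\<guillemotleft>g' : K N \<rightarrow> Sob (- ?e) B\<guillemotright>" "g = Sh ?e g'" by (rule Sh_surj[OF _ K Sob_closed[OF B]])
    have "xkills (Suc s) N (Sob (- ?e) B)" using kills_shift[OF pow_grading[OF S] B] step(6)[of "Suc s"] by simp
    then have "xact (Suc s) N (Sob (- ?e) B) \<bullet> g' = Zer T (K N) (Sob ?e (Sob (- ?e) B))"
      using kills_comp[OF pow_grading[OF S] _ g'(1)] by blast
    then show "f = Zer T (K N) B"
      using act_natural[OF pow_grading[OF S] g'(1)] g'(2) g(2) B by (simp add: Sob_add Sob_0)
  qed
  then show ?case using step by simp
qed


section \<open>Morphisms into a Koszul system\<close>

text \<open>The composite \<open>K n \<rightarrow> K (n + k)\<close> of transition morphisms.\<close>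

primrec trans where
  "trans K u n 0 = Ident T (K n)"
| "trans K u n (Suc k) = u (n + k) \<bullet> trans K u n k"

lemma trans_arrow:
  assumes all: "\<forall>n\<ge>1. \<guillemotleft>u n : K n \<rightarrow> K (Suc n)\<guillemotright>" and n: "n \<ge> (1::nat)"
  shows "\<guillemotleft>trans K u n k : K n \<rightarrow> K (n + k)\<guillemotright>"
proof (induction k)
  case 0 show ?case using arrow_ident[OF arrowD(1)[OF all[rule_format, OF n]]] by simp
next
  case (Suc k)
  have "\<guillemotleft>u (n + k) : K (n + k) \<rightarrow> K (Suc (n + k))\<guillemotright>" using all n by simp
  from arrow_comp[OF Suc this] show ?case by simp
qed

lemma trans_add:
  assumes u: "\<forall>n\<ge>1. \<guillemotleft>u n : K n \<rightarrow> K (Suc n)\<guillemotright>" and n: "n \<ge> (1::nat)"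
  shows "trans K u n (k + l) = trans K u (n + k) l \<bullet> trans K u n k"
proof (induction l)
  case 0 show ?case using ident_comp[OF trans_arrow[where K = K and u = u and k = k, OF u n]] by simp
next
  case (Suc l)
  have nk: "n + k \<ge> 1" "n + k + l \<ge> 1" using n by simp_all
  show ?case using Suc comp_assoc[OF trans_arrow[where K = K and u = u and k = k, OF u n] trans_arrow[where K = K and u = u and k = l, OF u nk(1)] u[rule_format, OF nk(2)]]
    by (simp add: add.assoc)
qed

lemma trans_augmentation:
  assumes sys: "koszul_system M s K u e" and M: "M \<in> Ob T" and n: "n \<ge> 1"
  shows "e (n + k) \<bullet> trans K u n k = e n"
proof (induction k)
  case 0 show ?case using comp_ident[OF koszul_systemD(3)[OF sys M n]] by simp
next
  case (Suc k)
  have nk: "n + k \<ge> 1" "Suc (n + k) \<ge> 1" using n by simp_all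
  note D = koszul_systemD[OF sys M]
  show ?case
    using comp_eq_comp[OF D(2)[OF nk(1)] D(3)[OF nk(2)] trans_arrow[where K = K and u = u, OF koszul_system_u[OF sys M] n] D(4)[OF nk(1)]] Suc by simp
qed

lemma trans_step:
  assumes sys: "koszul_system M s K u e" and M: "M \<in> Ob T" and st: "koszul_step (Suc s) K u K' a b u'" and n: "n \<ge> 1"
  shows "a (n + k) \<bullet> trans K' u' n k = trans K u n k \<bullet> a n"
proof (induction k)
  case 0 show ?case using comp_ident ident_comp koszul_stepD(5)[OF st n] by simp
next
  case (Suc k)
  have nk: "n + k \<ge> 1" "Suc (n + k) \<ge> 1" using n by simp_all
  note D = koszul_systemD[OF sys M]
  note S = koszul_stepD[OF st]
  note tr = trans_arrow[where K = K and u = u and k = k, OF koszul_system_u[OF sys M] n] and tr' = trans_arrow[where K = K' and u = u' and k = k, OF koszul_step_u[OF st] n]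
  have "a (Suc (n + k)) \<bullet> (u' (n + k) \<bullet> trans K' u' n k) = u (n + k) \<bullet> (a (n + k) \<bullet> trans K' u' n k)"
    by (rule square_comp[OF S(2)[OF nk(1)] S(5)[OF nk(2)] S(5)[OF nk(1)] D(2)[OF nk(1)] tr' S(3)[OF nk(1), symmetric]])
  also have "\<dots> = (u (n + k) \<bullet> trans K u n k) \<bullet> a n"
    unfolding Suc by (rule comp_assoc[OF S(5)[OF n] tr D(2)[OF nk(1)], symmetric])
  finally show ?case by simp
qed

text \<open>A morphism \<open>D \<rightarrow> K' m\<close> that vanishes in \<open>K m\<close> comes from the third term of the triangle, after
  suspension.  The transition morphisms between the third terms are composites with \<open>x s\<close>, so \<open>N\<close>
  of them annihilate it if the \<open>N\<close>-th power of \<open>x s\<close> annihilates \<open>D\<close>.\<close>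

lemma koszul_step_kills:
  assumes sys: "koszul_system M s K u e" and M: "M \<in> Ob T" and st: "koszul_step (Suc s) K u K' a b u'"
    and S: "Suc s \<in> {1..t}" and m: "m \<ge> 1" and g: "\<guillemotleft>g : D \<rightarrow> K' m\<guillemotright>" and ag: "a m \<bullet> g = Zer T D (K m)"
    and N: "xkills (Suc s) N D"
  shows "trans K' u' m N \<bullet> g = Zer T D (K' (m + N))"
proof -
  let ?d = "d (Suc s)" and ?x = "x (Suc s)" and ?E = "Sob 1 D"
  note D = koszul_systemD[OF sys M]
  note St = koszul_stepD[OF st]
  have DO: "D \<in> Ob T" and EO: "?E \<in> Ob T" using arrowD(1)[OF g] Sob_closed by blast+
  note tr' = trans_arrow[where K = K' and u = u', OF koszul_step_u[OF st] m]
  have K': "K' n \<in> Ob T" if "n \<ge> 1" for n using arrowD(1)[OF St(2)[OF that]] .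
  have b: "\<guillemotleft>b n : Sob (int n * ?d) (K n) \<rightarrow> Sob 1 (K' n)\<guillemotright>" if "n \<ge> 1" for n
    by (rule exact_arrows(3)[OF St(1)[OF that]])
  have "\<exists>h. \<guillemotleft>h : Sob (int j * ?d) ?E \<rightarrow> Sob (int (m + j) * ?d) (K (m + j))\<guillemotright> \<and>
      Sh 1 (trans K' u' m j \<bullet> g) = b (m + j) \<bullet> (h \<bullet> xact (Suc s) j ?E)" for j
  proof (induction j)
    case 0
    have "Sh 1 (a m) \<bullet> Sh 1 g = Sh 1 (a m \<bullet> g)" using St(5)[OF m] g by (simp add: arrow_iff Sh_comp)
    also have "\<dots> = Zer T ?E (Sob 1 (K m))" unfolding ag by (rule Sh_Zer[OF DO D(1)[OF m]])
    finally obtain h where h: "\<guillemotleft>h : ?E \<rightarrow> Sob (int m * ?d) (K m)\<guillemotright>" "b m \<bullet> h = Sh 1 g"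
      by (rule hom_exact1[OF St(1)[OF m] Sh_arrow[OF g]])
    have "xact (Suc s) 0 ?E = Ident T ?E" using action_one[OF EO] by simp
    then show ?case using h comp_ident[OF h(1)] ident_comp[OF g] by (intro exI[of _ h]) (simp add: Sob_0)
  next
    case (Suc j)
    then obtain h where h: "\<guillemotleft>h : Sob (int j * ?d) ?E \<rightarrow> Sob (int (m + j) * ?d) (K (m + j))\<guillemotright>"
      "Sh 1 (trans K' u' m j \<bullet> g) = b (m + j) \<bullet> (h \<bullet> xact (Suc s) j ?E)" by blast
    let ?n = "m + j"
    let ?y = "xact (Suc s) j ?E"
    have n: "?n \<ge> 1" "Suc ?n \<ge> 1" using m by simp_all
    note y = xact_arrow[OF S EO, of j]
    note u = D(2)[OF n(1)] and u' = St(2)[OF n(1)] and K = D(1)[OF n(1)] D(1)[OF n(2)]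
    have Su: "\<guillemotleft>Sh (int ?n * ?d) (u ?n) : Sob (int ?n * ?d) (K ?n) \<rightarrow> Sob (int ?n * ?d) (K (Suc ?n))\<guillemotright>" by (rule Sh_arrow[OF u])
    define q where "q = Sh (int ?n * ?d) (u ?n) \<bullet> h"
    have q: "\<guillemotleft>q : Sob (int j * ?d) ?E \<rightarrow> Sob (int ?n * ?d) (K (Suc ?n))\<guillemotright>" unfolding q_def by (rule arrow_comp[OF h(1) Su])
    let ?\<xi> = "\<Phi> ?d ?x (Sob (int ?n * ?d) (K (Suc ?n)))"
    have \<xi>: "\<guillemotleft>?\<xi> : Sob (int ?n * ?d) (K (Suc ?n)) \<rightarrow> Sob (int (Suc ?n) * ?d) (K (Suc ?n))\<guillemotright>"
      using act_arrow[OF x_grading[OF S] Sob_closed[OF K(2)], of "int ?n * ?d"] K(2) by (simp add: Sob_add algebra_simps)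
    have \<eta>: "\<guillemotleft>\<Phi> ?d ?x (Sob (int j * ?d) ?E) : Sob (int j * ?d) ?E \<rightarrow> Sob (int (Suc j) * ?d) ?E\<guillemotright>"
      using act_arrow[OF x_grading[OF S] Sob_closed[OF EO], of "int j * ?d"] EO by (simp add: Sob_add algebra_simps)
    have Sq: "\<guillemotleft>Sh ?d q : Sob (int (Suc j) * ?d) ?E \<rightarrow> Sob (int (Suc ?n) * ?d) (K (Suc ?n))\<guillemotright>"
      using Sh_arrow[OF q, of ?d] EO K(2) by (simp add: Sob_add algebra_simps)
    note tg = arrow_comp[OF g tr'[where k = j]]
    have "trans K' u' m (Suc j) \<bullet> g = u' ?n \<bullet> (trans K' u' m j \<bullet> g)"
      using comp_assoc[OF g tr'[where k = j] u'] by simp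
    then have "Sh 1 (trans K' u' m (Suc j) \<bullet> g) = Sh 1 (u' ?n) \<bullet> Sh 1 (trans K' u' m j \<bullet> g)"
      using tg u' by (simp only: arrow_iff Sh_comp)
    also have "\<dots> = Sh 1 (u' ?n) \<bullet> (b ?n \<bullet> (h \<bullet> ?y))" by (simp only: h(2))
    also have "\<dots> = b (Suc ?n) \<bullet> ((?\<xi> \<bullet> Sh (int ?n * ?d) (u ?n)) \<bullet> (h \<bullet> ?y))"
      by (rule square_comp[OF b[OF n(1)] Sh_arrow[OF u'] arrow_comp[OF Su \<xi>] b[OF n(2)] arrow_comp[OF y h(1)] St(4)[OF n(1)]])
    also have "(?\<xi> \<bullet> Sh (int ?n * ?d) (u ?n)) \<bullet> (h \<bullet> ?y) = ?\<xi> \<bullet> (q \<bullet> ?y)"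
      unfolding q_def comp_assoc[OF arrow_comp[OF y h(1)] Su \<xi>] comp_assoc[OF y h(1) Su] ..
    also have "\<dots> = Sh ?d q \<bullet> (\<Phi> ?d ?x (Sob (int j * ?d) ?E) \<bullet> ?y)"
      by (rule square_comp[OF q \<xi> \<eta> Sq y act_natural[OF x_grading[OF S] q]])
    also have "\<Phi> ?d ?x (Sob (int j * ?d) ?E) \<bullet> ?y = xact (Suc s) (Suc j) ?E" by (rule xact_Suc[OF S EO, symmetric])
    finally show ?case using Sq by (intro exI[of _ "Sh ?d q"]) simp
  qed
  then obtain h where h: "\<guillemotleft>h : Sob (int N * ?d) ?E \<rightarrow> Sob (int (m + N) * ?d) (K (m + N))\<guillemotright>"
    "Sh 1 (trans K' u' m N \<bullet> g) = b (m + N) \<bullet> (h \<bullet> xact (Suc s) N ?E)" by blast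
  have mN: "m + N \<ge> 1" using m by simp
  have "xkills (Suc s) N ?E" using kills_shift[OF pow_grading[OF S] DO] N by blast
  then have "xact (Suc s) N ?E = Zer T ?E (Sob (int N * ?d) ?E)" by (simp only: kills_def)
  then have "Sh 1 (trans K' u' m N \<bullet> g) = Zer T ?E (Sob 1 (K' (m + N)))"
    using h(2) comp_zero[OF h(1) EO] comp_zero[OF b[OF mN] EO] by simp
  then show ?thesis using Sh_zero_iff[OF arrow_comp[OF g tr'[where k = N]]] by blast
qed

text \<open>If the \<open>x i\<close> act nilpotently on \<open>D\<close>, then \<open>Hom(D, M)\<close> is the colimit of the groups
  \<open>Hom(D, K n)\<close>: surjectivity and injectivity of the canonical map, in terms of elements.\<close>

lemma koszul_system_hom:
  assumes M: "M \<in> Ob T" and D: "D \<in> Ob T"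
  shows "koszul_system M s K u e \<Longrightarrow> s \<le> t \<Longrightarrow> (\<And>i. i \<in> {1..s} \<Longrightarrow> nilpotent i D) \<Longrightarrow>
    (\<forall>f. \<guillemotleft>f : D \<rightarrow> M\<guillemotright> \<longrightarrow> (\<exists>n\<ge>1. \<exists>g. \<guillemotleft>g : D \<rightarrow> K n\<guillemotright> \<and> e n \<bullet> g = f)) \<and>
    (\<forall>n\<ge>1. \<forall>g. \<guillemotleft>g : D \<rightarrow> K n\<guillemotright> \<and> e n \<bullet> g = Zer T D M \<longrightarrow> (\<exists>k. trans K u n k \<bullet> g = Zer T D (K (n + k))))"
proof (induction rule: koszul_system.induct)
  case (base K u e)
  have 1: "\<exists>n\<ge>1. \<exists>g. \<guillemotleft>g : D \<rightarrow> K n\<guillemotright> \<and> e n \<bullet> g = f" if "\<guillemotleft>f : D \<rightarrow> M\<guillemotright>" for f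
    using base(1)[of 1] ident_comp[OF that] that by (intro exI[of _ 1] conjI exI[of _ f]) auto
  have 2: "\<exists>k. trans K u n k \<bullet> g = Zer T D (K (n + k))"
    if "n \<ge> 1" "\<guillemotleft>g : D \<rightarrow> K n\<guillemotright>" "e n \<bullet> g = Zer T D M" for n g
    using base(1)[of n] that by (intro exI[of _ 0]) auto
  show ?case using 1 2 by blast
next
  case (step s K u e K' a b u' e')
  have S: "Suc s \<in> {1..t}" using step by simp
  note ar = koszul_systemD[OF step(1) M]
  note St = koszul_stepD[OF step(2)]
  have IH1: "\<exists>n\<ge>1. \<exists>g. \<guillemotleft>g : D \<rightarrow> K n\<guillemotright> \<and> e n \<bullet> g = f" if "\<guillemotleft>f : D \<rightarrow> M\<guillemotright>" for f
    using step.IH step.prems that by simp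
  have IH2: "\<exists>k. trans K u n k \<bullet> g = Zer T D (K (n + k))" if "n \<ge> 1" "\<guillemotleft>g : D \<rightarrow> K n\<guillemotright>" "e n \<bullet> g = Zer T D M" for n g
    using step.IH step.prems that by simp
  have "nilpotent (Suc s) D" using step.prems by simp
  then obtain N where N: "xkills (Suc s) N D" unfolding nilpotent_def by blast
  have 1: "\<exists>n\<ge>1. \<exists>g. \<guillemotleft>g : D \<rightarrow> K' n\<guillemotright> \<and> e' n \<bullet> g = f" if f: "\<guillemotleft>f : D \<rightarrow> M\<guillemotright>" for f
  proof -
    obtain n g where n: "n \<ge> 1" and g: "\<guillemotleft>g : D \<rightarrow> K n\<guillemotright>" "e n \<bullet> g = f" using IH1[OF f] by blast
    note tr = trans_arrow[where K = K and u = u and k = N, OF koszul_system_u[OF step(1) M] n]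
    have m: "n + N \<ge> 1" using n by simp
    have "xkills (Suc s) (n + N) D" by (rule xkills_mono[OF S D N]) simp
    then have "xact (Suc s) (n + N) (K (n + N)) \<bullet> (trans K u n N \<bullet> g) = Zer T D (Sob (int (n + N) * d (Suc s)) (K (n + N)))"
      by (rule kills_source[OF pow_grading[OF S] _ arrow_comp[OF g(1) tr]])
    then obtain g' where g': "\<guillemotleft>g' : D \<rightarrow> K' (n + N)\<guillemotright>" "a (n + N) \<bullet> g' = trans K u n N \<bullet> g"
      by (rule hom_exact2[OF St(1)[OF m] arrow_comp[OF g(1) tr]])
    have "e' (n + N) \<bullet> g' = e (n + N) \<bullet> (a (n + N) \<bullet> g')"
      unfolding step(3)[OF m] by (rule comp_assoc[OF g'(1) St(5)[OF m] ar(3)[OF m]])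
    also have "\<dots> = e (n + N) \<bullet> (trans K u n N \<bullet> g)" by (simp only: g'(2))
    also have "\<dots> = e n \<bullet> g" by (rule comp_eq_comp[OF tr ar(3)[OF m] g(1) trans_augmentation[OF step(1) M n]])
    finally show ?thesis using g(2) g'(1) m by blast
  qed
  have 2: "\<exists>k. trans K' u' n k \<bullet> g = Zer T D (K' (n + k))"
    if n: "n \<ge> 1" and g: "\<guillemotleft>g : D \<rightarrow> K' n\<guillemotright>" and eg: "e' n \<bullet> g = Zer T D M" for n g
  proof -
    note ag = arrow_comp[OF g St(5)[OF n]]
    have "e n \<bullet> (a n \<bullet> g) = Zer T D M"
      using comp_assoc[OF g St(5)[OF n] ar(3)[OF n]] eg step(3)[OF n] by simp
    then obtain k where k: "trans K u n k \<bullet> (a n \<bullet> g) = Zer T D (K (n + k))" using IH2[OF n ag] by blast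
    have m: "n + k \<ge> 1" using n by simp
    note tr' = trans_arrow[where K = K' and u = u' and k = k, OF koszul_step_u[OF step(2)] n] and tr = trans_arrow[where K = K and u = u and k = k, OF koszul_system_u[OF step(1) M] n]
    have "a (n + k) \<bullet> (trans K' u' n k \<bullet> g) = trans K u n k \<bullet> (a n \<bullet> g)"
      by (rule square_comp[OF tr' St(5)[OF m] St(5)[OF n] tr g trans_step[OF step(1) M step(2) n]])
    then have "a (n + k) \<bullet> (trans K' u' n k \<bullet> g) = Zer T D (K (n + k))" unfolding k .
    then have "trans K' u' (n + k) N \<bullet> (trans K' u' n k \<bullet> g) = Zer T D (K' (n + k + N))"
      by (rule koszul_step_kills[OF step(1) M step(2) S m arrow_comp[OF g tr'] _ N])
    then have "trans K' u' n (k + N) \<bullet> g = Zer T D (K' (n + (k + N)))"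
      using trans_add[where K = K' and u = u' and k = k and l = N, OF koszul_step_u[OF step(2)] n] comp_assoc[OF g tr' trans_arrow[where K = K' and u = u' and k = N, OF koszul_step_u[OF step(2)] m]] by (simp add: add.assoc)
    then show ?thesis by blast
  qed
  show ?case using 1 2 by blast
qed


section \<open>The homotopy colimit of a Koszul system\<close>

text \<open>For compact \<open>D\<close>, the group \<open>Hom(D, H)\<close> is the colimit of the groups \<open>Hom(D, K n)\<close>.\<close>

lemma koszul_hocolim:
  fixes \<kappa> :: "'i rel"
  assumes \<kappa>: "uncountable_cardinal \<kappa>" and M: "M \<in> Ob T" and sys: "koszul_system M t K u e"
    and H: "is_hocolim T K u H"
  shows "\<exists>\<phi>. \<guillemotleft>\<phi> : H \<rightarrow> M\<guillemotright> \<and>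
    (\<forall>D. compact_object \<kappa> T D \<and> (\<forall>i\<in>{1..t}. nilpotent i D) \<longrightarrow> hom_bij \<phi> H M D)"
proof -
  obtain P \<iota> \<sigma> p q where cp: "is_coproduct T {1..} K P \<iota>" and \<sigma>H: "\<sigma> \<in> Hom T P P"
    and \<sigma>\<iota>: "\<And>n. n \<ge> 1 \<Longrightarrow> \<sigma> \<bullet> \<iota> n = \<iota> (Suc n) \<bullet> u n"
    and ex: "(P, P, H, Ident T P \<boxplus> Neg T P P \<sigma>, p, q) \<in> Exact T"
    using H unfolding is_hocolim_def by auto
  note ar = koszul_systemD[OF sys M]
  have P: "P \<in> Ob T" by (rule coproduct_arrow(1)[OF cp])
  have \<sigma>: "\<guillemotleft>\<sigma> : P \<rightarrow> P\<guillemotright>" by (rule arrowI[OF P P \<sigma>H])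
  have \<iota>: "\<guillemotleft>\<iota> n : K n \<rightarrow> P\<guillemotright>" if "n \<ge> 1" for n using coproduct_arrow(3)[OF cp] that by simp
  let ?\<delta> = "Ident T P \<boxplus> Neg T P P \<sigma>"
  note exa = exact_arrows[OF ex]
  note idP = arrow_ident[OF P]
  have \<delta>: "?\<delta> \<bullet> f = f \<boxplus> Neg T D P (\<sigma> \<bullet> f)" if f: "\<guillemotleft>f : D \<rightarrow> P\<guillemotright>" for f D
    using add_comp[OF f idP arrow_neg[OF \<sigma>]] ident_comp[OF f] neg_comp[OF f \<sigma>] by simp
  obtain \<epsilon> where \<epsilon>: "\<guillemotleft>\<epsilon> : P \<rightarrow> M\<guillemotright>" "\<And>n. n \<in> {1..} \<Longrightarrow> \<epsilon> \<bullet> \<iota> n = e n"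
    using coproduct_desc[OF cp M, where h = e] ar(3) by auto
  have "\<epsilon> \<bullet> \<sigma> = \<epsilon>"
  proof (rule coproduct_ext[OF cp arrow_comp[OF \<sigma> \<epsilon>(1)] \<epsilon>(1)])
    fix n :: nat assume "n \<in> {1..}"
    then have n: "n \<ge> 1" by simp
    have n': "Suc n \<ge> 1" by simp
    have "(\<epsilon> \<bullet> \<sigma>) \<bullet> \<iota> n = \<epsilon> \<bullet> (\<iota> (Suc n) \<bullet> u n)" using comp_assoc[OF \<iota>[OF n] \<sigma> \<epsilon>(1)] \<sigma>\<iota>[OF n] by simp
    also have "\<dots> = e (Suc n) \<bullet> u n" by (rule comp_eq_comp[OF \<iota>[OF n'] \<epsilon>(1) ar(2)[OF n]]) (simp add: \<epsilon>(2))
    also have "\<dots> = \<epsilon> \<bullet> \<iota> n" using ar(4)[OF n] \<epsilon>(2) n by simp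
    finally show "(\<epsilon> \<bullet> \<sigma>) \<bullet> \<iota> n = \<epsilon> \<bullet> \<iota> n" .
  qed
  then have "\<epsilon> \<bullet> ?\<delta> = Zer T P M"
    using comp_diff_zero[OF idP \<sigma> \<epsilon>(1)] comp_ident[OF \<epsilon>(1)] by simp
  then obtain \<phi> where \<phi>: "\<guillemotleft>\<phi> : H \<rightarrow> M\<guillemotright>" "\<phi> \<bullet> p = \<epsilon>" by (rule cohom_exact2[OF ex \<epsilon>(1)])
  obtain \<pi> where \<pi>: "\<And>i. i \<in> {1..} \<Longrightarrow> \<guillemotleft>\<pi> i : P \<rightarrow> K i\<guillemotright>" "\<And>i. i \<in> {1..} \<Longrightarrow> \<pi> i \<bullet> \<iota> i = Ident T (K i)"
    "\<And>i j. \<lbrakk>i \<in> {1..}; j \<in> {1..}; i \<noteq> j\<rbrakk> \<Longrightarrow> \<pi> i \<bullet> \<iota> j = Zer T (K j) (K i)"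
    using coproduct_proj[OF cp] by metis
  have \<pi>a: "\<guillemotleft>\<pi> n : P \<rightarrow> K n\<guillemotright>" if "n \<ge> 1" for n using \<pi>(1) that by simp
  have KO: "K n \<in> Ob T" if "n \<ge> 1" for n using ar(1)[OF that] .
  have \<pi>\<sigma>1: "\<pi> 1 \<bullet> \<sigma> = Zer T P (K 1)"
  proof (rule coproduct_ext[OF cp arrow_comp[OF \<sigma> \<pi>a] arrow_zero[OF P KO]])
    fix n :: nat assume "n \<in> {1..}"
    then have n: "n \<ge> 1" "Suc n \<ge> 1" by simp_all
    have 1: "(1::nat) \<ge> 1" by simp
    have "(\<pi> 1 \<bullet> \<sigma>) \<bullet> \<iota> n = \<pi> 1 \<bullet> (\<iota> (Suc n) \<bullet> u n)" using comp_assoc[OF \<iota>[OF n(1)] \<sigma> \<pi>a[OF 1]] \<sigma>\<iota>[OF n(1)] by simp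
    also have "\<dots> = Zer T (K (Suc n)) (K 1) \<bullet> u n"
      by (rule comp_eq_comp[OF \<iota>[OF n(2)] \<pi>a[OF 1] ar(2)[OF n(1)]]) (use \<pi>(3)[of 1 "Suc n"] n in simp)
    also have "\<dots> = Zer T P (K 1) \<bullet> \<iota> n"
      using zero_comp[OF ar(2)[OF n(1)] KO[OF 1]] zero_comp[OF \<iota>[OF n(1)] KO[OF 1]] by simp
    finally show "(\<pi> 1 \<bullet> \<sigma>) \<bullet> \<iota> n = Zer T P (K 1) \<bullet> \<iota> n" .
  qed simp_all
  have \<pi>\<sigma>: "\<pi> (Suc m) \<bullet> \<sigma> = u m \<bullet> \<pi> m" if m: "m \<ge> 1" for m
  proof -
    have m': "Suc m \<ge> 1" by simp
    show ?thesis
    proof (rule coproduct_ext[OF cp arrow_comp[OF \<sigma> \<pi>a[OF m']] arrow_comp[OF \<pi>a[OF m] ar(2)[OF m]]])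
      fix n :: nat assume "n \<in> {1..}"
      then have n: "n \<ge> 1" "Suc n \<ge> 1" by simp_all
      have "(\<pi> (Suc m) \<bullet> \<sigma>) \<bullet> \<iota> n = \<pi> (Suc m) \<bullet> (\<iota> (Suc n) \<bullet> u n)"
        using comp_assoc[OF \<iota>[OF n(1)] \<sigma> \<pi>a[OF m']] \<sigma>\<iota>[OF n(1)] by simp
      also have "\<dots> = (\<pi> (Suc m) \<bullet> \<iota> (Suc n)) \<bullet> u n" by (rule comp_assoc[OF ar(2)[OF n(1)] \<iota>[OF n(2)] \<pi>a[OF m'], symmetric])
      also have "\<dots> = u m \<bullet> (\<pi> m \<bullet> \<iota> n)"
      proof (cases "n = m")
        case True
        then show ?thesis using \<pi>(2)[of m] \<pi>(2)[of "Suc m"] m ident_comp[OF ar(2)[OF m]] comp_ident[OF ar(2)[OF m]] by simp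
      next
        case False
        then show ?thesis using \<pi>(3)[of m n] \<pi>(3)[of "Suc m" "Suc n"] m n zero_comp[OF ar(2)[OF n(1)] KO[OF m']]
          comp_zero[OF ar(2)[OF m] KO[OF n(1)]] by simp
      qed
      also have "\<dots> = (u m \<bullet> \<pi> m) \<bullet> \<iota> n" by (rule comp_assoc[OF \<iota>[OF n(1)] \<pi>a[OF m] ar(2)[OF m], symmetric])
      finally show "(\<pi> (Suc m) \<bullet> \<sigma>) \<bullet> \<iota> n = (u m \<bullet> \<pi> m) \<bullet> \<iota> n" .
    qed
  qed
  \<comment> \<open>On compact objects \<open>id - \<sigma>\<close> is injective: the components vanish one after the other.\<close>
  have \<delta>_inj: "f = Zer T D P" if D: "compact_object \<kappa> T D" and f: "\<guillemotleft>f : D \<rightarrow> P\<guillemotright>" and 0: "?\<delta> \<bullet> f = Zer T D P" for f D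
  proof -
    have DO: "D \<in> Ob T" by (rule arrowD(1)[OF f])
    have sf: "f = \<sigma> \<bullet> f" by (rule diff_zero[OF f arrow_comp[OF f \<sigma>]]) (use 0 \<delta>[OF f] in simp)
    have "\<pi> (Suc n) \<bullet> f = Zer T D (K (Suc n))" for n
    proof (induction n)
      case 0
      have "\<pi> 1 \<bullet> (\<sigma> \<bullet> f) = Zer T P (K 1) \<bullet> f" by (rule comp_eq_comp[OF \<sigma> \<pi>a f \<pi>\<sigma>1]) simp
      also have "\<dots> = Zer T D (K 1)" by (rule zero_comp[OF f KO]) simp
      finally show ?case unfolding sf[symmetric] by simp
    next
      case (Suc n)
      have n: "Suc n \<ge> 1" "Suc (Suc n) \<ge> 1" by simp_all
      have "\<pi> (Suc (Suc n)) \<bullet> (\<sigma> \<bullet> f) = u (Suc n) \<bullet> (\<pi> (Suc n) \<bullet> f)"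
        by (rule square_comp[OF \<sigma> \<pi>a[OF n(2)] \<pi>a[OF n(1)] ar(2)[OF n(1)] f \<pi>\<sigma>[OF n(1)]])
      also have "\<dots> = Zer T D (K (Suc (Suc n)))" unfolding Suc by (rule comp_zero[OF ar(2)[OF n(1)] DO])
      finally show ?case unfolding sf[symmetric] .
    qed
    then have all0: "\<forall>i\<in>{1..}. \<pi> i \<bullet> f = Zer T D (K i)" by (metis One_nat_def Suc_le_D atLeast_iff)
    show ?thesis by (rule finite_sum_eq_zero[OF cp \<pi> compact_nat[OF \<kappa> D cp f] DO all0])
  qed
  \<comment> \<open>In \<open>H\<close>, a morphism to \<open>K n\<close> agrees with its images in later stages of the system.\<close>
  have p\<iota>: "p \<bullet> (\<iota> n \<bullet> g) = p \<bullet> (\<iota> (n + k) \<bullet> (trans K u n k \<bullet> g))" if n: "n \<ge> 1" and g: "\<guillemotleft>g : D \<rightarrow> K n\<guillemotright>" for n g D k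
  proof (induction k)
    case 0 show ?case using ident_comp[OF g] by simp
  next
    case (Suc k)
    have nk: "n + k \<ge> 1" "Suc (n + k) \<ge> 1" using n by simp_all
    note tg = arrow_comp[OF g trans_arrow[where K = K and u = u and k = k, OF koszul_system_u[OF sys M] n]]
    define h where "h = \<iota> (n + k) \<bullet> (trans K u n k \<bullet> g)"
    have h: "\<guillemotleft>h : D \<rightarrow> P\<guillemotright>" unfolding h_def by (rule arrow_comp[OF tg \<iota>[OF nk(1)]])
    have "p \<bullet> (?\<delta> \<bullet> h) = Zer T D H"
      using comp_eq_comp[OF exa(1,2) h exact_comp_zero[OF ex]] zero_comp[OF h arrowD(2)[OF exa(2)]] by simp
    then have "(p \<bullet> h) \<boxplus> Neg T D H (p \<bullet> (\<sigma> \<bullet> h)) = Zer T D H"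
      unfolding \<delta>[OF h] using comp_add[OF h arrow_neg[OF arrow_comp[OF h \<sigma>]] exa(2)] comp_neg[OF arrow_comp[OF h \<sigma>] exa(2)] by simp
    then have "p \<bullet> h = p \<bullet> (\<sigma> \<bullet> h)"
      by (rule diff_zero[OF arrow_comp[OF h exa(2)] arrow_comp[OF arrow_comp[OF h \<sigma>] exa(2)]])
    also have "\<sigma> \<bullet> h = \<iota> (Suc (n + k)) \<bullet> (u (n + k) \<bullet> (trans K u n k \<bullet> g))" unfolding h_def
      by (rule square_comp[OF \<iota>[OF nk(1)] \<sigma> ar(2)[OF nk(1)] \<iota>[OF nk(2)] tg \<sigma>\<iota>[OF nk(1)]])
    also have "u (n + k) \<bullet> (trans K u n k \<bullet> g) = trans K u n (Suc k) \<bullet> g"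
      using comp_assoc[OF g trans_arrow[where K = K and u = u and k = k, OF koszul_system_u[OF sys M] n] ar(2)[OF nk(1)]] by simp
    finally show ?case using Suc unfolding h_def by simp
  qed
  have "hom_bij \<phi> H M D" if D: "compact_object \<kappa> T D" and nil: "\<forall>i\<in>{1..t}. nilpotent i D" for D
  proof -
    have DO: "D \<in> Ob T" by (rule compactD(1)[OF D])
    have hom: "\<exists>n\<ge>1. \<exists>g. \<guillemotleft>g : D \<rightarrow> K n\<guillemotright> \<and> e n \<bullet> g = f" if "\<guillemotleft>f : D \<rightarrow> M\<guillemotright>" for f
      using koszul_system_hom[OF M DO sys order_refl] nil that by blast
    have hom0: "\<exists>k. trans K u n k \<bullet> g = Zer T D (K (n + k))"
      if "n \<ge> 1" "\<guillemotleft>g : D \<rightarrow> K n\<guillemotright>" "e n \<bullet> g = Zer T D M" for n g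
      using koszul_system_hom[OF M DO sys order_refl] nil that by blast
    have \<phi>p\<iota>: "\<phi> \<bullet> (p \<bullet> (\<iota> n \<bullet> g)) = e n \<bullet> g" if n: "n \<ge> 1" and g: "\<guillemotleft>g : D \<rightarrow> K n\<guillemotright>" for n g
    proof -
      have "\<phi> \<bullet> (p \<bullet> (\<iota> n \<bullet> g)) = \<epsilon> \<bullet> (\<iota> n \<bullet> g)" by (rule comp_eq_comp[OF exa(2) \<phi>(1) arrow_comp[OF g \<iota>[OF n]] \<phi>(2)])
      also have "\<dots> = e n \<bullet> g" by (rule comp_eq_comp[OF \<iota>[OF n] \<epsilon>(1) g]) (use \<epsilon>(2) n in simp)
      finally show ?thesis .
    qed
    show ?thesis
      unfolding hom_bij_def
    proof (intro conjI allI impI)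
      fix f assume "\<guillemotleft>f : D \<rightarrow> M\<guillemotright>"
      then obtain n g where n: "n \<ge> 1" and g: "\<guillemotleft>g : D \<rightarrow> K n\<guillemotright>" "e n \<bullet> g = f" using hom by blast
      then show "\<exists>g. \<guillemotleft>g : D \<rightarrow> H\<guillemotright> \<and> \<phi> \<bullet> g = f"
        using \<phi>p\<iota>[OF n g(1)] arrow_comp[OF arrow_comp[OF g(1) \<iota>[OF n]] exa(2)] by blast
    next
      fix h assume "\<guillemotleft>h : D \<rightarrow> H\<guillemotright> \<and> \<phi> \<bullet> h = Zer T D M"
      then have h: "\<guillemotleft>h : D \<rightarrow> H\<guillemotright>" and \<phi>h: "\<phi> \<bullet> h = Zer T D M" by blast+
      note qh = arrow_comp[OF h exa(3)]
      have "q \<bullet> h = Zer T D (Sob 1 P)"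
      proof -
        have DD: "Sob 1 (Sob (-1) D) = D" using DO by (simp add: Sob_add Sob_0)
        have "\<guillemotleft>q \<bullet> h : Sob 1 (Sob (-1) D) \<rightarrow> Sob 1 P\<guillemotright>" unfolding DD by (rule qh)
        then obtain k where k: "\<guillemotleft>k : Sob (-1) D \<rightarrow> P\<guillemotright>" "q \<bullet> h = Sh 1 k" by (rule Sh_surj[OF _ Sob_closed[OF DO] P])
        have "Sh 1 (?\<delta> \<bullet> k) = Sh 1 ?\<delta> \<bullet> (q \<bullet> h)" using k exa(1) by (simp add: arrow_iff Sh_comp)
        also have "\<dots> = Zer T (Sob 1 (Sob (-1) D)) (Sob 1 P)" unfolding DD
          using comp_eq_comp[OF exa(3) Sh_arrow[OF exa(1)] h exact_comp_zero3[OF ex]] zero_comp[OF h Sob_closed[OF P]] by simp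
        finally have "?\<delta> \<bullet> k = Zer T (Sob (-1) D) P" using Sh_zero_iff[OF arrow_comp[OF k(1) exa(1)]] by blast
        then have "k = Zer T (Sob (-1) D) P" by (rule \<delta>_inj[OF compact_shift[OF D] k(1)])
        then show ?thesis using k(2) Sh_Zer[OF Sob_closed[OF DO] P, of 1] DD by simp
      qed
      then obtain l where l: "\<guillemotleft>l : D \<rightarrow> P\<guillemotright>" "p \<bullet> l = h" by (rule hom_exact3[OF ex h])
      have "\<exists>n\<ge>1. \<exists>g. \<guillemotleft>g : D \<rightarrow> K n\<guillemotright> \<and> p \<bullet> l = p \<bullet> (\<iota> n \<bullet> g)"
        using compact_nat[OF \<kappa> D cp l(1)]
      proof (induction rule: finite_sum.induct)
        case zero
        have 1: "(1::nat) \<ge> 1" by simp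
        then show ?case using arrow_zero[OF DO KO[OF 1]] comp_zero[OF \<iota>[OF 1] DO] by (metis)
      next
        case (step i g f)
        then obtain n g' where n: "n \<ge> 1" and g': "\<guillemotleft>g' : D \<rightarrow> K n\<guillemotright>" "p \<bullet> f = p \<bullet> (\<iota> n \<bullet> g')" by blast
        have i: "i \<ge> 1" using step(1) by simp
        have m: "i + n \<ge> 1" using i by simp
        have f: "\<guillemotleft>f : D \<rightarrow> P\<guillemotright>" by (rule finite_sum_arrow[OF cp DO step(3)])
        define g1 where "g1 = trans K u i n \<bullet> g"
        define g2 where "g2 = trans K u n i \<bullet> g'"
        have g1: "\<guillemotleft>g1 : D \<rightarrow> K (i + n)\<guillemotright>" unfolding g1_def by (rule arrow_comp[OF step(2) trans_arrow[where K = K and u = u, OF koszul_system_u[OF sys M] i]])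
        have g2: "\<guillemotleft>g2 : D \<rightarrow> K (i + n)\<guillemotright>"
          unfolding g2_def using arrow_comp[OF g'(1) trans_arrow[where K = K and u = u and k = i, OF koszul_system_u[OF sys M] n]] by (simp add: add.commute)
        have "p \<bullet> ((\<iota> i \<bullet> g) \<boxplus> f) = (p \<bullet> (\<iota> i \<bullet> g)) \<boxplus> (p \<bullet> f)"
          by (rule comp_add[OF arrow_comp[OF step(2) \<iota>[OF i]] f exa(2)])
        also have "p \<bullet> (\<iota> i \<bullet> g) = p \<bullet> (\<iota> (i + n) \<bullet> g1)" unfolding g1_def by (rule p\<iota>[OF i step(2)])
        also have "p \<bullet> f = p \<bullet> (\<iota> (i + n) \<bullet> g2)"
          unfolding g2_def g'(2) using p\<iota>[OF n g'(1), of i] by (simp add: add.commute)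
        also have "(p \<bullet> (\<iota> (i + n) \<bullet> g1)) \<boxplus> (p \<bullet> (\<iota> (i + n) \<bullet> g2)) = p \<bullet> (\<iota> (i + n) \<bullet> (g1 \<boxplus> g2))"
          using comp_add[OF g1 g2 \<iota>[OF m]] comp_add[OF arrow_comp[OF g1 \<iota>[OF m]] arrow_comp[OF g2 \<iota>[OF m]] exa(2)] by simp
        finally show ?case using m arrow_add[OF g1 g2] by blast
      qed
      then obtain n g where n: "n \<ge> 1" and g: "\<guillemotleft>g : D \<rightarrow> K n\<guillemotright>" "h = p \<bullet> (\<iota> n \<bullet> g)" using l(2) by blast
      have "e n \<bullet> g = Zer T D M" using \<phi>p\<iota>[OF n g(1)] g(2) \<phi>h by simp
      then obtain k where k: "trans K u n k \<bullet> g = Zer T D (K (n + k))" using hom0[OF n g(1)] by blast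
      have nk: "n + k \<ge> 1" using n by simp
      show "h = Zer T D H" unfolding g(2) p\<iota>[OF n g(1), of k] k comp_zero[OF \<iota>[OF nk] DO] by (rule comp_zero[OF exa(2) DO])
    qed
  qed
  then show ?thesis using \<phi>(1) by blast
qed

lemma koszul_hocolim_exists:
  fixes \<kappa> :: "'i rel"
  assumes \<kappa>: "uncountable_cardinal \<kappa>" and c: "has_small_coproducts \<kappa> T" and M: "M \<in> Ob T"
    and sys: "koszul_system M s K u e"
  shows "\<exists>H. is_hocolim T K u H"
proof -
  note ar = koszul_systemD[OF sys M]
  obtain P \<iota> where cp: "is_coproduct T {1..} K P \<iota>"
    using coproduct_nat[OF \<kappa> c, of "{1..}" K] ar(1) by auto
  have P: "P \<in> Ob T" by (rule coproduct_arrow(1)[OF cp])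
  have "\<guillemotleft>\<iota> (Suc n) \<bullet> u n : K n \<rightarrow> P\<guillemotright>" if "n \<in> {1..}" for n
    using arrow_comp[OF ar(2) coproduct_arrow(3)[OF cp, of "Suc n"]] that by simp
  then obtain \<sigma> where \<sigma>: "\<guillemotleft>\<sigma> : P \<rightarrow> P\<guillemotright>" "\<And>n. n \<in> {1..} \<Longrightarrow> \<sigma> \<bullet> \<iota> n = \<iota> (Suc n) \<bullet> u n"
    using coproduct_desc[OF cp P, where h = "\<lambda>n. \<iota> (Suc n) \<bullet> u n"] by blast
  obtain H p q where ex: "(P, P, H, Ident T P \<boxplus> Neg T P P \<sigma>, p, q) \<in> Exact T"
    using exact_cone[OF arrow_add[OF arrow_ident[OF P] arrow_neg[OF \<sigma>(1)]]] .
  have "is_hocolim T K u H"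
    unfolding is_hocolim_def
  proof (intro conjI allI impI exI)
    show "K n \<in> Ob T" if "1 \<le> n" for n by (rule ar(1)[OF that])
    show "u n \<in> Hom T (K n) (K (n + 1))" if "1 \<le> n" for n using arrowD(3)[OF ar(2)[OF that]] by simp
    show "is_coproduct T {1..} K P \<iota>" by (rule cp)
    show "\<sigma> \<in> Hom T P P" by (rule arrowD(3)[OF \<sigma>(1)])
    show "\<sigma> \<bullet> \<iota> n = \<iota> (n + 1) \<bullet> u n" if "1 \<le> n" for n using \<sigma>(2) that by simp
    show "(P, P, H, Ident T P \<boxplus> Neg T P P \<sigma>, p, q) \<in> Exact T" by (rule ex)
  qed
  then show ?thesis by blast
qed

end

section \<open>Support of the endomorphism ring\<close>

context koszul
begin

text \<open>The compact objects on which every \<open>x i\<close> acts nilpotently.\<close>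

definition torsion_compact where
  "torsion_compact \<kappa> = {D. compact_object \<kappa> T D \<and> (\<forall>i\<in>{1..t}. nilpotent i D)}"

text \<open>The localization of \<open>End(D)\<close> at \<open>\<pp>\<close> vanishes if and only if a homogeneous element outside \<open>\<pp>\<close>
  annihilates \<open>D\<close>; here any two fractions are related, so there is only one class.\<close>

lemma End_localized_zero_if_kills:
  assumes D: "D \<in> Ob T" and p: "\<pp> \<in> graded_Spec R" and c: "c \<in> grading R m" "c \<notin> \<pp>" and k: "kills m c D"
  shows "End_localized R T \<Phi> \<pp> D n = {End_localized_zero R T \<Phi> \<pp> D n}"
proof -
  let ?A = "End_fractions R T \<pp> D n" and ?r = "End_fraction_rel R T \<Phi> \<pp> D n"
  note prime = graded_primeD[OF p]
  have rel: "(q, q') \<in> ?r" if q: "q \<in> ?A" and q': "q' \<in> ?A" for q q'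
  proof -
    obtain k' s f where q_eq: "q = (k', s, f)" and s: "s \<in> grading R k'" "s \<notin> \<pp>" and fH: "f \<in> Hom T D (susp_ob T (n + k') D)"
      using q unfolding End_fractions_def by blast
    obtain l z g where q'_eq: "q' = (l, z, g)" and z: "z \<in> grading R l" "z \<notin> \<pp>" and gH: "g \<in> Hom T D (susp_ob T (n + l) D)"
      using q' unfolding End_fractions_def by blast
    note f = arrowI[OF D Sob_closed[OF D] fH] and g = arrowI[OF D Sob_closed[OF D] gH]
    \<comment> \<open>The element \<open>s'\<close> is \<open>s\<close> up to sign.\<close>
    obtain s' where s': "s' \<in> grading R k'" "z \<otimes>\<^bsub>R\<^esub> s = s' \<otimes>\<^bsub>R\<^esub> z"
    proof (cases "even (l * k')")
      case True
      then show ?thesis using that[OF s(1)] graded_commute[OF z(1) s(1)] by simp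
    next
      case False
      then show ?thesis
        using that[OF grading_neg[OF s(1)]] graded_commute[OF z(1) s(1)] grading_carrier[OF s(1)] grading_carrier[OF z(1)]
        by (simp add: l_minus)
    qed
    let ?a = "c \<otimes>\<^bsub>R\<^esub> z" and ?b = "c \<otimes>\<^bsub>R\<^esub> s'"
    have a: "?a \<in> grading R (m + l)" and b: "?b \<in> grading R (m + k')" using grading_mult c(1) z(1) s'(1) by blast+
    have eq: "?a \<otimes>\<^bsub>R\<^esub> s = ?b \<otimes>\<^bsub>R\<^esub> z"
      using s' c(1) z(1) s(1) by (simp add: m_assoc grading_carrier)
    have "?a \<notin> \<pp>" using prime(3)[OF c(1) z(1)] c(2) z(2) by blast
    then have nin: "?a \<otimes>\<^bsub>R\<^esub> s \<notin> \<pp>" using prime(3)[OF a s(1)] s(2) by blast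
    have ka: "kills (m + l) ?a D" and kb: "kills (m + k') ?b D" using kills_mult[OF c(1) _ D] z(1) s'(1) k by blast+
    have "\<Phi> (m + l) ?a (Sob (n + k') D) \<bullet> f = Zer T D (Sob (m + l) (Sob (n + k') D))"
      by (rule kills_source[OF a ka f])
    moreover have "\<Phi> (m + k') ?b (Sob (n + l) D) \<bullet> g = Zer T D (Sob (m + k') (Sob (n + l) D))"
      by (rule kills_source[OF b kb g])
    ultimately have "\<Phi> (m + l) ?a (Sob (n + k') D) \<bullet> f = \<Phi> (m + k') ?b (Sob (n + l) D) \<bullet> g"
      using D by (simp add: Sob_add algebra_simps)
    then have "\<exists>i j a b. a \<in> grading R i \<and> b \<in> grading R j \<and> i + k' = j + l \<and>
           a \<otimes>\<^bsub>R\<^esub> s = b \<otimes>\<^bsub>R\<^esub> z \<and> a \<otimes>\<^bsub>R\<^esub> s \<notin> \<pp> \<and>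
           \<Phi> i a (susp_ob T (n + k') D) \<bullet> f = \<Phi> j b (susp_ob T (n + l) D) \<bullet> g"
      using a b eq nin by (intro exI[of _ "m + l"] exI[of _ "m + k'"] exI[of _ ?a] exI[of _ ?b]) simp
    then show ?thesis using q q' unfolding End_fraction_rel_def q_eq q'_eq by blast
  qed
  have z0: "(0, \<one>\<^bsub>R\<^esub>, Zer T D (susp_ob T n D)) \<in> ?A"
    unfolding End_fractions_def using grading_one prime(2) arrowD(3)[OF arrow_zero[OF D Sob_closed[OF D, of n]]] by simp
  have sub: "?r \<subseteq> ?A \<times> ?A" unfolding End_fraction_rel_def by blast
  have cls: "?r `` {q} = ?A" if "q \<in> ?A" for q using rel[OF that] sub by blast
  show ?thesis unfolding End_localized_def End_localized_zero_def quotient_def using cls cls[OF z0] z0 by blast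
qed

text \<open>For the converse, compare the fraction of the identity with zero.\<close>

lemma kills_if_End_localized_zero:
  assumes D: "D \<in> Ob T" and p: "\<pp> \<in> graded_Spec R"
    and 0: "End_localized R T \<Phi> \<pp> D 0 = {End_localized_zero R T \<Phi> \<pp> D 0}"
  obtains m c where "c \<in> grading R m" "c \<notin> \<pp>" "kills m c D"
proof -
  let ?A = "End_fractions R T \<pp> D 0" and ?r = "End_fraction_rel R T \<Phi> \<pp> D 0"
  note prime = graded_primeD[OF p]
  let ?q = "(0::int, \<one>\<^bsub>R\<^esub>, Ident T D)"
  have q: "?q \<in> ?A" unfolding End_fractions_def using grading_one prime(2) Ident_closed[OF D] by (simp add: Sob_0)
  have "(?q, ?q) \<in> ?r" unfolding End_fraction_rel_def
    using q grading_one prime(2) by (auto intro!: exI[of _ "0::int"] exI[of _ "\<one>\<^bsub>R\<^esub>"])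
  moreover have "?r `` {?q} = ?r `` {(0, \<one>\<^bsub>R\<^esub>, Zer T D (susp_ob T 0 D))}"
    using 0 q quotientI[OF q, of ?r] unfolding End_localized_def End_localized_zero_def by simp
  ultimately have "((0, \<one>\<^bsub>R\<^esub>, Zer T D (susp_ob T 0 D)), ?q) \<in> ?r" by blast
  then obtain i j a b where ab: "a \<in> grading R i" "b \<in> grading R j" "i + 0 = j + 0"
      "a \<otimes>\<^bsub>R\<^esub> \<one>\<^bsub>R\<^esub> = b \<otimes>\<^bsub>R\<^esub> \<one>\<^bsub>R\<^esub>" "a \<otimes>\<^bsub>R\<^esub> \<one>\<^bsub>R\<^esub> \<notin> \<pp>"
      "\<Phi> i a (susp_ob T (0 + 0) D) \<bullet> Zer T D (susp_ob T 0 D) = \<Phi> j b (susp_ob T (0 + 0) D) \<bullet> Ident T D"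
    unfolding End_fraction_rel_def by blast
  have eq: "a = b" "i = j" using ab(1-4) grading_carrier by simp_all
  have np: "a \<notin> \<pp>" using ab(1,5) grading_carrier by simp
  have "\<Phi> i a D \<bullet> Zer T D D = \<Phi> i a D \<bullet> Ident T D" using ab(6) eq by (simp add: Sob_0)
  then have "kills i a D"
    unfolding kills_def using comp_ident[OF act_arrow[OF ab(1) D]] comp_zero[OF act_arrow[OF ab(1) D] D] by simp
  then show ?thesis by (rule that[OF ab(1) np])
qed

lemma graded_annihilator:
  assumes D: "D \<in> Ob T" shows "graded_ideal {(n, a). a \<in> grading R n \<and> kills n a D}"
  unfolding graded_ideal_def
proof (intro conjI allI impI)
  fix n show "(n, \<zero>\<^bsub>R\<^esub>) \<in> {(n, a). a \<in> grading R n \<and> kills n a D}"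
    using grading_zero kills_zero[OF D] by simp
next
  fix n a b
  assume "(n, a) \<in> {(n, a). a \<in> grading R n \<and> kills n a D} \<and> (n, b) \<in> {(n, a). a \<in> grading R n \<and> kills n a D}"
  then show "(n, a \<oplus>\<^bsub>R\<^esub> b) \<in> {(n, a). a \<in> grading R n \<and> kills n a D}"
    using grading_add kills_add[OF _ _ D] by simp
next
  fix m n r a assume "r \<in> grading R m \<and> (n, a) \<in> {(n, a). a \<in> grading R n \<and> kills n a D}"
  then show "(m + n, r \<otimes>\<^bsub>R\<^esub> a) \<in> {(n, a). a \<in> grading R n \<and> kills n a D}"
    using grading_mult kills_mult[OF _ _ D] by simp
qed simp

text \<open>These are the compact objects whose endomorphism ring is supported on \<open>\<V>(x 1, \<dots>, x t)\<close>.\<close>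

lemma torsion_compact_eq:
  "{D. compact_object \<kappa> T D \<and> (\<forall>\<pp> \<in> graded_Spec R - closed_locus R (Idl\<^bsub>R\<^esub> (x ` {1..t})).
     \<forall>n. End_localized R T \<Phi> \<pp> D n = {End_localized_zero R T \<Phi> \<pp> D n})} = torsion_compact \<kappa>"
proof -
  have sub: "x ` {1..t} \<subseteq> carrier R" using x_carrier by blast
  have "(\<forall>\<pp> \<in> graded_Spec R - closed_locus R (Idl\<^bsub>R\<^esub> (x ` {1..t})).
     \<forall>n. End_localized R T \<Phi> \<pp> D n = {End_localized_zero R T \<Phi> \<pp> D n}) \<longleftrightarrow> (\<forall>i\<in>{1..t}. nilpotent i D)"
    (is "?E D \<longleftrightarrow> ?N D") if D: "D \<in> Ob T" for D
  proof
    assume N: "?N D"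
    show "?E D"
    proof (intro ballI allI)
      fix \<pp> n assume p: "\<pp> \<in> graded_Spec R - closed_locus R (Idl\<^bsub>R\<^esub> (x ` {1..t}))"
      then have pS: "\<pp> \<in> graded_Spec R" by blast
      have "\<not> x ` {1..t} \<subseteq> \<pp>" using p genideal_minimal[OF graded_primeD(1)[OF pS]] unfolding closed_locus_def by blast
      then obtain i where i: "i \<in> {1..t}" "x i \<notin> \<pp>" by blast
      obtain k where k: "xkills i k D" using N i(1) unfolding nilpotent_def by blast
      show "End_localized R T \<Phi> \<pp> D n = {End_localized_zero R T \<Phi> \<pp> D n}"
        by (rule End_localized_zero_if_kills[OF D pS pow_grading[OF i(1)] graded_prime_pow[OF pS x_grading[OF i(1)] i(2)] k])
    qed
  next
    assume E: "?E D"
    show "?N D"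
    proof (rule ballI, rule ccontr)
      fix i assume i: "i \<in> {1..t}" and nn: "\<not> nilpotent i D"
      have av: "(int N * d i, x i [^]\<^bsub>R\<^esub> N) \<notin> {(n, a). a \<in> grading R n \<and> kills n a D}" for N :: nat
        using nn unfolding nilpotent_def by blast
      obtain \<pp> where p: "\<pp> \<in> graded_Spec R" "x i \<notin> \<pp>"
        "snd ` {(n, a). a \<in> grading R n \<and> kills n a D} \<subseteq> \<pp>"
        by (rule graded_prime_avoiding_powers[OF graded_annihilator[OF D] x_grading[OF i] av])
      have "x i \<in> Idl\<^bsub>R\<^esub> (x ` {1..t})" using genideal_self[OF sub] i by blast
      then have "\<pp> \<notin> closed_locus R (Idl\<^bsub>R\<^esub> (x ` {1..t}))" using p(2) unfolding closed_locus_def by blast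
      then have "End_localized R T \<Phi> \<pp> D 0 = {End_localized_zero R T \<Phi> \<pp> D 0}" using E p(1) by blast
      then obtain m c where "c \<in> grading R m" "c \<notin> \<pp>" "kills m c D" by (rule kills_if_End_localized_zero[OF D p(1)])
      then show False using p(3) by force
    qed
  qed
  note eq = this
  show ?thesis
    unfolding torsion_compact_def
    by (rule Collect_cong, rule conj_cong[OF refl], rule eq, rule compactD(1))
qed


section \<open>Local cohomology\<close>

lemma torsion_compact_shift: "D \<in> torsion_compact \<kappa> \<Longrightarrow> Sob n D \<in> torsion_compact \<kappa>"
  unfolding torsion_compact_def using compact_shift nilpotent_shift compactD(1) by blast

lemma torsion_compact_Ob: "torsion_compact \<kappa> \<subseteq> Ob T"
  unfolding torsion_compact_def using compactD(1) by blast

lemma Loc_torsion_localizing: "localizing_subcategory \<kappa> T (Loc \<kappa> T (torsion_compact \<kappa>))"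
  by (rule Loc_localizing[OF torsion_compact_Ob])

lemma koszul_system_torsion_compact:
  assumes M: "compact_object \<kappa> T M" and sys: "koszul_system M t K u e" and n: "n \<ge> 1"
  shows "K n \<in> torsion_compact \<kappa>"
  using koszul_system_compact[OF M sys] koszul_system_nilpotent[OF compactD(1)[OF M] sys order_refl] n
  unfolding torsion_compact_def by blast

lemma hocolim_coreflection:
  assumes \<kappa>: "uncountable_cardinal \<kappa>" and M: "M \<in> Ob T" and sys: "koszul_system M t K u e"
    and H: "is_hocolim T K u H" and K: "\<And>n. n \<ge> 1 \<Longrightarrow> K n \<in> Loc \<kappa> T (torsion_compact \<kappa>)"
  shows "\<exists>\<phi>. coreflection (Loc \<kappa> T (torsion_compact \<kappa>)) \<phi> H M"
proof -
  obtain \<phi> where \<phi>: "\<guillemotleft>\<phi> : H \<rightarrow> M\<guillemotright>" "\<And>D. D \<in> torsion_compact \<kappa> \<Longrightarrow> hom_bij \<phi> H M D"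
    using koszul_hocolim[OF \<kappa> M sys H] unfolding torsion_compact_def by blast
  have "H \<in> Loc \<kappa> T (torsion_compact \<kappa>)" by (rule hocolim_localizing[OF \<kappa> Loc_torsion_localizing H K])
  then have "coreflection (Loc \<kappa> T (torsion_compact \<kappa>)) \<phi> H M"
    unfolding coreflection_def using hom_bij_Loc[OF torsion_compact_Ob torsion_compact_shift \<phi>] \<phi>(1) by blast
  then show ?thesis by blast
qed

lemma coreflection_exists:
  assumes \<kappa>: "uncountable_cardinal \<kappa>" and cg: "compactly_generated \<kappa> T" and X: "X \<in> Ob T"
  shows "\<exists>A \<epsilon>. coreflection (Loc \<kappa> T (torsion_compact \<kappa>)) \<epsilon> A X"
proof -
  let ?L = "Loc \<kappa> T (torsion_compact \<kappa>)"
  have c: "has_small_coproducts \<kappa> T" using cg unfolding compactly_generated_def by blast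
  obtain S where S: "\<forall>C\<in>S. compact_object \<kappa> T C" "Loc \<kappa> T S = Ob T" using cg unfolding compactly_generated_def by blast
  have "localizing_subcategory \<kappa> T {X \<in> Ob T. \<exists>A \<epsilon>. coreflection ?L \<epsilon> A X}"
    by (rule coreflective_localizing[OF c _ torsion_compact_shift]) (simp add: torsion_compact_def)
  moreover have "S \<subseteq> {X \<in> Ob T. \<exists>A \<epsilon>. coreflection ?L \<epsilon> A X}"
  proof
    fix C assume "C \<in> S"
    then have C: "compact_object \<kappa> T C" using S(1) by blast
    then have CO: "C \<in> Ob T" by (rule compactD(1))
    obtain K u e where sys: "koszul_system C t K u e" using koszul_system_exists[OF CO order_refl] by blast
    obtain H where H: "is_hocolim T K u H" using koszul_hocolim_exists[OF \<kappa> c CO sys] by blast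
    have "K n \<in> ?L" if "n \<ge> 1" for n using koszul_system_torsion_compact[OF C sys that] Loc_incl by blast
    then have "\<exists>\<phi>. coreflection ?L \<phi> H C" by (rule hocolim_coreflection[OF \<kappa> CO sys H])
    then show "C \<in> {X \<in> Ob T. \<exists>A \<epsilon>. coreflection ?L \<epsilon> A X}" using CO by blast
  qed
  ultimately have "Loc \<kappa> T S \<subseteq> {X \<in> Ob T. \<exists>A \<epsilon>. coreflection ?L \<epsilon> A X}" by (rule Loc_least)
  then show ?thesis using S(2) X by blast
qed

text \<open>If powers of all \<open>x i\<close> annihilate \<open>Y\<close>, they annihilate the cone \<open>B\<close> of the coreflection
  \<open>A \<rightarrow> Y\<close>.  Since \<open>B\<close> receives no nonzero morphisms from Koszul objects on compact objects, it
  receives none from compact objects.  So it vanishes.\<close>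

lemma nilpotent_in_Loc:
  assumes \<kappa>: "uncountable_cardinal \<kappa>" and cg: "compactly_generated \<kappa> T" and Y: "Y \<in> Ob T"
    and nil: "\<And>i. i \<in> {1..t} \<Longrightarrow> nilpotent i Y"
  shows "Y \<in> Loc \<kappa> T (torsion_compact \<kappa>)"
proof -
  let ?L = "Loc \<kappa> T (torsion_compact \<kappa>)"
  note L = Loc_torsion_localizing[of \<kappa>]
  have LO: "D \<in> Ob T" if "D \<in> ?L" for D using localizingD(1)[OF L] that by blast
  obtain S where S: "\<forall>C\<in>S. compact_object \<kappa> T C" "Loc \<kappa> T S = Ob T" using cg unfolding compactly_generated_def by blast
  obtain A \<epsilon> where "coreflection ?L \<epsilon> A Y" using coreflection_exists[OF \<kappa> cg Y] by blast
  then have A: "A \<in> ?L" and \<epsilon>: "\<guillemotleft>\<epsilon> : A \<rightarrow> Y\<guillemotright>" and hb: "\<And>D. D \<in> ?L \<Longrightarrow> hom_bij \<epsilon> A Y D" unfolding coreflection_def by blast+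
  obtain B v w where ex: "(A, Y, B, \<epsilon>, v, w) \<in> Exact T" using exact_cone[OF \<epsilon>] .
  note ar = exact_arrows[OF ex]
  have B: "B \<in> Ob T" by (rule arrowD(2)[OF ar(2)])
  have oB: "orth D (Sob n B)" if D: "D \<in> ?L" for D n
  proof (rule orth_shift[OF _ B])
    note D' = localizing_shift[OF L D, of "- n"]
    show "orth (Sob (- n) D) B"
      by (rule hom_bij_cone[OF ex hb[OF D'] hb[OF localizing_shift[OF L D']] LO[OF D']])
  qed
  have "\<forall>i\<in>{1..t}. \<exists>n. xkills i n Y" using nil unfolding nilpotent_def by blast
  then obtain \<nu> where \<nu>: "\<And>i. i \<in> {1..t} \<Longrightarrow> xkills i (\<nu> i) Y" by metis
  \<comment> \<open>A common exponent; it must be positive because the systems are indexed by \<open>n \<ge> 1\<close>.\<close>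
  define N where "N = Suc (sum \<nu> {1..t})"
  have N: "N \<ge> 1" by (simp add: N_def)
  have kB: "xkills i N B" if i: "i \<in> {1..t}" for i
  proof -
    have "\<nu> i \<le> N" unfolding N_def using member_le_sum[OF i, of \<nu>] by simp
    then have kY: "xkills i N Y" by (rule xkills_mono[OF i Y \<nu>[OF i]])
    have "xact i N B \<bullet> v = Zer T Y (Sob (int N * d i) B)" by (rule kills_source[OF pow_grading[OF i] kY ar(2)])
    then obtain k where k: "\<guillemotleft>k : Sob 1 A \<rightarrow> Sob (int N * d i) B\<guillemotright>" "k \<bullet> w = xact i N B"
      by (rule cohom_exact3[OF ex xact_arrow[OF i B]])
    have "k = Zer T (Sob 1 A) (Sob (int N * d i) B)" by (rule orthD[OF oB[OF localizing_shift[OF L A]] k(1)])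
    then show ?thesis unfolding kills_def using k(2) zero_comp[OF ar(3) Sob_closed[OF B]] by simp
  qed
  have oS: "orth C (Sob n B)" if "C \<in> S" for C n
  proof -
    have C: "compact_object \<kappa> T C" using S(1) that by blast
    then have CO: "C \<in> Ob T" by (rule compactD(1))
    obtain K u e where sys: "koszul_system C t K u e" using koszul_system_exists[OF CO order_refl] by blast
    have KN: "K N \<in> ?L" using koszul_system_torsion_compact[OF C sys N] Loc_incl by blast
    show ?thesis
    proof (rule koszul_system_orth[OF CO N Sob_closed[OF B] sys order_refl _ oB[OF KN]])
      show "xkills i N (Sob n B)" if "i \<in> {1..t}" for i using kB[OF that] kills_shift[OF pow_grading[OF that] B] by blast
    qed
  qed
  have SO: "S \<subseteq> Ob T" using S(1) compactD(1) by blast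
  have "orth B (Sob 0 B)" using orth_Loc[OF SO B oS, where \<kappa> = \<kappa>] S(2) B by blast
  then have "Ident T B = Zer T B B" using orthD arrow_ident[OF B] by (simp add: Sob_0)
  then have "B \<in> ?L" using localizing_zero[OF L zero_objectI[OF B]] by blast
  then show ?thesis by (rule localizing_fibre[OF L exact_rotate[OF ex] _ localizing_shift[OF L A]])
qed

lemma is_Koszul_system_imp_koszul_system:
  assumes M: "M \<in> Ob T" and sys: "is_Koszul_system R T \<Phi> M t x d C a b u"
  shows "s \<le> t \<Longrightarrow> \<exists>e. koszul_system M s (\<lambda>n. susp_ob T (- int s) (C s n)) (u s) e"
proof (induction s)
  note sys' = sys[unfolded is_Koszul_system_def Let_def]
  case 0
  have "C 0 n = M \<and> u 0 n = Ident T M" if "n \<ge> 1" for n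
    using sys' that unfolding is_Koszul_tower_def by blast
  then have "koszul_system M 0 (\<lambda>n. susp_ob T (- int 0) (C 0 n)) (u 0) (\<lambda>_. Ident T M)"
    by (intro koszul_system.base) (simp add: Sob_0)
  then show ?case by blast
next
  note sys' = sys[unfolded is_Koszul_system_def Let_def]
  case (Suc s)
  then obtain e where e: "koszul_system M s (\<lambda>n. susp_ob T (- int s) (C s n)) (u s) e" by auto
  have S: "Suc s \<in> {1..t}" using Suc by simp
  let ?K = "\<lambda>s n. susp_ob T (- int s) (C s n)"
  have ex: "(?K (Suc s) n, ?K s n, Sob (int n * d (Suc s)) (?K s n), a (Suc s) n, xact (Suc s) n (?K s n), b (Suc s) n) \<in> Exact T"
    if "n \<ge> 1" for n
    using sys'[THEN conjunct2, THEN conjunct1, rule_format, OF S that] by simp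
  have mor: "is_triangle_morphism T
      (?K (Suc s) n, ?K s n, Sob (int n * d (Suc s)) (?K s n), a (Suc s) n, xact (Suc s) n (?K s n), b (Suc s) n)
      (?K (Suc s) (n + 1), ?K s (n + 1), Sob (int (n + 1) * d (Suc s)) (?K s (n + 1)), a (Suc s) (n + 1),
        xact (Suc s) (n + 1) (?K s (n + 1)), b (Suc s) (n + 1))
      (u (Suc s) n, u s n, \<Phi> (d (Suc s)) (x (Suc s)) (Sob (int n * d (Suc s)) (?K s (n + 1))) \<bullet> Sh (int n * d (Suc s)) (u s n))"
    if "n \<ge> 1" for n
    using sys'[THEN conjunct2, THEN conjunct2, THEN conjunct2, rule_format, OF S that] by (simp only: diff_Suc_1)
  have "koszul_step (Suc s) (?K s) (u s) (?K (Suc s)) (a (Suc s)) (b (Suc s)) (u (Suc s))"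
    unfolding koszul_step_def
  proof (intro allI impI)
    fix n :: nat assume n: "1 \<le> n"
    have n': "1 \<le> Suc n" by simp
    note m = mor[OF n, unfolded is_triangle_morphism.simps Susp_eq Suc_eq_plus1[symmetric]]
    have K': "?K (Suc s) n \<in> Ob T" "?K (Suc s) (Suc n) \<in> Ob T"
      using arrowD(1)[OF exact_arrows(1)[OF ex[OF n]]] arrowD(1)[OF exact_arrows(1)[OF ex[OF n']]] .
    show "(?K (Suc s) n, ?K s n, Sob (int n * d (Suc s)) (?K s n), a (Suc s) n, xact (Suc s) n (?K s n), b (Suc s) n) \<in> Exact T \<and>
     \<guillemotleft>u (Suc s) n : ?K (Suc s) n \<rightarrow> ?K (Suc s) (Suc n)\<guillemotright> \<and> u s n \<bullet> a (Suc s) n = a (Suc s) (Suc n) \<bullet> u (Suc s) n \<and>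
     Sh 1 (u (Suc s) n) \<bullet> b (Suc s) n = b (Suc s) (Suc n) \<bullet>
       (\<Phi> (d (Suc s)) (x (Suc s)) (Sob (int n * d (Suc s)) (?K s (Suc n))) \<bullet> Sh (int n * d (Suc s)) (u s n))"
      using m ex[OF n] arrowI[OF K'] by blast
  qed
  then have "koszul_system M (Suc s) (?K (Suc s)) (u (Suc s)) (\<lambda>n. e n \<bullet> a (Suc s) n)"
    by (rule koszul_system.step[OF e _ refl])
  then show ?case by blast
qed

end

theorem theoremC:
  fixes \<kappa> :: "'i rel"
    and R :: "('r, 'y) graded_ring_scheme"
    and T :: "('o, 'm, 'z) tcat_scheme"
    and \<Phi> :: "int \<Rightarrow> 'r \<Rightarrow> 'o \<Rightarrow> 'm"
    and M H :: 'o
    and t :: nat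
    and x :: "nat \<Rightarrow> 'r"
    and d :: "nat \<Rightarrow> int"
    and C :: "nat \<Rightarrow> nat \<Rightarrow> 'o"
    and a b u :: "nat \<Rightarrow> nat \<Rightarrow> 'm"
  assumes "graded_commutative_ring R" and "graded_noetherian R"
    and "uncountable_cardinal \<kappa>"
    and "triangulated_category T" and "compactly_generated \<kappa> T"
    and "linear_triangulated_category R T \<Phi>"
    and "M \<in> Ob T"
    and "\<forall>i \<in> {1..t}. x i \<in> grading R (d i)"
    and "is_Koszul_system R T \<Phi> M t x d C a b u"
    and "is_hocolim T (\<lambda>n. susp_ob T (- int t) (C t n)) (u t) H"
  shows "isomorphic T H
           (onOb (Gamma \<kappa> R T \<Phi> (closed_locus R (Idl\<^bsub>R\<^esub> (x ` {1..t})))) M)"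
proof -
  interpret koszul R T \<Phi> t x d
    using assms(6,8) by (intro koszul.intro graded_action.intro koszul_axioms.intro) blast+
  let ?L = "Loc \<kappa> T (torsion_compact \<kappa>)"
  let ?K = "\<lambda>n. susp_ob T (- int t) (C t n)"
  have L: "local_subcategory \<kappa> R T \<Phi> (closed_locus R (Idl\<^bsub>R\<^esub> (x ` {1..t}))) = ?L"
    unfolding local_subcategory_def torsion_compact_eq ..
  have LO: "?L \<subseteq> Ob T" by (rule localizingD(1)[OF Loc_torsion_localizing])
  obtain e where sys: "koszul_system M t ?K (u t) e"
    using is_Koszul_system_imp_koszul_system[OF assms(7,9) order_refl] by blast
  have "?K n \<in> ?L" if n: "n \<ge> 1" for n
    by (rule nilpotent_in_Loc[OF assms(3,5) koszul_systemD(1)[OF sys assms(7) n]])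
      (use koszul_system_nilpotent[OF assms(7) sys order_refl] n in blast)
  then obtain \<phi> where \<phi>: "coreflection ?L \<phi> H M"
    using hocolim_coreflection[OF assms(3,7) sys assms(10)] by blast
  define G :: "('o, 'm, 'o, 'm) ftor" where "G = (SOME G. adjoint (full_subcategory T ?L) T inclusion G)"
  have "adjoint (full_subcategory T ?L) T inclusion G"
    unfolding G_def using right_adjoint_exists[OF LO coreflection_exists[OF assms(3,5)]] by (rule someI_ex)
  then have "isomorphic T H (onOb G M)" by (rule coreflection_right_adjoint[OF LO _ assms(7) \<phi>])
  then show ?thesis
    unfolding Gamma_def L G_def compose_functor_def inclusion_def by simp
qed

end
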